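(* Let $\mathcal{H}$ be a Hilbert space, $p,q\in\{1,\ldots,n\}$ with $p\neq q$, and let $X=(X_1,\ldots,X_n)$ be a tuple of commuting pure contractions on $\mathcal{H}$ which belongs to $\mathcal{X}^n_{p,q}(\mathcal{H})$ and has finite rank. Then there exist a Hilbert space $\mathcal{E}$ and inner polynomials $\Phi_p,\Phi_q\in H^\infty_{\mathcal{B}(\mathcal{E})}(\mathbb{D}^{n-1})$ of degree at most one satisfying $\Phi_p(\mathbf{z})\Phi_q(\mathbf{z})=\Phi_q(\mathbf{z})\Phi_p(\mathbf{z})=z_pI_{\mathcal{E}}$ for $\mathbf{z}\in\mathbb{D}^{n-1}$, such that $X$ dilates to the $n$-tuple of commuting pure isometries $V=(V_1,\ldots,V_n)$ on $H^2_{\mathcal{E}}(\mathbb{D}^{n-1})$ given by $V_p=M_{\Phi_p}$, $V_q=M_{\Phi_q}$, and $V_i=M_{z_i}$ for $i\in\{1,\ldots,n\}\setminus\{p,q\}$, where the $n-1$ coordinates of $\mathbb{D}^{n-1}$ are labelled by $\{1,\ldots,n\}\setminus\{q\}$.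
   Context: A contraction $T$ is pure if $T^{*m}\to0$ in the strong operator topology; a pure isometry is an isometry that is a pure contraction; a tuple is pure if each of its entries is a pure contraction. $\mathcal{X}^n(\mathcal{H})$ is the set of $n$-tuples of commuting contractions on $\mathcal{H}$. For $X\in\mathcal{X}^n(\mathcal{H})$ and $i\in\{1,\ldots,n\}$, $\hat X_i=(X_1,\ldots,X_{i-1},X_{i+1},\ldots,X_n)$. For $Y\in\mathcal{X}^r(\mathcal{H})$, $\mathbb{S}_r^{-1}(Y,Y^* )=\sum_{F\subseteq\{1,\ldots,r\}}(-1)^{|F|}Y_FY_F^*$ with $Y_F=\prod_{j\in F}Y_j$, $Y_\emptyset=I$ (obtained from the reciprocal $\prod_{i=1}^r(1-z_i\bar w_i)$ of the Szeg\H{o} kernel), and $\mathbb{S}_r(\mathcal{H})=\{Y\in\mathcal{X}^r(\mathcal{H}):\mathbb{S}_r^{-1}(Y,Y^* )\ge0\}$. For $p\ne q$, $\mathcal{X}^n_{p,q}(\mathcal{H})=\{X\in\mathcal{X}^n(\mathcal{H}):\hat X_p,\hat X_q\in\mathbb{S}_{n-1}(\mathcal{H})\text{ and }\hat X_p\text{ is pure}\}$. Such $X$ has finite rank if $\mathcal{D}_{\hat X_i}=\overline{\mathrm{ran}}\,\mathbb{S}_{n-1}^{-1}(\hat X_i,\hat X_i^* )^{1/2}$ is finite dimensional for $i=p,q$. $H^2_{\mathcal{E}}(\mathbb{D}^{n-1})$ is the $\mathcal{E}$-valued Hardy space on the polydisc (kernel $\prod_i(1-z_i\bar w_i)^{-1}I_{\mathcal{E}}$),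 $H^\infty_{\mathcal{B}(\mathcal{E})}(\mathbb{D}^{n-1})$ is the space of bounded analytic $\mathcal{B}(\mathcal{E})$-valued functions, $M_\Phi$ is multiplication by $\Phi$, and $\Phi$ is inner if $M_\Phi$ is an isometry. $X$ dilates to $V$ on $\mathcal{K}$ if there is an isometry $\Pi:\mathcal{H}\to\mathcal{K}$ with $\Pi X_i^*=V_i^*\Pi$ for all $i\in\{1,\ldots,n\}$. *)

theory Defs
  imports "HOL-Analysis.Analysis"
begin

section \<open>Complex inner product spaces and Hilbert spaces\<close>

class scaleC =
  fixes scaleC :: "complex \<Rightarrow> 'a \<Rightarrow> 'a"  (infixr \<open>*\<^sub>C\<close> 75)

class complex_inner = real_normed_vector + scaleC +
  fixes cinner :: "'a \<Rightarrow> 'a \<Rightarrow> complex"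
  assumes scaleC_add_right: "c *\<^sub>C (x + y) = c *\<^sub>C x + c *\<^sub>C y"
    and scaleC_add_left: "(c + d) *\<^sub>C x = c *\<^sub>C x + d *\<^sub>C x"
    and scaleC_scaleC: "c *\<^sub>C d *\<^sub>C x = (c * d) *\<^sub>C x"
    and scaleC_of_real: "complex_of_real r *\<^sub>C x = r *\<^sub>R x"
    and cinner_commute: "cinner x y = cnj (cinner y x)"
    and cinner_add_left: "cinner (x + y) z = cinner x z + cinner y z"
    and cinner_scaleC_left: "cinner (c *\<^sub>C x) y = c * cinner x y"
    and cinner_self: "cinner x x = complex_of_real ((norm x)\<^sup>2)"

class complex_hilbert = complex_inner + banach

interpretation complex_vector: vector_space "scaleC :: complex \<Rightarrow> 'a \<Rightarrow> 'a::complex_inner"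
proof unfold_locales
  fix x :: 'a
  show "1 *\<^sub>C x = x"
    using scaleC_of_real[of 1 x] by simp
qed (simp_all add: scaleC_add_right scaleC_add_left scaleC_scaleC)

lemma cinner_add_right: "cinner x (y + z) = cinner x y + cinner x z"
  for x :: "'a::complex_inner"
  by (metis cinner_add_left cinner_commute complex_cnj_add)

lemma cinner_scaleC_right: "cinner x (c *\<^sub>C y) = cnj c * cinner x y"
  for x :: "'a::complex_inner"
  by (metis cinner_commute cinner_scaleC_left complex_cnj_mult)

lemma norm_scaleC: "norm (c *\<^sub>C x) = cmod c * norm x"
  for x :: "'a::complex_inner"
proof -
  have "complex_of_real ((norm (c *\<^sub>C x))\<^sup>2) = (c * cnj c) * cinner x x"
    unfolding cinner_self[symmetric] by (simp add: cinner_scaleC_left cinner_scaleC_right)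
  also have "\<dots> = complex_of_real ((cmod c * norm x)\<^sup>2)"
    unfolding complex_norm_square[symmetric] cinner_self by (simp add: power_mult_distrib)
  finally have "(norm (c *\<^sub>C x))\<^sup>2 = (cmod c * norm x)\<^sup>2"
    using of_real_eq_iff by blast
  then show ?thesis
    by (simp add: power2_eq_iff_nonneg)
qed

lemma norm_cinner_le: "cmod (cinner x y) \<le> norm x * norm y"
  for x :: "'a::complex_inner"
proof (cases "y = 0")
  case True
  have "cinner x (0::'a) = 0"
    using cinner_add_right[of x 0 "0::'a"] by simp
  with True show ?thesis by simp
next
  case False
  define a where "a = cinner x y"
  define r where "r = (norm y)\<^sup>2"
  have r: "r > 0" using False by (simp add: r_def)
  define c where "c = - (a / complex_of_real r)"
  have yx: "cinner y x = cnj a" by (metis a_def cinner_commute)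
  have "cinner (x + c *\<^sub>C y) (x + c *\<^sub>C y)
      = cinner x x + cnj c * a + c * cnj a + c * cnj c * cinner y y"
    by (simp add: cinner_add_left cinner_add_right cinner_scaleC_left cinner_scaleC_right yx
        a_def[symmetric] algebra_simps)
  also have "\<dots> = cinner x x - a * cnj a / complex_of_real r"
    using r by (simp add: c_def cinner_self r_def[symmetric] field_simps)
  also have "\<dots> = complex_of_real ((norm x)\<^sup>2 - (cmod a)\<^sup>2 / r)"
    by (simp add: cinner_self complex_norm_square[symmetric])
  finally have "(norm (x + c *\<^sub>C y))\<^sup>2 = (norm x)\<^sup>2 - (cmod a)\<^sup>2 / r"
    using cinner_self of_real_eq_iff by metis
  then have "(cmod a)\<^sup>2 / r \<le> (norm x)\<^sup>2"
    by (metis diff_ge_0_iff_ge zero_le_power2)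
  then have "(cmod a)\<^sup>2 \<le> (norm x * norm y)\<^sup>2"
    using r by (simp add: field_simps r_def)
  then show ?thesis
    unfolding a_def by (rule power2_le_imp_le) simp
qed


section \<open>Square-summable families of vectors\<close>

typedef (overloaded) ('i, 'a) ell2 =
  "{f :: 'i \<Rightarrow> 'a::complex_inner. (\<lambda>i. (norm (f i))\<^sup>2) summable_on UNIV}"
  morphisms ell2_nth Abs_ell2
  by (rule exI[of _ "\<lambda>_. 0"]) simp

setup_lifting type_definition_ell2

lemma ell2_minkowski:
  fixes f g :: "'i \<Rightarrow> 'a::complex_inner"
  assumes f: "(\<lambda>i. (norm (f i))\<^sup>2) summable_on UNIV"
    and g: "(\<lambda>i. (norm (g i))\<^sup>2) summable_on UNIV"
  shows "(\<lambda>i. (norm (f i + g i))\<^sup>2) summable_on UNIV"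
    and "sqrt (\<Sum>\<^sub>\<infinity>i. (norm (f i + g i))\<^sup>2)
      \<le> sqrt (\<Sum>\<^sub>\<infinity>i. (norm (f i))\<^sup>2) + sqrt (\<Sum>\<^sub>\<infinity>i. (norm (g i))\<^sup>2)"
proof -
  let ?N = "\<lambda>h :: 'i \<Rightarrow> 'a. sqrt (\<Sum>\<^sub>\<infinity>i. (norm (h i))\<^sup>2)"
  have part: "L2_set (\<lambda>i. norm (h i)) F \<le> ?N h"
    if "(\<lambda>i. (norm (h i))\<^sup>2) summable_on UNIV" "finite F" for h :: "'i \<Rightarrow> 'a" and F
    unfolding L2_set_def
    by (rule real_sqrt_le_mono, rule finite_sum_le_infsum) (use that in auto)
  have bound: "(\<Sum>i\<in>F. (norm (f i + g i))\<^sup>2) \<le> (?N f + ?N g)\<^sup>2" if F: "finite F" for F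
  proof -
    have "L2_set (\<lambda>i. norm (f i + g i)) F \<le> L2_set (\<lambda>i. norm (f i) + norm (g i)) F"
      by (rule L2_set_mono) (auto intro: norm_triangle_ineq)
    also have "\<dots> \<le> L2_set (\<lambda>i. norm (f i)) F + L2_set (\<lambda>i. norm (g i)) F"
      by (rule L2_set_triangle_ineq)
    also have "\<dots> \<le> ?N f + ?N g"
      using part[OF f F] part[OF g F] by simp
    finally have "(L2_set (\<lambda>i. norm (f i + g i)) F)\<^sup>2 \<le> (?N f + ?N g)\<^sup>2"
      by (rule power_mono) (simp add: L2_set_nonneg)
    then show ?thesis
      by (simp add: L2_set_def sum_nonneg)
  qed
  show summ: "(\<lambda>i. (norm (f i + g i))\<^sup>2) summable_on UNIV"
    by (rule nonneg_bdd_above_summable_on) (auto intro!: bdd_aboveI[of _ "(?N f + ?N g)\<^sup>2"] bound)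
  have "(\<Sum>\<^sub>\<infinity>i. (norm (f i + g i))\<^sup>2) \<le> (?N f + ?N g)\<^sup>2"
    by (rule infsum_le_finite_sums[OF summ]) (auto intro: bound)
  then show "?N (\<lambda>i. f i + g i) \<le> ?N f + ?N g"
    by (intro real_le_lsqrt) (auto intro!: add_nonneg_nonneg infsum_nonneg)
qed

lemma ell2_scaleC_summable:
  fixes f :: "'i \<Rightarrow> 'a::complex_inner"
  assumes "(\<lambda>i. (norm (f i))\<^sup>2) summable_on UNIV"
  shows "(\<lambda>i. (norm (c *\<^sub>C f i))\<^sup>2) summable_on UNIV"
  using summable_on_cmult_right[OF assms, of "(cmod c)\<^sup>2"]
  by (simp add: norm_scaleC power_mult_distrib)

lemma ell2_cinner_summable:
  fixes f g :: "'i \<Rightarrow> 'a::complex_inner"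
  assumes f: "(\<lambda>i. (norm (f i))\<^sup>2) summable_on UNIV"
    and g: "(\<lambda>i. (norm (g i))\<^sup>2) summable_on UNIV"
  shows "(\<lambda>i. cinner (f i) (g i)) summable_on UNIV"
proof (rule abs_summable_summable, rule Infinite_Sum.abs_summable_on_comparison_test')
  show "(\<lambda>i. (norm (f i))\<^sup>2 + (norm (g i))\<^sup>2) summable_on UNIV"
    by (rule summable_on_add[OF f g])
  fix i
  have "norm (cinner (f i) (g i)) \<le> norm (f i) * norm (g i)"
    by (rule norm_cinner_le)
  also have "\<dots> \<le> 2 * (norm (f i) * norm (g i))"
    by simp
  also have "\<dots> \<le> (norm (f i))\<^sup>2 + (norm (g i))\<^sup>2"
    using sum_squares_bound[of "norm (f i)" "norm (g i)"] by simp
  finally show "norm (cinner (f i) (g i)) \<le> (norm (f i))\<^sup>2 + (norm (g i))\<^sup>2" .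
qed

instantiation ell2 :: (type, complex_inner) complex_inner
begin

lift_definition zero_ell2 :: "('a, 'b) ell2" is "\<lambda>_. 0" by simp

lift_definition plus_ell2 :: "('a, 'b) ell2 \<Rightarrow> ('a, 'b) ell2 \<Rightarrow> ('a, 'b) ell2"
  is "\<lambda>f g i. f i + g i"
  by (rule ell2_minkowski(1))

lift_definition uminus_ell2 :: "('a, 'b) ell2 \<Rightarrow> ('a, 'b) ell2" is "\<lambda>f i. - f i" by simp

lift_definition minus_ell2 :: "('a, 'b) ell2 \<Rightarrow> ('a, 'b) ell2 \<Rightarrow> ('a, 'b) ell2"
  is "\<lambda>f g i. f i - g i"
  using ell2_minkowski(1)[where g = "\<lambda>i. - g i" for g] by simp

lift_definition scaleC_ell2 :: "complex \<Rightarrow> ('a, 'b) ell2 \<Rightarrow> ('a, 'b) ell2"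
  is "\<lambda>c f i. c *\<^sub>C f i"
  by (rule ell2_scaleC_summable)

lift_definition scaleR_ell2 :: "real \<Rightarrow> ('a, 'b) ell2 \<Rightarrow> ('a, 'b) ell2"
  is "\<lambda>r f i. r *\<^sub>R f i"
  by (simp add: scaleC_of_real[symmetric] ell2_scaleC_summable)

lift_definition cinner_ell2 :: "('a, 'b) ell2 \<Rightarrow> ('a, 'b) ell2 \<Rightarrow> complex"
  is "\<lambda>f g. \<Sum>\<^sub>\<infinity>i. cinner (f i) (g i)" .

lift_definition norm_ell2 :: "('a, 'b) ell2 \<Rightarrow> real"
  is "\<lambda>f. sqrt (\<Sum>\<^sub>\<infinity>i. (norm (f i))\<^sup>2)" .

definition dist_ell2 :: "('a, 'b) ell2 \<Rightarrow> ('a, 'b) ell2 \<Rightarrow> real"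
  where "dist_ell2 f g = norm (f - g)"

definition sgn_ell2 :: "('a, 'b) ell2 \<Rightarrow> ('a, 'b) ell2"
  where "sgn_ell2 f = scaleR (inverse (norm f)) f"

definition uniformity_ell2 :: "(('a, 'b) ell2 \<times> ('a, 'b) ell2) filter"
  where "uniformity_ell2 = (INF e\<in>{0<..}. principal {(f, g). dist f g < e})"

definition open_ell2 :: "('a, 'b) ell2 set \<Rightarrow> bool"
  where "open_ell2 U \<longleftrightarrow> (\<forall>f\<in>U. eventually (\<lambda>(f', g). f' = f \<longrightarrow> g \<in> U) uniformity)"

instance
proof
  fix f g h :: "('a, 'b) ell2" and c d :: complex and r s :: real
  show "f + g + h = f + (g + h)" by transfer (simp add: add.assoc)
  show "f + g = g + f" by transfer (simp add: add.commute)
  show "0 + f = f" by transfer simp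
  show "- f + f = 0" by transfer simp
  show "f - g = f + - g" by transfer simp
  show "r *\<^sub>R (f + g) = r *\<^sub>R f + r *\<^sub>R g" by transfer (simp add: scaleR_add_right)
  show "(r + s) *\<^sub>R f = r *\<^sub>R f + s *\<^sub>R f" by transfer (simp add: scaleR_add_left)
  show "r *\<^sub>R s *\<^sub>R f = (r * s) *\<^sub>R f" by transfer simp
  show "1 *\<^sub>R f = f" by transfer simp
  show "sgn f = scaleR (inverse (norm f)) f" by (rule sgn_ell2_def)
  show "dist f g = norm (f - g)" by (rule dist_ell2_def)
  show "uniformity = (INF e\<in>{0<..}. principal {(f, g :: ('a, 'b) ell2). dist f g < e})"
    by (rule uniformity_ell2_def)
  show "open U = (\<forall>f\<in>U. eventually (\<lambda>(f', g). f' = f \<longrightarrow> g \<in> U) uniformity)"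
    for U :: "('a, 'b) ell2 set"
    by (rule open_ell2_def)
  show "norm f = 0 \<longleftrightarrow> f = 0"
  proof transfer
    fix f :: "'a \<Rightarrow> 'b"
    assume f: "(\<lambda>i. (norm (f i))\<^sup>2) summable_on UNIV"
    show "sqrt (\<Sum>\<^sub>\<infinity>i. (norm (f i))\<^sup>2) = 0 \<longleftrightarrow> f = (\<lambda>_. 0)"
    proof
      assume "sqrt (\<Sum>\<^sub>\<infinity>i. (norm (f i))\<^sup>2) = 0"
      then have "(\<Sum>\<^sub>\<infinity>i. (norm (f i))\<^sup>2) = 0" by simp
      then have "(norm (f i))\<^sup>2 = 0" for i
        by (intro nonneg_infsum_le_0D[OF _ f]) auto
      then show "f = (\<lambda>_. 0)" by auto
    qed simp
  qed
  show "norm (f + g) \<le> norm f + norm g" by transfer (rule ell2_minkowski(2))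
  show "norm (r *\<^sub>R f) = \<bar>r\<bar> * norm f"
    by transfer (simp add: power_mult_distrib infsum_cmult_right' real_sqrt_mult)
  show "c *\<^sub>C (f + g) = c *\<^sub>C f + c *\<^sub>C g" by transfer (simp add: scaleC_add_right)
  show "(c + d) *\<^sub>C f = c *\<^sub>C f + d *\<^sub>C f" by transfer (simp add: scaleC_add_left)
  show "c *\<^sub>C d *\<^sub>C f = (c * d) *\<^sub>C f" by transfer (simp add: scaleC_scaleC)
  show "complex_of_real r *\<^sub>C f = r *\<^sub>R f" by transfer (simp add: scaleC_of_real)
  show "cinner f g = cnj (cinner g f)"
    by transfer (subst infsum_cnj[symmetric], simp add: cinner_commute[symmetric])
  show "cinner (f + g) h = cinner f h + cinner g h"
    by transfer (simp add: cinner_add_left infsum_add ell2_cinner_summable)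
  show "cinner (c *\<^sub>C f) g = c * cinner f g"
    by transfer (simp add: cinner_scaleC_left infsum_cmult_right')
  show "cinner f f = complex_of_real ((norm f)\<^sup>2)"
  proof transfer
    fix f :: "'a \<Rightarrow> 'b"
    assume "(\<lambda>i. (norm (f i))\<^sup>2) summable_on UNIV"
    then have "(\<Sum>\<^sub>\<infinity>i. complex_of_real ((norm (f i))\<^sup>2)) = complex_of_real (\<Sum>\<^sub>\<infinity>i. (norm (f i))\<^sup>2)"
      by (intro infsumI has_sum_of_real has_sum_infsum)
    then show "(\<Sum>\<^sub>\<infinity>i. cinner (f i) (f i)) = complex_of_real ((sqrt (\<Sum>\<^sub>\<infinity>i. (norm (f i))\<^sup>2))\<^sup>2)"
      by (simp add: cinner_self infsum_nonneg del: of_real_power)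
  qed
qed

end

lemma norm_ell2_nth_sum_le:
  fixes f :: "('i, 'a::complex_inner) ell2"
  assumes "finite F"
  shows "(\<Sum>i\<in>F. (norm (ell2_nth f i))\<^sup>2) \<le> (norm f)\<^sup>2"
proof -
  have "(\<Sum>i\<in>F. (norm (ell2_nth f i))\<^sup>2) \<le> (\<Sum>\<^sub>\<infinity>i. (norm (ell2_nth f i))\<^sup>2)"
    using ell2_nth[of f] assms by (intro finite_sum_le_infsum) auto
  then show ?thesis
    by (simp add: norm_ell2.rep_eq infsum_nonneg)
qed

lemma norm_ell2_nth_le: "norm (ell2_nth f i) \<le> norm f"
  for f :: "('i, 'a::complex_inner) ell2"
proof (rule power2_le_imp_le)
  show "(norm (ell2_nth f i))\<^sup>2 \<le> (norm f)\<^sup>2"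
    using norm_ell2_nth_sum_le[of "{i}" f] by simp
qed simp

instance ell2 :: (type, complex_hilbert) complex_hilbert
proof
  fix X :: "nat \<Rightarrow> ('a, 'b) ell2"
  assume X: "Cauchy X"
  have "convergent (\<lambda>n. ell2_nth (X n) i)" for i
  proof (rule Cauchy_convergent, rule metric_CauchyI)
    fix e :: real assume "e > 0"
    with X obtain N where "\<forall>m\<ge>N. \<forall>n\<ge>N. dist (X m) (X n) < e"
      unfolding Cauchy_def by blast
    moreover have "dist (ell2_nth (X m) i) (ell2_nth (X n) i) \<le> dist (X m) (X n)" for m n
      using norm_ell2_nth_le[of "X m - X n" i] by (simp add: dist_norm minus_ell2.rep_eq)
    ultimately show "\<exists>N. \<forall>m\<ge>N. \<forall>n\<ge>N. dist (ell2_nth (X m) i) (ell2_nth (X n) i) < e"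
      by (meson le_less_trans)
  qed
  then obtain l where l: "(\<lambda>n. ell2_nth (X n) i) \<longlonglongrightarrow> l i" for i
    unfolding convergent_def by metis
  have close: "\<exists>N. \<forall>n\<ge>N. \<forall>F. finite F \<longrightarrow> (\<Sum>i\<in>F. (norm (l i - ell2_nth (X n) i))\<^sup>2) \<le> e\<^sup>2"
    if e: "e > 0" for e
  proof -
    from X e obtain N where N: "\<And>m n. m \<ge> N \<Longrightarrow> n \<ge> N \<Longrightarrow> dist (X m) (X n) < e"
      unfolding Cauchy_def by blast
    have "(\<Sum>i\<in>F. (norm (l i - ell2_nth (X n) i))\<^sup>2) \<le> e\<^sup>2" if n: "n \<ge> N" and F: "finite F" for n F
    proof (rule tendsto_upperbound)
      show "(\<lambda>m. \<Sum>i\<in>F. (norm (ell2_nth (X m) i - ell2_nth (X n) i))\<^sup>2)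
          \<longlonglongrightarrow> (\<Sum>i\<in>F. (norm (l i - ell2_nth (X n) i))\<^sup>2)"
        by (intro tendsto_intros l)
      show "\<forall>\<^sub>F m in sequentially. (\<Sum>i\<in>F. (norm (ell2_nth (X m) i - ell2_nth (X n) i))\<^sup>2) \<le> e\<^sup>2"
        unfolding eventually_sequentially
      proof (intro exI allI impI)
        fix m assume m: "N \<le> m"
        have "(\<Sum>i\<in>F. (norm (ell2_nth (X m) i - ell2_nth (X n) i))\<^sup>2) \<le> (norm (X m - X n))\<^sup>2"
          using norm_ell2_nth_sum_le[OF F, of "X m - X n"] by (simp add: minus_ell2.rep_eq)
        also have "\<dots> \<le> e\<^sup>2"
          using N[OF m n] by (intro power_mono) (auto simp: dist_norm)
        finally show "(\<Sum>i\<in>F. (norm (ell2_nth (X m) i - ell2_nth (X n) i))\<^sup>2) \<le> e\<^sup>2" .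
      qed
    qed simp
    then show ?thesis by blast
  qed
  have diff: "(\<lambda>i. (norm (l i - ell2_nth (X n) i))\<^sup>2) summable_on UNIV"
    if "\<forall>F. finite F \<longrightarrow> (\<Sum>i\<in>F. (norm (l i - ell2_nth (X n) i))\<^sup>2) \<le> e\<^sup>2" for n e
    by (rule nonneg_bdd_above_summable_on) (use that in \<open>auto intro!: bdd_aboveI[of _ "e\<^sup>2"]\<close>)
  obtain n0 where "(\<lambda>i. (norm (l i - ell2_nth (X n0) i))\<^sup>2) summable_on UNIV"
    using close[OF zero_less_one] diff by blast
  from ell2_minkowski(1)[OF this, of "ell2_nth (X n0)"]
  have lsum: "(\<lambda>i. (norm (l i))\<^sup>2) summable_on UNIV"
    using ell2_nth[of "X n0"] by simp
  define L where "L = Abs_ell2 l"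
  have L: "ell2_nth L = l"
    unfolding L_def by (rule Abs_ell2_inverse) (simp add: lsum)
  have "X \<longlonglongrightarrow> L"
  proof (rule metric_LIMSEQ_I)
    fix r :: real assume r: "r > 0"
    then obtain N where N: "\<And>n F. n \<ge> N \<Longrightarrow> finite F \<Longrightarrow>
        (\<Sum>i\<in>F. (norm (l i - ell2_nth (X n) i))\<^sup>2) \<le> (r / 2)\<^sup>2"
      using close[of "r / 2"] by auto
    have "dist (X n) L < r" if n: "n \<ge> N" for n
    proof -
      have "(\<Sum>\<^sub>\<infinity>i. (norm (l i - ell2_nth (X n) i))\<^sup>2) \<le> (r / 2)\<^sup>2"
        using N[OF n] by (intro infsum_le_finite_sums diff) auto
      then have "norm (L - X n) \<le> r / 2"
        unfolding norm_ell2.rep_eq minus_ell2.rep_eq L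
        using r by (intro real_le_lsqrt) simp_all
      then show ?thesis
        using r by (simp add: dist_norm norm_minus_commute)
    qed
    then show "\<exists>N. \<forall>n\<ge>N. dist (X n) L < r" by blast
  qed
  then show "convergent X" by (rule convergentI)
qed


section \<open>Operators on subspaces\<close>

text \<open>
  A Hilbert space is represented by a closed complex-linear subspace of a type of class
  \<^class>\<open>complex_hilbert\<close> (by \<^term>\<open>UNIV\<close> for the type itself). An operator on such a subspace
  \<open>K\<close> is a function on the ambient type of which only the values on \<open>K\<close> matter.
\<close>

definition hilbert_subspace :: "'a::complex_hilbert set \<Rightarrow> bool"
  where "hilbert_subspace K \<longleftrightarrow> complex_vector.subspace K \<and> closed K"

definition fin_dim :: "'a::complex_hilbert set \<Rightarrow> bool"
  where "fin_dim S \<longleftrightarrow> (\<exists>B. finite B \<and> S = complex_vector.span B)"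

definition bounded_ops :: "'a::complex_hilbert set \<Rightarrow> 'b::complex_hilbert set \<Rightarrow> ('a \<Rightarrow> 'b) set"
  where "bounded_ops K L = {T. (\<forall>x\<in>K. T x \<in> L)
    \<and> (\<forall>x\<in>K. \<forall>y\<in>K. T (x + y) = T x + T y)
    \<and> (\<forall>c. \<forall>x\<in>K. T (c *\<^sub>C x) = c *\<^sub>C T x)
    \<and> (\<exists>C. \<forall>x\<in>K. norm (T x) \<le> C * norm x)}"

definition opnorm :: "'a::complex_hilbert set \<Rightarrow> ('a \<Rightarrow> 'b::complex_hilbert) \<Rightarrow> real"
  where "opnorm K T = (SUP x\<in>K. norm (T x) / norm x)"

definition adj :: "'a::complex_hilbert set \<Rightarrow> ('a \<Rightarrow> 'a) \<Rightarrow> 'a \<Rightarrow> 'a"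
  where "adj K T y = (THE z. z \<in> K \<and> (\<forall>x\<in>K. cinner (T x) y = cinner x z))"

definition contraction :: "'a::complex_hilbert set \<Rightarrow> ('a \<Rightarrow> 'a) \<Rightarrow> bool"
  where "contraction K T \<longleftrightarrow> T \<in> bounded_ops K K \<and> (\<forall>x\<in>K. norm (T x) \<le> norm x)"

definition isometry ::
    "'a::complex_hilbert set \<Rightarrow> 'b::complex_hilbert set \<Rightarrow> ('a \<Rightarrow> 'b) \<Rightarrow> bool"
  where "isometry K L T \<longleftrightarrow> T \<in> bounded_ops K L \<and> (\<forall>x\<in>K. norm (T x) = norm x)"

definition pure_contraction :: "'a::complex_hilbert set \<Rightarrow> ('a \<Rightarrow> 'a) \<Rightarrow> bool"
  where "pure_contraction K T \<longleftrightarrow>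
    contraction K T \<and> (\<forall>x\<in>K. (\<lambda>m. (adj K T ^^ m) x) \<longlonglongrightarrow> 0)"

definition pure_isometry :: "'a::complex_hilbert set \<Rightarrow> ('a \<Rightarrow> 'a) \<Rightarrow> bool"
  where "pure_isometry K T \<longleftrightarrow> isometry K K T \<and> pure_contraction K T"

definition positive_op :: "'a::complex_hilbert set \<Rightarrow> ('a \<Rightarrow> 'a) \<Rightarrow> bool"
  where "positive_op K T \<longleftrightarrow>
    T \<in> bounded_ops K K \<and> (\<forall>x\<in>K. cinner (T x) x \<in> \<real> \<and> 0 \<le> Re (cinner (T x) x))"

text \<open>Meaningful only for positive \<open>T\<close>, which has exactly one positive square root.\<close>

definition op_sqrt :: "('a::complex_hilbert \<Rightarrow> 'a) \<Rightarrow> 'a \<Rightarrow> 'a"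
  where "op_sqrt T = (THE R. positive_op UNIV R \<and> R \<circ> R = T)"


section \<open>Tuples of commuting contractions\<close>

text \<open>
  Tuples are families indexed by a finite set \<open>J\<close> of natural numbers: \<open>{1..n}\<close> for an \<open>n\<close>-tuple \<open>X\<close>,
  and \<open>{1..n} - {i}\<close> for the \<open>(n-1)\<close>-tuple obtained from \<open>X\<close> by deleting its \<open>i\<close>-th entry.
\<close>

definition commuting_on :: "'a set \<Rightarrow> nat set \<Rightarrow> (nat \<Rightarrow> 'a \<Rightarrow> 'a) \<Rightarrow> bool"
  where "commuting_on K J Y \<longleftrightarrow> (\<forall>i\<in>J. \<forall>j\<in>J. \<forall>x\<in>K. Y i (Y j x) = Y j (Y i x))"

definition commuting_contractions :: "nat set \<Rightarrow> (nat \<Rightarrow> 'a::complex_hilbert \<Rightarrow> 'a) \<Rightarrow> bool"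
  where "commuting_contractions J Y \<longleftrightarrow>
    (\<forall>i\<in>J. contraction UNIV (Y i)) \<and> commuting_on UNIV J Y"

definition pure_tuple :: "nat set \<Rightarrow> (nat \<Rightarrow> 'a::complex_hilbert \<Rightarrow> 'a) \<Rightarrow> bool"
  where "pure_tuple J Y \<longleftrightarrow> (\<forall>i\<in>J. pure_contraction UNIV (Y i))"

definition op_prod :: "(nat \<Rightarrow> 'a \<Rightarrow> 'a) \<Rightarrow> nat set \<Rightarrow> 'a \<Rightarrow> 'a"
  where "op_prod Y F = foldr (\<circ>) (map Y (sorted_list_of_set F)) id"

definition szego_inv :: "nat set \<Rightarrow> (nat \<Rightarrow> 'a::complex_hilbert \<Rightarrow> 'a) \<Rightarrow> 'a \<Rightarrow> 'a"
  where "szego_inv J Y x =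
    (\<Sum>F\<in>Pow J. (- 1) ^ card F *\<^sub>C op_prod Y F (adj UNIV (op_prod Y F) x))"

definition szego_class :: "nat set \<Rightarrow> (nat \<Rightarrow> 'a::complex_hilbert \<Rightarrow> 'a) \<Rightarrow> bool"
  where "szego_class J Y \<longleftrightarrow> commuting_contractions J Y \<and> positive_op UNIV (szego_inv J Y)"

definition defect_space :: "nat set \<Rightarrow> (nat \<Rightarrow> 'a::complex_hilbert \<Rightarrow> 'a) \<Rightarrow> 'a set"
  where "defect_space J Y = closure (range (op_sqrt (szego_inv J Y)))"

definition X_class :: "nat \<Rightarrow> nat \<Rightarrow> nat \<Rightarrow> (nat \<Rightarrow> 'a::complex_hilbert \<Rightarrow> 'a) \<Rightarrow> bool"
  where "X_class n p q X \<longleftrightarrow> commuting_contractions {1..n} X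
    \<and> szego_class ({1..n} - {p}) X \<and> szego_class ({1..n} - {q}) X
    \<and> pure_tuple ({1..n} - {p}) X"

definition finite_rank :: "nat \<Rightarrow> nat \<Rightarrow> nat \<Rightarrow> (nat \<Rightarrow> 'a::complex_hilbert \<Rightarrow> 'a) \<Rightarrow> bool"
  where "finite_rank n p q X \<longleftrightarrow> (\<forall>i\<in>{p, q}. fin_dim (defect_space ({1..n} - {i}) X))"

definition dilates_to :: "nat \<Rightarrow> 'a::complex_hilbert set \<Rightarrow> (nat \<Rightarrow> 'a \<Rightarrow> 'a)
    \<Rightarrow> 'b::complex_hilbert set \<Rightarrow> (nat \<Rightarrow> 'b \<Rightarrow> 'b) \<Rightarrow> bool"
  where "dilates_to n H X K V \<longleftrightarrow> (\<exists>W. isometry H K W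
    \<and> (\<forall>i\<in>{1..n}. \<forall>h\<in>H. W (adj H (X i) h) = adj K (V i) (W h)))"


section \<open>Vector-valued Hardy space and multiplication operators on the polydisc\<close>

text \<open>
  \<open>J\<close> is the finite set labelling the coordinates. An element of the Hardy space is represented by
  the square-summable family \<open>f\<close> of its Taylor coefficients in \<open>E\<close>; the function itself is
  \<open>z \<mapsto> hardy_eval J f z\<close> on \<open>polydisc J\<close>. That this is the space with kernel
  \<open>(\<Prod>i\<in>J. 1 / (1 - z\<^sub>i * cnj w\<^sub>i)) I\<close> is the content of \<open>hardy_reproducing\<close> and
  \<open>hardy_eval_szego\<close> below.
\<close>

definition polydisc :: "nat set \<Rightarrow> (nat \<Rightarrow> complex) set"
  where "polydisc J = (J \<rightarrow>\<^sub>E ball 0 1)"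

definition multi_indices :: "nat set \<Rightarrow> (nat \<Rightarrow> nat) set"
  where "multi_indices J = (J \<rightarrow>\<^sub>E UNIV)"

definition monomial :: "nat set \<Rightarrow> (nat \<Rightarrow> nat) \<Rightarrow> (nat \<Rightarrow> complex) \<Rightarrow> complex"
  where "monomial J k z = (\<Prod>i\<in>J. z i ^ k i)"

definition hardy :: "nat set \<Rightarrow> 'e::complex_hilbert set \<Rightarrow> (nat \<Rightarrow> nat, 'e) ell2 set"
  where "hardy J E = {f. (\<forall>k\<in>multi_indices J. ell2_nth f k \<in> E)
    \<and> (\<forall>k. k \<notin> multi_indices J \<longrightarrow> ell2_nth f k = 0)}"

definition hardy_eval ::
    "nat set \<Rightarrow> (nat \<Rightarrow> nat, 'e::complex_hilbert) ell2 \<Rightarrow> (nat \<Rightarrow> complex) \<Rightarrow> 'e"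
  where "hardy_eval J f z = (\<Sum>\<^sub>\<infinity>k\<in>multi_indices J. monomial J k z *\<^sub>C ell2_nth f k)"

definition szego_element ::
    "nat set \<Rightarrow> (nat \<Rightarrow> complex) \<Rightarrow> 'e \<Rightarrow> (nat \<Rightarrow> nat, 'e::complex_hilbert) ell2"
  where "szego_element J w x = Abs_ell2
    (\<lambda>k. if k \<in> multi_indices J then cnj (monomial J k w) *\<^sub>C x else 0)"

lemma monomial_abs_summable:
  assumes "finite J" and "\<And>i. i \<in> J \<Longrightarrow> cmod (z i) < 1"
  shows "(\<lambda>k. norm (monomial J k z)) summable_on multi_indices J"
proof -
  have "Infinite_Set_Sum.abs_summable_on (\<lambda>k. \<Prod>i\<in>J. z i ^ k i) (PiE J (\<lambda>_. UNIV :: nat set))"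
  proof (rule abs_summable_on_prod_PiE[OF assms(1)])
    fix i assume "i \<in> J"
    then have "summable (\<lambda>m. norm (z i ^ m))"
      using assms(2) by (simp add: norm_power)
    then have "(\<lambda>m. norm (z i ^ m)) summable_on UNIV"
      by (simp add: summable_on_UNIV_nonneg_real_iff)
    then show "Infinite_Set_Sum.abs_summable_on (\<lambda>m. z i ^ m) UNIV"
      by (simp add: abs_summable_equivalent)
  qed simp
  then show ?thesis
    unfolding monomial_def multi_indices_def by (simp add: abs_summable_equivalent)
qed

lemma monomial_infsum:
  assumes "finite J" and "\<And>i. i \<in> J \<Longrightarrow> cmod (z i) < 1"
  shows "(\<Sum>\<^sub>\<infinity>k\<in>multi_indices J. monomial J k z) = (\<Prod>i\<in>J. 1 / (1 - z i))"
proof -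
  have summ: "summable (\<lambda>m. norm (z i ^ m))" if "i \<in> J" for i
    using assms(2)[OF that] by (simp add: norm_power)
  have "(\<Sum>\<^sub>\<infinity>k\<in>multi_indices J. monomial J k z) = (\<Prod>i\<in>J. \<Sum>\<^sub>\<infinity>m. z i ^ m)"
    unfolding monomial_def multi_indices_def
    using summ by (intro infsum_prod_PiE_abs[OF assms(1)]) (simp add: summable_on_UNIV_nonneg_real_iff)
  also have "\<dots> = (\<Prod>i\<in>J. 1 / (1 - z i))"
  proof (rule prod.cong[OF refl])
    fix i assume i: "i \<in> J"
    have "((\<lambda>m. z i ^ m) has_sum (1 / (1 - z i))) UNIV"
      using norm_summable_imp_has_sum[OF summ[OF i]] geometric_sums assms(2)[OF i] by blast
    then show "(\<Sum>\<^sub>\<infinity>m. z i ^ m) = 1 / (1 - z i)" by (rule infsumI)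
  qed
  finally show ?thesis .
qed

lemma monomial_sq_summable:
  assumes "finite J" and "w \<in> polydisc J"
  shows "(\<lambda>k. (cmod (monomial J k w))\<^sup>2) summable_on multi_indices J"
proof -
  have w: "cmod (w i) < 1" if "i \<in> J" for i
    using assms(2) that by (auto simp: polydisc_def PiE_iff)
  have "norm (monomial J k (\<lambda>i. (w i)\<^sup>2)) = (cmod (monomial J k w))\<^sup>2" for k
    by (simp add: monomial_def norm_mult norm_power power2_eq_square power_mult_distrib prod.distrib
        flip: prod_norm)
  moreover have "cmod ((w i)\<^sup>2) < 1" if "i \<in> J" for i
    using w[OF that] by (simp add: norm_power power_less_one_iff)
  ultimately show ?thesis
    using monomial_abs_summable[OF assms(1), of "\<lambda>i. (w i)\<^sup>2"] by simp
qed

lemma szego_element_nth: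
  fixes x :: "'e::complex_hilbert"
  assumes "finite J" and "w \<in> polydisc J"
  shows "ell2_nth (szego_element J w x) =
    (\<lambda>k. if k \<in> multi_indices J then cnj (monomial J k w) *\<^sub>C x else 0)"
  unfolding szego_element_def
proof (rule Abs_ell2_inverse, rule CollectI)
  have "(\<lambda>k. (cmod (monomial J k w))\<^sup>2 * (norm x)\<^sup>2) summable_on multi_indices J"
    by (intro summable_on_cmult_left monomial_sq_summable assms)
  then show "(\<lambda>k. (norm (if k \<in> multi_indices J then cnj (monomial J k w) *\<^sub>C x else 0))\<^sup>2)
      summable_on UNIV"
    by (rule summable_on_cong_neutral[THEN iffD1, rotated 3])
      (auto simp: norm_scaleC power_mult_distrib)
qed

lemma hardy_eval_summable:
  fixes f :: "(nat \<Rightarrow> nat, 'e::complex_hilbert) ell2"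
  assumes "finite J" and "z \<in> polydisc J"
  shows "(\<lambda>k. monomial J k z *\<^sub>C ell2_nth f k) summable_on multi_indices J"
proof (rule abs_summable_summable, rule Infinite_Sum.abs_summable_on_comparison_test')
  have "(\<lambda>k. (norm (ell2_nth f k))\<^sup>2) summable_on multi_indices J"
    using ell2_nth[of f] by (auto intro: summable_on_subset_banach)
  then show "(\<lambda>k. (cmod (monomial J k z))\<^sup>2 + (norm (ell2_nth f k))\<^sup>2) summable_on multi_indices J"
    by (intro summable_on_add monomial_sq_summable assms)
  fix k
  have "norm (monomial J k z *\<^sub>C ell2_nth f k) \<le> 2 * (cmod (monomial J k z) * norm (ell2_nth f k))"
    by (simp add: norm_scaleC)
  then show "norm (monomial J k z *\<^sub>C ell2_nth f k)
      \<le> (cmod (monomial J k z))\<^sup>2 + (norm (ell2_nth f k))\<^sup>2"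
    using sum_squares_bound[of "cmod (monomial J k z)" "norm (ell2_nth f k)"] by simp
qed

lemma hardy_reproducing:
  fixes E :: "'e::complex_hilbert set"
  assumes "finite J" and "w \<in> polydisc J" and "hilbert_subspace E" and "x \<in> E" and "f \<in> hardy J E"
  shows "szego_element J w x \<in> hardy J E"
    and "cinner f (szego_element J w x) = cinner (hardy_eval J f w) x"
proof -
  show "szego_element J w x \<in> hardy J E"
    using assms(3,4) unfolding hardy_def
    by (auto simp: szego_element_nth[OF assms(1,2)] hilbert_subspace_def
        intro: complex_vector.subspace_scale)
  have lin: "bounded_linear (\<lambda>y :: 'e. cinner y x)"
    by (rule bounded_linear_intro[where K = "norm x"])
      (auto simp: cinner_add_left cinner_scaleC_left norm_cinner_le scaleC_of_real[symmetric]
        scaleR_conv_of_real)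
  have "cinner f (szego_element J w x)
      = (\<Sum>\<^sub>\<infinity>k. cinner (ell2_nth f k) (ell2_nth (szego_element J w x) k))"
    by (simp add: cinner_ell2.rep_eq)
  also have "\<dots> = (\<Sum>\<^sub>\<infinity>k\<in>multi_indices J. cinner (monomial J k w *\<^sub>C ell2_nth f k) x)"
    using assms(5) cinner_scaleC_right[where c = 0]
    by (intro infsum_cong_neutral)
      (auto simp: szego_element_nth[OF assms(1,2)] cinner_scaleC_left cinner_scaleC_right hardy_def)
  also have "\<dots> = cinner (hardy_eval J f w) x"
    unfolding hardy_eval_def
    by (rule infsum_bounded_linear_strong[OF _ lin])
      (use hardy_eval_summable[OF assms(1,2)] summable_on_bounded_linear[OF lin] in blast)
  finally show "cinner f (szego_element J w x) = cinner (hardy_eval J f w) x" .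
qed

lemma hardy_eval_szego:
  fixes x :: "'e::complex_hilbert"
  assumes J: "finite J" and w: "w \<in> polydisc J" and z: "z \<in> polydisc J"
  shows "hardy_eval J (szego_element J w x) z = (\<Prod>i\<in>J. 1 / (1 - z i * cnj (w i))) *\<^sub>C x"
proof -
  have lin: "bounded_linear (\<lambda>c. c *\<^sub>C x)"
    by (rule bounded_linear_intro[where K = "norm x"])
      (auto simp: scaleC_add_left norm_scaleC scaleC_of_real[symmetric] scaleC_scaleC
        scaleR_conv_of_real)
  have less: "cmod (z i * cnj (w i)) < 1" if "i \<in> J" for i
  proof -
    have "cmod (z i) < 1" "cmod (w i) < 1"
      using w z that by (auto simp: polydisc_def PiE_iff)
    then have "cmod (z i) * cmod (w i) < 1 * 1"
      by (intro mult_strict_mono') simp_all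
    then show ?thesis by (simp add: norm_mult)
  qed
  have "hardy_eval J (szego_element J w x) z
      = (\<Sum>\<^sub>\<infinity>k\<in>multi_indices J. monomial J k (\<lambda>i. z i * cnj (w i)) *\<^sub>C x)"
    unfolding hardy_eval_def
    by (rule infsum_cong)
      (simp add: szego_element_nth[OF J w] scaleC_scaleC monomial_def power_mult_distrib prod.distrib)
  also have "\<dots> = (\<Sum>\<^sub>\<infinity>k\<in>multi_indices J. monomial J k (\<lambda>i. z i * cnj (w i))) *\<^sub>C x"
  proof (rule infsum_bounded_linear_strong[OF _ lin])
    have "(\<lambda>k. monomial J k (\<lambda>i. z i * cnj (w i))) summable_on multi_indices J"
      by (rule abs_summable_summable, rule monomial_abs_summable[OF J less])
    then show "(\<lambda>k. monomial J k (\<lambda>i. z i * cnj (w i)) *\<^sub>C x) summable_on multi_indices J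
        \<longleftrightarrow> (\<lambda>k. monomial J k (\<lambda>i. z i * cnj (w i))) summable_on multi_indices J"
      using summable_on_bounded_linear[OF lin] by simp
  qed
  also have "\<dots> = (\<Prod>i\<in>J. 1 / (1 - z i * cnj (w i))) *\<^sub>C x"
    by (simp add: monomial_infsum[OF J less])
  finally show ?thesis .
qed

text \<open>
  The value at \<open>f\<close> is the element of the Hardy space whose function is the pointwise product; it is
  unique because the Taylor coefficients are determined by the function, and it exists for \<open>\<Phi>\<close>
  bounded and analytic.
\<close>

definition mult_op :: "nat set \<Rightarrow> 'e::complex_hilbert set \<Rightarrow> ((nat \<Rightarrow> complex) \<Rightarrow> 'e \<Rightarrow> 'e)
    \<Rightarrow> (nat \<Rightarrow> nat, 'e) ell2 \<Rightarrow> (nat \<Rightarrow> nat, 'e) ell2"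
  where "mult_op J E \<Phi> f = (THE g. g \<in> hardy J E \<and>
    (\<forall>z\<in>polydisc J. hardy_eval J g z = \<Phi> z (hardy_eval J f z)))"

text \<open>
  Analytic means that the function is given on the polydisc by a power series converging in
  operator norm.
\<close>

definition H_infinity ::
    "nat set \<Rightarrow> 'e::complex_hilbert set \<Rightarrow> ((nat \<Rightarrow> complex) \<Rightarrow> 'e \<Rightarrow> 'e) set"
  where "H_infinity J E = {\<Phi>. (\<forall>z\<in>polydisc J. \<Phi> z \<in> bounded_ops E E)
    \<and> bdd_above ((\<lambda>z. opnorm E (\<Phi> z)) ` polydisc J)
    \<and> (\<exists>A. (\<forall>k\<in>multi_indices J. A k \<in> bounded_ops E E) \<and>
        (\<forall>z\<in>polydisc J.
          ((\<lambda>F. opnorm E (\<lambda>x. \<Phi> z x - (\<Sum>k\<in>F. monomial J k z *\<^sub>C A k x))) \<longlongrightarrow> 0)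
            (finite_subsets_at_top (multi_indices J))))}"

definition inner_function ::
    "nat set \<Rightarrow> 'e::complex_hilbert set \<Rightarrow> ((nat \<Rightarrow> complex) \<Rightarrow> 'e \<Rightarrow> 'e) \<Rightarrow> bool"
  where "inner_function J E \<Phi> \<longleftrightarrow>
    \<Phi> \<in> H_infinity J E \<and> isometry (hardy J E) (hardy J E) (mult_op J E \<Phi>)"

definition op_polynomial ::
    "nat set \<Rightarrow> 'e::complex_hilbert set \<Rightarrow> nat \<Rightarrow> ((nat \<Rightarrow> complex) \<Rightarrow> 'e \<Rightarrow> 'e) \<Rightarrow> bool"
  where "op_polynomial J E d \<Phi> \<longleftrightarrow> (\<exists>A. (\<forall>k\<in>multi_indices J. A k \<in> bounded_ops E E) \<and>
    (\<forall>z\<in>polydisc J. \<forall>x\<in>E.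
      \<Phi> z x = (\<Sum>k | k \<in> multi_indices J \<and> (\<Sum>i\<in>J. k i) \<le> d. monomial J k z *\<^sub>C A k x)))"

end

theory Submission
  imports Defs
begin

text \<open>
  The idea is that of Berger, Coburn and Lebow. Replacing \<open>X\<^sub>p\<close>, \<open>X\<^sub>q\<close> by their product gives an
  \<open>(n - 1)\<close>-tuple whose Szego defect is \<open>D\<^sub>q + X\<^sub>p D\<^sub>p X\<^sub>p\<^sup>* = D\<^sub>p + X\<^sub>q D\<^sub>q X\<^sub>q\<^sup>*\<close>, where \<open>D\<^sub>p\<close>, \<open>D\<^sub>q\<close> are the
  defects of the tuples omitting \<open>X\<^sub>p\<close>, \<open>X\<^sub>q\<close>. Hence this tuple is the compression of the coordinate
  shifts, and the two expressions for the defect give a unitary \<open>U\<close> on a finite-dimensional space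
  with \<open>U (D\<^sub>q\<^sup>1\<^sup>/\<^sup>2 h, D\<^sub>p\<^sup>1\<^sup>/\<^sup>2 X\<^sub>p\<^sup>* h) = (D\<^sub>q\<^sup>1\<^sup>/\<^sup>2 X\<^sub>q\<^sup>* h, D\<^sub>p\<^sup>1\<^sup>/\<^sup>2 h)\<close>. With \<open>P\<close> the projection to the first
  component and \<open>P' = 1 - P\<close>, the symbols are \<open>\<Phi>\<^sub>p = (P' + z\<^sub>p P) U\<close> and \<open>\<Phi>\<^sub>q = U\<^sup>* (P + z\<^sub>p P')\<close>.
  Multiplication by them is pure once the unitary parts of the constant terms are split off; in
  finite dimension the rest is pure by compactness, and purity of \<open>X\<^sub>p\<close>, \<open>X\<^sub>q\<close> keeps the dilation
  space orthogonal to these unitary parts.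
\<close>

section \<open>Bounded operators and adjoints\<close>

text \<open>Matching \<open>A h\<close> with \<open>B h\<close> is isometric between two ranges
  only. Finite rank puts both ranges into one finite-dimensional space, where their complements have
  equal dimension, so a unitary \<open>U\<close> exists without enlarging the space. On the
  complement \<open>U\<close> is arbitrary, and that is the obstacle: on a vector whose whole orbit
  under \<open>U\<close> is fixed by \<open>P\<close>, the symbol \<open>\<Phi>q\<close> acts as the
  constant unitary \<open>U'\<close>, which spoils purity. Finite dimension helps again: the space
  of such vectors is also invariant under the inverse \<open>U'\<close>, so its complement reduces
  \<open>U\<close> and \<open>P\<close> and all algebraic identities survive the restriction. The
  analysis takes place on Taylor coefficients. The adjoint of multiplication by C + z_i D turns a
  family f into C' f(k) + D' f(k + e_i), and the dilation has the coefficients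
  \<open>A (op_power Zpq J k h)\<close>; hence each intertwining relation is a single identity for
  \<open>A\<close>. The coordinates are such pencils as well, with constant term 0, so one locale
  serves every entry of V.\<close>

abbreviation bounded_op :: "('a::complex_hilbert \<Rightarrow> 'b::complex_hilbert) \<Rightarrow> bool"
  where "bounded_op T \<equiv> T \<in> bounded_ops UNIV UNIV"

lemma scaleC_minus_one: "(- 1) *\<^sub>C x = - x" for x :: "'a::complex_inner"
  by (metis complex_vector.scale_minus_left complex_vector.scale_one)

lemma cinner_zero_left [simp]: "cinner 0 x = 0" for x :: "'a::complex_inner"
  using cinner_scaleC_left[of 0 0 x] by simp

lemma cinner_zero_right [simp]: "cinner x 0 = 0" for x :: "'a::complex_inner"
  using cinner_scaleC_right[of x 0 0] by simp

lemma cinner_minus_left [simp]: "cinner (- x) y = - cinner x y" for x :: "'a::complex_inner"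
  using cinner_scaleC_left[of "-1" x y] by (simp add: scaleC_minus_one)

lemma cinner_minus_right [simp]: "cinner x (- y) = - cinner x y" for x :: "'a::complex_inner"
  using cinner_scaleC_right[of x "-1" y] by (simp add: scaleC_minus_one)

lemma cinner_diff_left: "cinner (x - y) z = cinner x z - cinner y z" for x :: "'a::complex_inner"
  using cinner_add_left[of x "- y" z] by simp

lemma cinner_diff_right: "cinner x (y - z) = cinner x y - cinner x z" for x :: "'a::complex_inner"
  using cinner_add_right[of x y "- z"] by simp

lemma cinner_sum_left: "cinner (sum f I) y = (\<Sum>i\<in>I. cinner (f i) y)"
  for y :: "'a::complex_inner"
  by (induction I rule: infinite_finite_induct) (auto simp: cinner_add_left)

lemma cinner_sum_right: "cinner y (sum f I) = (\<Sum>i\<in>I. cinner y (f i))"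
  for y :: "'a::complex_inner"
  by (induction I rule: infinite_finite_induct) (auto simp: cinner_add_right)

lemma cinner_eq_zero_iff [simp]: "cinner x x = 0 \<longleftrightarrow> x = 0" for x :: "'a::complex_inner"
  by (simp add: cinner_self)

lemma Re_cinner_self [simp]: "Re (cinner x x) = (norm x)\<^sup>2" for x :: "'a::complex_inner"
  by (simp add: cinner_self)

lemma norm_add_squared:
  "(norm (x + y))\<^sup>2 = (norm x)\<^sup>2 + (norm y)\<^sup>2 + 2 * Re (cinner x y)" for x :: "'a::complex_inner"
proof -
  have "Re (cinner y x) = Re (cinner x y)"
    using arg_cong[OF cinner_commute[of y x], of Re] by simp
  then show ?thesis
    unfolding Re_cinner_self[symmetric] by (simp add: cinner_add_left cinner_add_right)
qed

lemma norm_diff_squared: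
  "(norm (x - y))\<^sup>2 = (norm x)\<^sup>2 + (norm y)\<^sup>2 - 2 * Re (cinner x y)" for x :: "'a::complex_inner"
  using norm_add_squared[of x "- y"] by simp

lemma bounded_linear_cinner_left: "bounded_linear (\<lambda>x. cinner x y)" for y :: "'a::complex_inner"
  by (rule bounded_linear_intro[where K = "norm y"])
    (auto simp: cinner_add_left cinner_scaleC_left norm_cinner_le scaleC_of_real[symmetric]
      scaleR_conv_of_real)

lemma bounded_linear_cinner_right: "bounded_linear (\<lambda>y. cinner x y)" for x :: "'a::complex_inner"
  by (rule bounded_linear_intro[where K = "norm x"])
    (auto simp: cinner_add_right cinner_scaleC_right scaleC_of_real[symmetric]
      scaleR_conv_of_real norm_cinner_le mult.commute[of "norm _" "norm x"])

lemma bounded_linear_scaleC: "bounded_linear (\<lambda>x :: 'a::complex_inner. c *\<^sub>C x)"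
  by (rule bounded_linear_intro[where K = "cmod c"])
    (auto simp: scaleC_add_right norm_scaleC scaleC_of_real[symmetric] scaleC_scaleC mult.commute)

lemmas tendsto_cinner_left = bounded_linear.tendsto[OF bounded_linear_cinner_left]
lemmas tendsto_cinner_right = bounded_linear.tendsto[OF bounded_linear_cinner_right]

lemma cinner_eqI:
  fixes y z :: "'a::complex_hilbert"
  assumes "complex_vector.subspace K" "y \<in> K" "z \<in> K" "\<And>x. x \<in> K \<Longrightarrow> cinner x y = cinner x z"
  shows "y = z"
proof -
  have "cinner (y - z) (y - z) = 0"
    using assms(4)[OF complex_vector.subspace_diff[OF assms(1-3)]] by (simp add: cinner_diff_right)
  then show ?thesis by simp
qed

lemma cinner_eqI_UNIV:
  fixes y z :: "'a::complex_hilbert"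
  assumes "\<And>x. cinner x y = cinner x z"
  shows "y = z"
  by (rule cinner_eqI[of UNIV]) (use assms in auto)

lemma hilbert_subspace_UNIV [simp]: "hilbert_subspace UNIV"
  by (simp add: hilbert_subspace_def)

lemma bounded_opI:
  assumes "\<And>x y. T (x + y) = T x + T y" "\<And>c x. T (c *\<^sub>C x) = c *\<^sub>C T x"
    "\<And>x. norm (T x) \<le> C * norm x"
  shows "bounded_op T"
  using assms unfolding bounded_ops_def by blast

lemma bounded_op_add: "bounded_op T \<Longrightarrow> T (x + y) = T x + T y"
  by (simp add: bounded_ops_def)

lemma bounded_op_scaleC: "bounded_op T \<Longrightarrow> T (c *\<^sub>C x) = c *\<^sub>C T x"
  by (simp add: bounded_ops_def)

lemma bounded_op_bounded_linear:
  assumes "bounded_op T"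
  shows "bounded_linear T"
proof -
  obtain C where "\<And>x. norm (T x) \<le> C * norm x"
    using assms by (auto simp: bounded_ops_def)
  then show ?thesis
    using assms
    by (intro bounded_linear_intro[where K = C])
      (auto simp: bounded_op_add bounded_op_scaleC scaleC_of_real[symmetric] mult.commute)
qed

lemma bounded_op_bound:
  assumes "bounded_op T"
  obtains C where "C > 0" "\<And>x. norm (T x) \<le> C * norm x"
  using bounded_linear.pos_bounded[OF bounded_op_bounded_linear[OF assms]]
  by (auto simp: mult.commute)

lemma bounded_op_zero: "bounded_op T \<Longrightarrow> T 0 = 0"
  using bounded_op_scaleC[of T 0 0] by simp

lemma bounded_op_diff: "bounded_op T \<Longrightarrow> T (x - y) = T x - T y"
  by (rule linear_diff[OF bounded_linear.linear[OF bounded_op_bounded_linear]])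

lemma bounded_op_sum: "bounded_op T \<Longrightarrow> T (sum f I) = (\<Sum>i\<in>I. T (f i))"
  by (rule linear_sum[OF bounded_linear.linear[OF bounded_op_bounded_linear]])

lemma bounded_op_tendsto: "bounded_op T \<Longrightarrow> (f \<longlongrightarrow> a) F \<Longrightarrow> ((\<lambda>x. T (f x)) \<longlongrightarrow> T a) F"
  by (rule bounded_linear.tendsto[OF bounded_op_bounded_linear])

lemma bounded_op_id: "bounded_op (\<lambda>x. x)"
  by (rule bounded_opI[where C = 1]) auto

lemma bounded_op_const_zero: "bounded_op (\<lambda>x. 0)"
  by (rule bounded_opI[where C = 1]) auto

lemma bounded_op_comp:
  assumes S: "bounded_op S" and T: "bounded_op T"
  shows "bounded_op (\<lambda>x. S (T x))"
proof -
  obtain C where C: "C > 0" "\<And>x. norm (S x) \<le> C * norm x" using bounded_op_bound[OF S] by blast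
  obtain D where D: "D > 0" "\<And>x. norm (T x) \<le> D * norm x" using bounded_op_bound[OF T] by blast
  have "norm (S (T x)) \<le> C * (D * norm x)" for x
    using C(2)[of "T x"] D(2)[of x] C(1) by (meson dual_order.trans mult_left_mono less_imp_le)
  then show ?thesis
    by (intro bounded_opI[where C = "C * D"])
      (auto simp: bounded_op_add[OF S] bounded_op_add[OF T] bounded_op_scaleC[OF S]
        bounded_op_scaleC[OF T] mult.assoc)
qed

lemma bounded_op_plus:
  assumes S: "bounded_op S" and T: "bounded_op T"
  shows "bounded_op (\<lambda>x. S x + T x)"
proof -
  obtain C where C: "C > 0" "\<And>x. norm (S x) \<le> C * norm x" using bounded_op_bound[OF S] by blast
  obtain D where D: "D > 0" "\<And>x. norm (T x) \<le> D * norm x" using bounded_op_bound[OF T] by blast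
  have "norm (S x + T x) \<le> (C + D) * norm x" for x
    using C(2)[of x] D(2)[of x] norm_triangle_ineq[of "S x" "T x"] by (simp add: distrib_right)
  then show ?thesis
    by (intro bounded_opI[where C = "C + D"])
      (auto simp: bounded_op_add[OF S] bounded_op_add[OF T] bounded_op_scaleC[OF S]
        bounded_op_scaleC[OF T] scaleC_add_right)
qed

lemma bounded_op_scale:
  assumes "bounded_op T"
  shows "bounded_op (\<lambda>x. c *\<^sub>C T x)"
proof (rule bounded_op_comp[OF _ assms])
  show "bounded_op (\<lambda>x. c *\<^sub>C x)"
    by (rule bounded_opI[where C = "cmod c"])
      (auto simp: scaleC_add_right norm_scaleC scaleC_scaleC mult.commute)
qed

lemma bounded_op_minus:
  assumes S: "bounded_op S" and T: "bounded_op T"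
  shows "bounded_op (\<lambda>x. S x - T x)"
  using bounded_op_plus[OF S bounded_op_scale[OF T, of "-1"]] by (simp add: scaleC_minus_one)

lemma bounded_op_setsum:
  assumes "\<And>i. i \<in> I \<Longrightarrow> bounded_op (T i)"
  shows "bounded_op (\<lambda>x. \<Sum>i\<in>I. T i x)"
  using assms
  by (induction I rule: infinite_finite_induct)
    (auto simp: bounded_op_const_zero intro!: bounded_op_plus)

lemma bounded_op_funpow:
  fixes T :: "'a::complex_hilbert \<Rightarrow> 'a"
  assumes "bounded_op T"
  shows "bounded_op (T ^^ m)"
  by (induction m)
    (auto simp: id_def o_def intro: bounded_op_id bounded_op_comp[OF assms])

lemma bounded_op_on:
  assumes "bounded_op T" "\<And>x. x \<in> K \<Longrightarrow> T x \<in> L"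
  shows "T \<in> bounded_ops K L"
  using assms by (auto simp: bounded_ops_def)

section \<open>Riesz representation on closed subspaces\<close>

text \<open>The vector \<open>z\<close> is the minimiser of \<open>\<parallel>x\<parallel>\<^sup>2 - 2 Re (f x)\<close> on \<open>K\<close>; minimising sequences are
  Cauchy by the parallelogram law.\<close>

theorem riesz_representation:
  fixes f :: "'a::complex_hilbert \<Rightarrow> complex"
  assumes K: "hilbert_subspace K"
    and add: "\<And>x y. x \<in> K \<Longrightarrow> y \<in> K \<Longrightarrow> f (x + y) = f x + f y"
    and scale: "\<And>c x. x \<in> K \<Longrightarrow> f (c *\<^sub>C x) = c * f x"
    and bound: "\<And>x. x \<in> K \<Longrightarrow> cmod (f x) \<le> C * norm x"
  obtains z where "z \<in> K" "\<And>x. x \<in> K \<Longrightarrow> f x = cinner x z"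
proof -
  have sub: "complex_vector.subspace K" and cl: "closed K"
    using K by (auto simp: hilbert_subspace_def)
  have K0: "0 \<in> K" and Kadd: "\<And>x y. x \<in> K \<Longrightarrow> y \<in> K \<Longrightarrow> x + y \<in> K"
    and Kscale: "\<And>c x. x \<in> K \<Longrightarrow> c *\<^sub>C x \<in> K"
    using sub by (auto simp: complex_vector.subspace_def)
  define J where "J x = (norm x)\<^sup>2 - 2 * Re (f x)" for x
  have Jlow: "J x \<ge> - C\<^sup>2" if "x \<in> K" for x
  proof -
    have "Re (f x) \<le> C * norm x"
      using bound[OF that] complex_Re_le_cmod[of "f x"] by linarith
    then have "J x \<ge> (norm x)\<^sup>2 - 2 * (C * norm x)" by (simp add: J_def)
    also have "(norm x)\<^sup>2 - 2 * (C * norm x) = (norm x - C)\<^sup>2 - C\<^sup>2"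
      by (simp add: power2_eq_square algebra_simps)
    finally show ?thesis by (smt (verit) zero_le_power2)
  qed
  define m where "m = (INF x\<in>K. J x)"
  have bdd: "bdd_below (J ` K)" using Jlow by (auto intro!: bdd_belowI[of _ "- C\<^sup>2"])
  have mle: "m \<le> J x" if "x \<in> K" for x
    unfolding m_def by (rule cINF_lower[OF bdd that])
  have "\<exists>x\<in>K. J x < m + inverse (real (Suc k))" for k
    using cINF_less_iff[OF _ bdd, of "m + inverse (real (Suc k))"] K0
    by (auto simp: m_def[symmetric])
  then obtain s where s: "\<And>k. s k \<in> K" "\<And>k. J (s k) < m + inverse (real (Suc k))"
    by metis
  \<comment> \<open>The midpoint of x and y lies in K, so \<open>J\<close> is at least m there; this
    bounds the norm of x + y from below, hence that of x - y from above.\<close>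
  have half: "(norm (x - y))\<^sup>2 \<le> 2 * (J x - m) + 2 * (J y - m)" if xy: "x \<in> K" "y \<in> K" for x y
  proof -
    let ?c = "complex_of_real (1/2)"
    have "f (?c *\<^sub>C (x + y)) = ?c * (f x + f y)"
      using xy by (simp add: scale Kadd add)
    then have "Re (f (?c *\<^sub>C (x + y))) = (Re (f x) + Re (f y)) / 2"
      by (simp only: complex.sel times_complex.sel plus_complex.sel Re_complex_of_real
          Im_complex_of_real)
    then have "J (?c *\<^sub>C (x + y)) = (norm (x + y))\<^sup>2 / 4 - (Re (f x) + Re (f y))"
      unfolding J_def by (simp add: norm_scaleC power_mult_distrib power2_eq_square)
    moreover have "m \<le> J (?c *\<^sub>C (x + y))"
      by (rule mle) (intro Kscale Kadd xy)
    moreover have "(norm (x - y))\<^sup>2 + (norm (x + y))\<^sup>2 = 2 * (norm x)\<^sup>2 + 2 * (norm y)\<^sup>2"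
      by (simp add: norm_add_squared norm_diff_squared)
    ultimately show ?thesis unfolding J_def by argo
  qed
  have "Cauchy s"
  proof (rule metric_CauchyI)
    fix e :: real assume e: "e > 0"
    have "e\<^sup>2 / 4 > 0" using e by simp
    then obtain N where N: "inverse (real (Suc N)) < e\<^sup>2 / 4"
      using reals_Archimedean by blast
    have "dist (s i) (s j) < e" if ij: "i \<ge> N" "j \<ge> N" for i j
    proof -
      have "J (s k) - m < e\<^sup>2 / 4" if "k \<ge> N" for k
      proof -
        have "inverse (real (Suc k)) \<le> inverse (real (Suc N))"
          using that by (simp add: divide_simps)
        then show ?thesis using s(2)[of k] N by linarith
      qed
      from this[OF ij(1)] this[OF ij(2)] have "(norm (s i - s j))\<^sup>2 < e\<^sup>2"
        using half[OF s(1) s(1), of i j] by argo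
      then show ?thesis using e by (simp add: dist_norm power_less_imp_less_base)
    qed
    then show "\<exists>M. \<forall>i\<ge>M. \<forall>j\<ge>M. dist (s i) (s j) < e" by blast
  qed
  then obtain z where z: "s \<longlonglongrightarrow> z" using Cauchy_convergent convergent_def by blast
  have zK: "z \<in> K" using closed_sequentially[OF cl _ z] s(1) by blast
  have fz: "(\<lambda>k. f (s k)) \<longlonglongrightarrow> f z"
  proof (rule Lim_null[THEN iffD2], rule Lim_null_comparison)
    have "norm (f (s k) - f z) \<le> C * norm (s k - z)" for k
    proof -
      have "f (s k) - f z = f (s k - z)"
        using add[OF s(1)[of k] Kscale[OF zK, of "-1"]] scale[OF zK, of "-1"]
        by (simp add: scaleC_minus_one)
      then show ?thesis using bound[OF complex_vector.subspace_diff[OF sub s(1) zK]] by simp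
    qed
    then show "\<forall>\<^sub>F k in sequentially. norm (f (s k) - f z) \<le> C * norm (s k - z)" by simp
    show "(\<lambda>k. C * norm (s k - z)) \<longlonglongrightarrow> 0"
      using tendsto_mult_right_zero[OF tendsto_norm_zero[OF Lim_null[THEN iffD1, OF z]]] .
  qed
  have "(\<lambda>k. J (s k)) \<longlonglongrightarrow> J z"
    unfolding J_def by (intro tendsto_intros z fz)
  moreover have "(\<lambda>k. J (s k)) \<longlonglongrightarrow> m"
  proof (rule tendsto_sandwich[of "\<lambda>k. m" _ _ "\<lambda>k. m + inverse (real (Suc k))"])
    show "(\<lambda>k. m + inverse (real (Suc k))) \<longlonglongrightarrow> m"
      using tendsto_add[OF tendsto_const[of m] LIMSEQ_inverse_real_of_nat] by simp
    show "\<forall>\<^sub>F k in sequentially. m \<le> J (s k)" using mle s(1) by simp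
    show "\<forall>\<^sub>F k in sequentially. J (s k) \<le> m + inverse (real (Suc k))"
      by (intro always_eventually allI less_imp_le s(2))
  qed simp
  ultimately have Jz: "J z = m" using LIMSEQ_unique by blast
  \<comment> \<open>First variation at the minimiser in the direction x. Real multiples of x give
    only real parts; the imaginary part comes from i x afterwards.\<close>
  have re: "Re (f x) = Re (cinner x z)" if x: "x \<in> K" for x
  proof -
    define d where "d = Re (cinner x z) - Re (f x)"
    have ineq: "0 \<le> t\<^sup>2 * (norm x)\<^sup>2 + 2 * t * d" for t :: real
    proof -
      let ?y = "complex_of_real t *\<^sub>C x"
      have "m \<le> J (?y + z)" by (intro mle Kadd Kscale x zK)
      also have "J (?y + z) = J z + (t\<^sup>2 * (norm x)\<^sup>2 + 2 * t * d)"
        unfolding J_def norm_add_squared d_def using x zK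
        by (simp add: add Kscale scale norm_scaleC cinner_scaleC_left power_mult_distrib algebra_simps)
      finally show ?thesis using Jz by simp
    qed
    have "d = 0"
    proof (rule ccontr)
      assume d: "d \<noteq> 0"
      \<comment> \<open>The quadratic in t is smallest at t = -d / |x|^2. The added 1 keeps the
        denominator positive when x = 0, and the value at this t is still negative.\<close>
      let ?a = "(norm x)\<^sup>2 + 1"
      have a: "?a > 0" by (smt (verit) zero_le_power2)
      have "0 \<le> (- d / ?a)\<^sup>2 * (norm x)\<^sup>2 + 2 * (- d / ?a) * d" by (rule ineq)
      also have "\<dots> \<le> (- d / ?a)\<^sup>2 * ?a + 2 * (- d / ?a) * d"
        by (intro add_right_mono mult_left_mono) auto
      also have "\<dots> = - (d\<^sup>2 / ?a)"
      proof -
        have "(- d / b)\<^sup>2 * b + 2 * (- d / b) * d = - (d\<^sup>2 / b)" if "b > 0" for b :: real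
          using that by (simp add: power2_eq_square)
        then show ?thesis using a by blast
      qed
      also have "\<dots> < 0" using a d by simp
      finally show False by simp
    qed
    then show ?thesis by (simp add: d_def)
  qed
  have "f x = cinner x z" if x: "x \<in> K" for x
  proof (rule complex_eqI)
    show "Re (f x) = Re (cinner x z)" by (rule re[OF x])
    have "Re (f (\<i> *\<^sub>C x)) = Re (cinner (\<i> *\<^sub>C x) z)" by (rule re) (rule Kscale[OF x])
    then show "Im (f x) = Im (cinner x z)" using x by (simp add: scale cinner_scaleC_left)
  qed
  with zK that show thesis by blast
qed

section \<open>Existence and boundedness of adjoints\<close>

lemma adj_eqI:
  assumes "hilbert_subspace K" "z \<in> K" "\<And>x. x \<in> K \<Longrightarrow> cinner (T x) y = cinner x z"
  shows "adj K T y = z"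
  unfolding adj_def
proof (rule the_equality)
  show "z \<in> K \<and> (\<forall>x\<in>K. cinner (T x) y = cinner x z)" using assms by blast
  fix w assume "w \<in> K \<and> (\<forall>x\<in>K. cinner (T x) y = cinner x w)"
  then show "w = z"
    using assms unfolding hilbert_subspace_def by (intro cinner_eqI[of K]) auto
qed

lemma cinner_adj:
  fixes T :: "'a::complex_hilbert \<Rightarrow> 'a"
  assumes T: "bounded_op T"
  shows "cinner (T x) y = cinner x (adj UNIV T y)"
proof -
  obtain C where C: "C > 0" "\<And>x. norm (T x) \<le> C * norm x" using bounded_op_bound[OF T] by blast
  obtain z where z: "\<And>x. cinner (T x) y = cinner x z"
  proof (rule riesz_representation[of UNIV "\<lambda>x. cinner (T x) y" "C * norm y"])
    fix x
    have "cmod (cinner (T x) y) \<le> norm (T x) * norm y" by (rule norm_cinner_le)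
    also have "\<dots> \<le> C * norm x * norm y" by (intro mult_right_mono C) simp
    finally show "cmod (cinner (T x) y) \<le> C * norm y * norm x" by (simp add: mult_ac)
  qed (auto simp: bounded_op_add[OF T] bounded_op_scaleC[OF T] cinner_add_left cinner_scaleC_left)
  then have "adj UNIV T y = z" by (intro adj_eqI) auto
  with z show ?thesis by simp
qed

lemma norm_adjoint_le:
  fixes T :: "'a::complex_hilbert \<Rightarrow> 'b::complex_hilbert"
  assumes adj: "\<And>x y. cinner (T x) y = cinner x (S y)"
    and C: "\<And>x. norm (T x) \<le> C * norm x" and C0: "0 \<le> C"
  shows "norm (S y) \<le> C * norm y"
proof (cases "S y = 0")
  case True
  then show ?thesis using C0 by simp
next
  case False
  have "(norm (S y))\<^sup>2 = Re (cinner (T (S y)) y)" by (simp add: adj)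
  also have "\<dots> \<le> norm (T (S y)) * norm y"
    by (rule order_trans[OF complex_Re_le_cmod norm_cinner_le])
  also have "\<dots> \<le> C * norm (S y) * norm y" by (intro mult_right_mono C) simp
  finally show ?thesis using False by (simp add: power2_eq_square mult_ac)
qed

lemma bounded_op_adjoint:
  fixes T :: "'a::complex_hilbert \<Rightarrow> 'b::complex_hilbert"
  assumes T: "bounded_op T" and adj: "\<And>x y. cinner (T x) y = cinner x (S y)"
  shows "bounded_op S"
proof -
  obtain C where C: "C > 0" "\<And>x. norm (T x) \<le> C * norm x" using bounded_op_bound[OF T] by blast
  show ?thesis
  proof (rule bounded_opI[where C = C])
    show "S (x + y) = S x + S y" for x y
      by (rule cinner_eqI_UNIV) (simp add: adj[symmetric] cinner_add_right)
    show "S (c *\<^sub>C x) = c *\<^sub>C S x" for c x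
      by (rule cinner_eqI_UNIV) (simp add: adj[symmetric] cinner_scaleC_right)
    show "norm (S x) \<le> C * norm x" for x
      by (rule norm_adjoint_le[OF adj C(2)]) (use C(1) in simp)
  qed
qed

lemma contraction_bounded_op: "contraction UNIV T \<Longrightarrow> bounded_op T"
  by (simp add: contraction_def)

lemma bounded_op_adj: "bounded_op T \<Longrightarrow> bounded_op (adj UNIV T)"
  by (rule bounded_op_adjoint[OF _ cinner_adj])

lemma norm_adj_contraction_le:
  assumes "contraction UNIV T"
  shows "norm (adj UNIV T x) \<le> norm x"
  using norm_adjoint_le[OF cinner_adj[OF contraction_bounded_op[OF assms]], of 1] assms
  by (simp add: contraction_def)

section \<open>Positive operators and their square roots\<close>

lemma positive_op_bounded_op: "positive_op UNIV T \<Longrightarrow> bounded_op T"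
  by (simp add: positive_op_def)

lemma positive_op_ge_0: "positive_op UNIV T \<Longrightarrow> 0 \<le> Re (cinner (T x) x)"
  by (simp add: positive_op_def)

text \<open>The quadratic form is real at x + y and at x + i y. These two tests force the imaginary
  parts of <Tx, y> and <Ty, x> to be opposite and their real parts to agree.\<close>

lemma positive_op_selfadjoint:
  assumes T: "positive_op UNIV T"
  shows "cinner (T x) y = cinner x (T y)"
proof -
  have bT: "bounded_op T" by (rule positive_op_bounded_op[OF T])
  have real: "Im (cinner (T u) u) = 0" for u
    using T unfolding positive_op_def by (auto simp: complex_is_Real_iff)
  define a where "a = cinner (T x) y"
  define b where "b = cinner (T y) x"
  have "Im (a + b) = 0"
    using real[of "x + y"] real[of x] real[of y]
    by (simp add: bounded_op_add[OF bT] cinner_add_left cinner_add_right a_def b_def)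
  moreover have "Im (- \<i> * a + \<i> * b) = 0"
    using real[of "x + \<i> *\<^sub>C y"] real[of x] real[of y]
    by (simp add: bounded_op_add[OF bT] bounded_op_scaleC[OF bT] cinner_add_left cinner_add_right
        cinner_scaleC_left cinner_scaleC_right a_def b_def)
  ultimately have "a = cnj b" by (simp add: complex_eq_iff)
  then show ?thesis unfolding a_def b_def by (metis cinner_commute)
qed

lemma positive_opI:
  assumes "bounded_op T" "\<And>x y. cinner (T x) y = cinner x (T y)" "\<And>x. 0 \<le> Re (cinner (T x) x)"
  shows "positive_op UNIV T"
proof -
  have "cinner (T x) x \<in> \<real>" for x
    by (metis assms(2) cinner_commute Reals_cnj_iff)
  then show ?thesis using assms by (simp add: positive_op_def)
qed

text \<open>A nonnegative form that vanishes at x is minimal there, so its first variation vanishes;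
  in the direction \<open>T x\<close> that variation is a multiple of |Tx|^2.\<close>

lemma positive_op_kernel:
  assumes T: "positive_op UNIV T" and 0: "Re (cinner (T x) x) = 0"
  shows "T x = 0"
proof -
  have bT: "bounded_op T" by (rule positive_op_bounded_op[OF T])
  define y where "y = T x"
  define k where "k = Re (cinner (T y) y)"
  have k: "k \<ge> 0" unfolding k_def by (rule positive_op_ge_0[OF T])
  have "0 \<le> 2 * t * (norm y)\<^sup>2 + t\<^sup>2 * k" for t :: real
  proof -
    have "0 \<le> Re (cinner (T (x + complex_of_real t *\<^sub>C y)) (x + complex_of_real t *\<^sub>C y))"
      by (rule positive_op_ge_0[OF T])
    also have "\<dots> = 2 * t * (norm y)\<^sup>2 + t\<^sup>2 * k"
      using 0 positive_op_selfadjoint[OF T, of y x]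
      by (simp add: bounded_op_add[OF bT] bounded_op_scaleC[OF bT] cinner_add_left cinner_add_right
          cinner_scaleC_left cinner_scaleC_right y_def[symmetric] k_def power2_eq_square algebra_simps)
    finally show ?thesis .
  qed
  \<comment> \<open>As in the Riesz argument, \<open>k + 1\<close> replaces k in the optimal
    parameter so that k = 0 is covered.\<close>
  from this[of "- (norm y)\<^sup>2 / (k + 1)"]
  have "0 \<le> 2 * (- (norm y)\<^sup>2 / (k + 1)) * (norm y)\<^sup>2 + (- (norm y)\<^sup>2 / (k + 1))\<^sup>2 * k" .
  also have "\<dots> \<le> 2 * (- (norm y)\<^sup>2 / (k + 1)) * (norm y)\<^sup>2 + (- (norm y)\<^sup>2 / (k + 1))\<^sup>2 * (k + 1)"
    by (intro add_left_mono mult_left_mono) auto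
  also have "\<dots> = - ((norm y)\<^sup>2 * (norm y)\<^sup>2 / (k + 1))"
  proof -
    have "(- a / b)\<^sup>2 * b = a * a / b" if "b > 0" for a b :: real
      using that by (simp add: power2_eq_square)
    then show ?thesis using k by simp
  qed
  finally have "(norm y)\<^sup>2 * (norm y)\<^sup>2 / (k + 1) \<le> 0" by simp
  then have "(norm y)\<^sup>2 * (norm y)\<^sup>2 \<le> 0" using k by (simp add: divide_le_0_iff)
  then have "norm y = 0" by (metis zero_le_power2 mult_nonneg_nonneg order_antisym mult_eq_0_iff power_eq_0_iff)
  then show ?thesis by (simp add: y_def)
qed

text \<open>The index is the sum of the coefficients; it bounds the norm when \<open>S\<close> is a contraction.\<close>

inductive nonneg_poly :: "('a::complex_hilbert \<Rightarrow> 'a) \<Rightarrow> real \<Rightarrow> ('a \<Rightarrow> 'a) \<Rightarrow> bool"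
  for S where
  zero: "nonneg_poly S 0 (\<lambda>x. 0)"
| base: "nonneg_poly S 1 S"
| add: "nonneg_poly S a A \<Longrightarrow> nonneg_poly S b B \<Longrightarrow> nonneg_poly S (a + b) (\<lambda>x. A x + B x)"
| mult: "nonneg_poly S a A \<Longrightarrow> nonneg_poly S b B \<Longrightarrow> nonneg_poly S (a * b) (\<lambda>x. A (B x))"
| scale: "nonneg_poly S a A \<Longrightarrow> 0 \<le> c \<Longrightarrow> nonneg_poly S (c * a) (\<lambda>x. complex_of_real c *\<^sub>C A x)"

lemma nonneg_poly_bounds:
  assumes "nonneg_poly S r A" "bounded_op S" "\<And>x. norm (S x) \<le> norm x"
  shows "bounded_op A \<and> 0 \<le> r \<and> (\<forall>x. norm (A x) \<le> r * norm x)"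
  using assms(1)
proof induction
  case (add a A b B)
  have "norm (A x + B x) \<le> (a + b) * norm x" for x
    using add norm_triangle_ineq[of "A x" "B x"] by (smt (verit) distrib_right)
  with add show ?case by (auto intro: bounded_op_plus)
next
  case (mult a A b B)
  have "norm (A (B x)) \<le> a * b * norm x" for x
    using mult by (metis (no_types, lifting) mult.assoc mult_left_mono order_trans)
  with mult show ?case by (auto intro: bounded_op_comp)
next
  case (scale a A c)
  then show ?case
    by (auto intro: bounded_op_scale simp: norm_scaleC mult.assoc mult_left_mono)
qed (use assms in \<open>auto intro: bounded_op_const_zero\<close>)

text \<open>Used twice in a row it shows that two polynomials in S commute: first with T = S, then
  with T one of the polynomials.\<close>

lemma nonneg_poly_commute:
  assumes "nonneg_poly S r A" "bounded_op T" "\<And>x. T (S x) = S (T x)"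
  shows "T (A x) = A (T x)"
  using assms(1)
  by (induction arbitrary: x)
    (simp_all add: assms(3) bounded_op_zero[OF assms(2)] bounded_op_add[OF assms(2)]
      bounded_op_scaleC[OF assms(2)])

lemma nonneg_poly_selfadjoint:
  assumes "nonneg_poly S r A" "bounded_op S" "\<And>x y. cinner (S x) y = cinner x (S y)"
    "\<And>x. norm (S x) \<le> norm x"
  shows "cinner (A x) y = cinner x (A y)"
  using assms(1)
proof (induction arbitrary: x y)
  case (mult a A b B)
  have B: "bounded_op B" using nonneg_poly_bounds[OF mult(2) assms(2,4)] by simp
  have "B (S x) = S (B x)" for x
    using nonneg_poly_commute[OF mult(2) assms(2)] by simp
  then have "B (A y) = A (B y)" by (rule nonneg_poly_commute[OF mult(1) B])
  then show ?case using mult.IH by simp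
qed (auto simp: assms(3) cinner_add_left cinner_add_right cinner_scaleC_left cinner_scaleC_right)

text \<open>With R = 1 - Y, the equation R^2 = 1 - S becomes Y = (S + Y^2) / 2, which is solved by
  iteration from 0. Each iterate is a polynomial in S with nonnegative coefficients, and
  \<open>sqrt_iter_sum\<close> is the same recursion at S = 1, that is, the sum of these
  coefficients.\<close>

primrec sqrt_iter :: "('a::complex_hilbert \<Rightarrow> 'a) \<Rightarrow> nat \<Rightarrow> 'a \<Rightarrow> 'a" where
  "sqrt_iter S 0 x = 0"
| "sqrt_iter S (Suc m) x = complex_of_real (1/2) *\<^sub>C (S x + sqrt_iter S m (sqrt_iter S m x))"

primrec sqrt_iter_sum :: "nat \<Rightarrow> real" where
  "sqrt_iter_sum 0 = 0"
| "sqrt_iter_sum (Suc m) = (1/2) * (1 + sqrt_iter_sum m * sqrt_iter_sum m)"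

lemma nonneg_poly_sqrt_iter: "nonneg_poly S (sqrt_iter_sum m) (sqrt_iter S m)"
proof (induction m)
  case 0
  have "sqrt_iter S 0 = (\<lambda>x. 0)" by (rule ext) simp
  then show ?case using nonneg_poly.zero[of S] by simp
next
  case (Suc m)
  have "nonneg_poly S ((1/2) * (1 + sqrt_iter_sum m * sqrt_iter_sum m))
      (\<lambda>x. complex_of_real (1/2) *\<^sub>C (S x + sqrt_iter S m (sqrt_iter S m x)))"
    by (intro nonneg_poly.scale nonneg_poly.add nonneg_poly.base nonneg_poly.mult Suc) simp
  then show ?case by simp
qed

lemma sqrt_iter_sum_le_1: "0 \<le> sqrt_iter_sum m \<and> sqrt_iter_sum m \<le> 1"
  by (induction m) (auto intro: mult_le_one)

text \<open>\<open>Y\<^sub>m\<^sub>+\<^sub>2 - Y\<^sub>m\<^sub>+\<^sub>1 = (Y\<^sub>m\<^sub>+\<^sub>1 - Y\<^sub>m) (Y\<^sub>m\<^sub>+\<^sub>1 + Y\<^sub>m) / 2\<close>, since the iterates commute.\<close>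

lemma nonneg_poly_sqrt_iter_diff:
  assumes S: "bounded_op S" "\<And>x. norm (S x) \<le> norm x"
  shows "nonneg_poly S (sqrt_iter_sum (Suc m) - sqrt_iter_sum m)
    (\<lambda>x. sqrt_iter S (Suc m) x - sqrt_iter S m x)"
proof (induction m)
  case 0
  show ?case using nonneg_poly.scale[OF nonneg_poly.base, of "1/2" S] by simp
next
  case (Suc m)
  let ?Y = "sqrt_iter S m" and ?Z = "sqrt_iter S (Suc m)"
  let ?y = "sqrt_iter_sum m" and ?z = "sqrt_iter_sum (Suc m)"
  have bY: "bounded_op ?Y" and bZ: "bounded_op ?Z"
    using nonneg_poly_bounds[OF nonneg_poly_sqrt_iter S] by blast+
  have "?Y (S x) = S (?Y x)" for x
    using nonneg_poly_commute[OF nonneg_poly_sqrt_iter S(1)] by simp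
  then have comm: "?Y (?Z x) = ?Z (?Y x)" for x
    by (rule nonneg_poly_commute[OF nonneg_poly_sqrt_iter bY])
  have "nonneg_poly S ((1/2) * ((?z - ?y) * (?z + ?y)))
     (\<lambda>x. complex_of_real (1/2) *\<^sub>C ((\<lambda>x. ?Z x - ?Y x) (?Z x + ?Y x)))"
    by (intro nonneg_poly.scale nonneg_poly.mult[OF Suc] nonneg_poly.add nonneg_poly_sqrt_iter) simp
  also have "(1/2) * ((?z - ?y) * (?z + ?y)) = sqrt_iter_sum (Suc (Suc m)) - ?z"
    by (simp only: sqrt_iter_sum.simps) (simp add: field_simps)
  also have "(\<lambda>x. complex_of_real (1/2) *\<^sub>C ((\<lambda>x. ?Z x - ?Y x) (?Z x + ?Y x)))
      = (\<lambda>x. sqrt_iter S (Suc (Suc m)) x - ?Z x)"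
  proof
    fix x
    have "sqrt_iter S (Suc (Suc m)) x - ?Z x
        = complex_of_real (1/2) *\<^sub>C (S x + ?Z (?Z x)) - complex_of_real (1/2) *\<^sub>C (S x + ?Y (?Y x))"
      by simp
    also have "\<dots> = complex_of_real (1/2) *\<^sub>C (?Z (?Z x) - ?Y (?Y x))"
      by (simp add: complex_vector.scale_right_diff_distrib[symmetric])
    also have "\<dots> = complex_of_real (1/2) *\<^sub>C ((\<lambda>x. ?Z x - ?Y x) (?Z x + ?Y x))"
      by (simp only: bounded_op_add[OF bY] bounded_op_add[OF bZ] comm) simp
    finally show "complex_of_real (1/2) *\<^sub>C ((\<lambda>x. ?Z x - ?Y x) (?Z x + ?Y x))
      = sqrt_iter S (Suc (Suc m)) x - ?Z x" by simp
  qed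
  finally show ?case .
qed

text \<open>The increments of the iterates are bounded in norm by the increments of
  \<open>sqrt_iter_sum\<close>, a monotone sequence bounded by 1. The latter telescope to a
  convergent series, which gives pointwise convergence of the operators.\<close>

lemma contraction_sqrt_limit:
  assumes S: "bounded_op S" "\<And>x. norm (S x) \<le> norm x"
  obtains Y where "\<And>x. (\<lambda>m. sqrt_iter S m x) \<longlonglongrightarrow> Y x"
    "\<And>x. norm (Y x) \<le> norm x" "\<And>x. 2 *\<^sub>C Y x = S x + Y (Y x)"
proof -
  let ?Y = "sqrt_iter S" and ?t = sqrt_iter_sum
  have bY: "bounded_op (?Y m)" and leY: "norm (?Y m x) \<le> norm x" for m x
  proof -
    have n: "bounded_op (?Y m) \<and> 0 \<le> ?t m \<and> (\<forall>x. norm (?Y m x) \<le> ?t m * norm x)"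
      by (rule nonneg_poly_bounds[OF nonneg_poly_sqrt_iter S])
    then show "bounded_op (?Y m)" by blast
    have "norm (?Y m x) \<le> ?t m * norm x" using n by blast
    also have "\<dots> \<le> 1 * norm x" using sqrt_iter_sum_le_1 by (intro mult_right_mono) auto
    finally show "norm (?Y m x) \<le> norm x" by simp
  qed
  have step: "norm (?Y (Suc m) x - ?Y m x) \<le> (?t (Suc m) - ?t m) * norm x"
    and inc: "?t m \<le> ?t (Suc m)" for m x
    using nonneg_poly_bounds[OF nonneg_poly_sqrt_iter_diff[OF S] S] by (simp_all del: sqrt_iter.simps sqrt_iter_sum.simps)
  have "convergent ?t"
  proof (rule Bseq_mono_convergent)
    show "Bseq ?t" using sqrt_iter_sum_le_1 by (auto intro!: BseqI'[where K = 1])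
    show "\<forall>m n. m \<le> n \<longrightarrow> ?t m \<le> ?t n" using lift_Suc_mono_le[of ?t] inc by blast
  qed
  then obtain l where l: "?t \<longlonglongrightarrow> l" by (auto simp: convergent_def)
  have "convergent (\<lambda>m. ?Y m x)" for x
  proof -
    have "summable (\<lambda>m. (?t (Suc m) - ?t m) * norm x)"
      by (rule summable_mult2[OF telescope_summable[OF l]])
    then have "summable (\<lambda>m. ?Y (Suc m) x - ?Y m x)"
      by (rule summable_comparison_test') (use step in \<open>auto simp del: sqrt_iter.simps sqrt_iter_sum.simps\<close>)
    then have "convergent (\<lambda>k. \<Sum>m<k. ?Y (Suc m) x - ?Y m x)"
      by (simp only: summable_iff_convergent)
    then show ?thesis
      by (simp add: sum_lessThan_telescope[of "\<lambda>m. ?Y m x"] del: sqrt_iter.simps(2))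
  qed
  then obtain Y where Y: "\<And>x. (\<lambda>m. ?Y m x) \<longlonglongrightarrow> Y x" unfolding convergent_def by metis
  have nY: "norm (Y x) \<le> norm x" for x
    by (rule tendsto_upperbound[OF tendsto_norm[OF Y]]) (use leY in auto)
  have YY: "(\<lambda>m. ?Y m (?Y m x)) \<longlonglongrightarrow> Y (Y x)" for x
  proof -
    \<comment> \<open>Operator and argument both vary with m. All iterates are contractions, so
      replacing the inner argument by its limit costs a null sequence.\<close>
    have "(\<lambda>m. ?Y m (?Y m x - Y x)) \<longlonglongrightarrow> 0"
      by (rule Lim_null_comparison[OF _ tendsto_norm_zero[OF Lim_null[THEN iffD1, OF Y[of x]]]])
        (use leY in auto)
    from tendsto_add[OF this Y[of "Y x"]] show ?thesis
      by (simp add: bounded_op_diff[OF bY])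
  qed
  have "2 *\<^sub>C Y x = S x + Y (Y x)" for x
  proof -
    have "(\<lambda>m. 2 *\<^sub>C ?Y (Suc m) x) \<longlonglongrightarrow> 2 *\<^sub>C Y x"
      by (intro bounded_linear.tendsto[OF bounded_linear_scaleC] LIMSEQ_Suc Y)
    moreover have "2 *\<^sub>C ?Y (Suc m) x = S x + ?Y m (?Y m x)" for m
      by (simp add: scaleC_scaleC)
    moreover have "(\<lambda>m. S x + ?Y m (?Y m x)) \<longlonglongrightarrow> S x + Y (Y x)"
      by (intro tendsto_intros YY)
    ultimately show ?thesis using LIMSEQ_unique by simp
  qed
  with Y nY that show thesis by blast
qed

text \<open>Dividing by a norm bound C makes S = 1 - T / C a positive contraction; if Y solves 2 Y =
  S + Y^2, then sqrt C (1 - Y) squares to T. The last conclusion, that the root commutes with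
  whatever commutes with T, is what uniqueness rests on.\<close>

lemma positive_op_sqrt_exists:
  assumes T: "positive_op UNIV T"
  obtains R where "positive_op UNIV R" "\<And>x. R (R x) = T x"
    "\<And>A x. bounded_op A \<Longrightarrow> (\<And>x. A (T x) = T (A x)) \<Longrightarrow> A (R x) = R (A x)"
proof -
  have bT: "bounded_op T" by (rule positive_op_bounded_op[OF T])
  obtain C where C: "C > 0" "\<And>x. norm (T x) \<le> C * norm x" using bounded_op_bound[OF bT] by blast
  have saT: "cinner (T x) y = cinner x (T y)" for x y by (rule positive_op_selfadjoint[OF T])
  define c where "c = complex_of_real (1 / C)"
  define S where "S = (\<lambda>x. x - c *\<^sub>C T x)"
  have bS: "bounded_op S"
    unfolding S_def by (intro bounded_op_minus bounded_op_id bounded_op_scale bT)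
  have saS: "cinner (S x) y = cinner x (S y)" for x y
    unfolding S_def c_def
    by (simp add: cinner_diff_left cinner_diff_right cinner_scaleC_left cinner_scaleC_right saT)
  have TC: "Re (cinner (T x) x) \<le> C * (norm x)\<^sup>2" for x
  proof -
    have "Re (cinner (T x) x) \<le> norm (T x) * norm x"
      by (rule order_trans[OF complex_Re_le_cmod norm_cinner_le])
    also have "\<dots> \<le> C * norm x * norm x" by (intro mult_right_mono C) simp
    finally show ?thesis by (simp add: power2_eq_square mult.assoc)
  qed
  have posS: "positive_op UNIV S"
  proof (rule positive_opI[OF bS saS])
    fix x
    show "0 \<le> Re (cinner (S x) x)"
      using TC[of x] C(1) unfolding S_def c_def
      by (simp add: cinner_diff_left cinner_scaleC_left field_simps)
  qed
  have leS: "norm (S x) \<le> norm x" for x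
  proof -
    text \<open>\<open>\<langle>S\<^sup>2 x, x\<rangle> + \<langle>S (1 - S) x, x\<rangle> = \<langle>S x, x\<rangle>\<close>, where \<open>S (1 - S)\<close> is positive because
      \<open>S (1 - S) = S (1 - S) S + (1 - S) S (1 - S)\<close>.\<close>
    define P where "P = (\<lambda>x. c *\<^sub>C T x)"
    have PS: "P x = x - S x" for x by (simp add: P_def S_def)
    have pP: "0 \<le> Re (cinner (P x) x)" for x
      using positive_op_ge_0[OF T, of x] C(1) by (simp add: P_def c_def cinner_scaleC_left)
    have 1: "0 \<le> Re (cinner (P (S x)) (S x))" by (rule pP)
    have 2: "0 \<le> Re (cinner (S (P x)) (P x))" by (rule positive_op_ge_0[OF posS])
    have "Re (cinner (P (S x)) (S x)) + Re (cinner (S (P x)) (P x)) = Re (cinner (S x) (P x))"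
    proof -
      have "cinner (P (S x)) (S x) = cinner (S x) (S x) - cinner (S (S x)) (S x)"
        by (simp add: PS cinner_diff_left)
      moreover have "cinner (S (P x)) (P x)
          = cinner (S x) x - cinner (S x) (S x) - cinner (S (S x)) x + cinner (S (S x)) (S x)"
        by (simp add: PS bounded_op_diff[OF bS] cinner_diff_left cinner_diff_right)
      moreover have "cinner (S (S x)) x = cinner (S x) (S x)" by (rule saS)
      ultimately show ?thesis by (simp add: PS cinner_diff_right)
    qed
    with 1 2 have "0 \<le> Re (cinner (S x) (P x))" by linarith
    then have "(norm (S x))\<^sup>2 \<le> Re (cinner (S x) x)" by (simp add: PS cinner_diff_right)
    also have "\<dots> \<le> norm (S x) * norm x"
      by (rule order_trans[OF complex_Re_le_cmod norm_cinner_le])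
    finally show ?thesis
      by (metis norm_ge_zero power2_eq_square mult_le_cancel_left_pos linorder_not_le order_less_le_trans)
  qed
  obtain Y where Y: "\<And>x. (\<lambda>m. sqrt_iter S m x) \<longlonglongrightarrow> Y x"
    "\<And>x. norm (Y x) \<le> norm x" "\<And>x. 2 *\<^sub>C Y x = S x + Y (Y x)"
    using contraction_sqrt_limit[OF bS leS] by metis
  have bn: "bounded_op (sqrt_iter S m)" for m
    using nonneg_poly_bounds[OF nonneg_poly_sqrt_iter bS leS] by blast
  have bY: "bounded_op Y"
  proof (rule bounded_opI[where C = 1])
    show "Y (x + y) = Y x + Y y" for x y
      by (rule LIMSEQ_unique[OF Y(1)])
        (simp add: bounded_op_add[OF bn] tendsto_add[OF Y(1) Y(1)])
    show "Y (c *\<^sub>C x) = c *\<^sub>C Y x" for c x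
      by (rule LIMSEQ_unique[OF Y(1)])
        (simp add: bounded_op_scaleC[OF bn] bounded_linear.tendsto[OF bounded_linear_scaleC Y(1)])
  qed (use Y(2) in simp)
  have saY: "cinner (Y x) y = cinner x (Y y)" for x y
  proof (rule LIMSEQ_unique[OF tendsto_cinner_left[OF Y(1)]])
    show "(\<lambda>m. cinner (sqrt_iter S m x) y) \<longlonglongrightarrow> cinner x (Y y)"
      unfolding nonneg_poly_selfadjoint[OF nonneg_poly_sqrt_iter bS saS leS]
      by (rule tendsto_cinner_right[OF Y(1)])
  qed
  define d where "d = complex_of_real (sqrt C)"
  define R where "R = (\<lambda>x. d *\<^sub>C (x - Y x))"
  have bR: "bounded_op R"
    unfolding R_def by (intro bounded_op_minus bounded_op_id bounded_op_scale bY)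
  have "positive_op UNIV R"
  proof (rule positive_opI[OF bR])
    show "cinner (R x) y = cinner x (R y)" for x y
      unfolding R_def d_def
      by (simp add: cinner_diff_left cinner_diff_right cinner_scaleC_left cinner_scaleC_right saY)
    show "0 \<le> Re (cinner (R x) x)" for x
    proof -
      have "Re (cinner (Y x) x) \<le> norm (Y x) * norm x"
        by (rule order_trans[OF complex_Re_le_cmod norm_cinner_le])
      also have "\<dots> \<le> (norm x)\<^sup>2" using Y(2)[of x] by (simp add: power2_eq_square mult_right_mono)
      finally show ?thesis using C(1)
        by (simp add: R_def d_def cinner_scaleC_left cinner_diff_left)
    qed
  qed
  moreover have "R (R x) = T x" for x
  proof -
    have "R (R x) = (d * d) *\<^sub>C (x - Y x - Y (x - Y x))"
      by (simp add: R_def bounded_op_scaleC[OF bY] scaleC_scaleC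
          complex_vector.scale_right_diff_distrib[symmetric])
    also have "d * d = complex_of_real C"
      using C(1) by (simp add: d_def flip: of_real_mult)
    also have "x - Y x - Y (x - Y x) = x - 2 *\<^sub>C Y x + Y (Y x)"
      using scaleC_add_left[of 1 1 "Y x"] by (simp add: bounded_op_diff[OF bY])
    also have "\<dots> = c *\<^sub>C T x"
      by (simp add: Y(3)) (simp add: S_def)
    finally show ?thesis using C(1) by (simp add: scaleC_scaleC c_def flip: of_real_mult)
  qed
  moreover have "A (R x) = R (A x)" if A: "bounded_op A" "\<And>x. A (T x) = T (A x)" for A x
  proof -
    have "A (S x) = S (A x)" for x
      by (simp add: S_def bounded_op_diff[OF A(1)] bounded_op_scaleC[OF A(1)] A(2))
    then have "A (sqrt_iter S m x) = sqrt_iter S m (A x)" for m x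
      by (rule nonneg_poly_commute[OF nonneg_poly_sqrt_iter A(1)])
    then have "(\<lambda>m. sqrt_iter S m (A x)) \<longlonglongrightarrow> A (Y x)"
      using bounded_op_tendsto[OF A(1) Y(1)[of x]] by simp
    then have "A (Y x) = Y (A x)" using LIMSEQ_unique[OF _ Y(1)] by blast
    then show ?thesis by (simp add: R_def bounded_op_diff[OF A(1)] bounded_op_scaleC[OF A(1)])
  qed
  ultimately show thesis using that by blast
qed

text \<open>For y = (R - Q) x, commutation gives (R + Q) y = R^2 x - Q^2 x = 0. Two nonnegative
  numbers <Ry, y> and <Qy, y> then sum to 0, so Ry = Qy = 0, and |y|^2 = <x, (R - Q) y>
  vanishes.\<close>

lemma positive_op_sqrt_unique:
  assumes R: "positive_op UNIV R" and Q: "positive_op UNIV Q"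
    and sq: "\<And>x. Q (Q x) = R (R x)" and comm: "\<And>x. Q (R x) = R (Q x)"
  shows "Q = R"
proof
  fix x
  have bR: "bounded_op R" and bQ: "bounded_op Q" using R Q positive_op_bounded_op by auto
  define y where "y = R x - Q x"
  have "R y + Q y = 0"
    by (simp add: y_def bounded_op_diff[OF bR] bounded_op_diff[OF bQ] sq comm)
  then have "Re (cinner (R y) y) + Re (cinner (Q y) y) = 0"
    by (metis cinner_add_left cinner_zero_left plus_complex.sel(1) zero_complex.sel(1))
  then have "Re (cinner (R y) y) = 0" "Re (cinner (Q y) y) = 0"
    using positive_op_ge_0[OF R, of y] positive_op_ge_0[OF Q, of y] by linarith+
  then have 0: "R y = 0" "Q y = 0" using positive_op_kernel R Q by blast+
  have "cinner y y = cinner x (R y) - cinner x (Q y)"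
    using positive_op_selfadjoint[OF R, of x y] positive_op_selfadjoint[OF Q, of x y]
    by (simp add: y_def cinner_diff_left)
  then have "y = 0" using 0 by simp
  then show "Q x = R x" by (simp add: y_def)
qed

text \<open>The description in \<open>op_sqrt\<close> requires uniqueness among all positive roots.
  A competing root Q commutes with T because T = Q Q, hence also with the constructed root.\<close>

theorem op_sqrt:
  assumes T: "positive_op UNIV T"
  shows "positive_op UNIV (op_sqrt T)" and "op_sqrt T (op_sqrt T x) = T x"
proof -
  obtain R where R: "positive_op UNIV R" "\<And>x. R (R x) = T x"
    "\<And>A x. bounded_op A \<Longrightarrow> (\<And>x. A (T x) = T (A x)) \<Longrightarrow> A (R x) = R (A x)"
    by (rule positive_op_sqrt_exists[OF T]) blast
  have "op_sqrt T = R"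
    unfolding op_sqrt_def
  proof (rule the_equality)
    show "positive_op UNIV R \<and> R \<circ> R = T" using R by auto
    fix Q assume Q: "positive_op UNIV Q \<and> Q \<circ> Q = T"
    then have QQ: "Q (Q x) = T x" for x by auto
    show "Q = R"
    proof (rule positive_op_sqrt_unique[OF R(1)])
      show "positive_op UNIV Q" using Q by blast
      show "Q (Q x) = R (R x)" for x by (simp add: QQ R(2))
      show "Q (R x) = R (Q x)" for x
        by (rule R(3)) (use Q in \<open>auto simp: positive_op_bounded_op QQ[symmetric]\<close>)
    qed
  qed
  then show "positive_op UNIV (op_sqrt T)" "op_sqrt T (op_sqrt T x) = T x" using R by auto
qed

lemma norm_op_sqrt_squared:
  assumes T: "positive_op UNIV T"
  shows "(norm (op_sqrt T x))\<^sup>2 = Re (cinner (T x) x)"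
  using positive_op_selfadjoint[OF op_sqrt(1)[OF T], of "op_sqrt T x" x]
  by (simp add: op_sqrt(2)[OF T] flip: Re_cinner_self)

section \<open>Orthonormal bases of finite-dimensional subspaces\<close>

definition orthonormal :: "'a::complex_inner set \<Rightarrow> bool"
  where "orthonormal B \<longleftrightarrow> (\<forall>a\<in>B. \<forall>b\<in>B. cinner a b = (if a = b then 1 else 0))"

lemma orthonormal_sum:
  assumes "orthonormal B" "finite B" "b \<in> B"
  shows "cinner (\<Sum>a\<in>B. f a *\<^sub>C a) b = f b"
proof -
  have "cinner (\<Sum>a\<in>B. f a *\<^sub>C a) b = (\<Sum>a\<in>B. if a = b then f b else 0)"
    unfolding cinner_sum_left
    by (rule sum.cong) (use assms in \<open>auto simp: orthonormal_def cinner_scaleC_left\<close>)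
  then show ?thesis using assms by simp
qed

lemma orthonormal_expansion:
  assumes B: "orthonormal B" "finite B" and x: "x \<in> complex_vector.span B"
  shows "x = (\<Sum>b\<in>B. cinner x b *\<^sub>C b)"
proof -
  obtain u where u: "x = (\<Sum>a\<in>B. u a *\<^sub>C a)"
    using x unfolding complex_vector.span_finite[OF B(2)] by auto
  then have "cinner x b = u b" if "b \<in> B" for b
    using orthonormal_sum[OF B that] by simp
  then show ?thesis using u by simp
qed

lemma orthonormal_independent:
  assumes B: "orthonormal B"
  shows "complex_vector.independent B"
  unfolding complex_vector.dependent_explicit
proof clarify
  fix T u v assume T: "finite T" "T \<subseteq> B" "(\<Sum>v\<in>T. u v *\<^sub>C v) = 0" "v \<in> T" "u v \<noteq> 0"
  have "orthonormal T" using B T(2) by (simp add: orthonormal_def subset_iff)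
  from orthonormal_sum[OF this T(1,4), of u] show False using T(3,5) by simp
qed

lemma orthonormal_insert_scaled:
  fixes y :: "'a::complex_inner"
  assumes B: "orthonormal B" and y: "y \<noteq> 0" and orth: "\<And>b. b \<in> B \<Longrightarrow> cinner y b = 0"
  defines "e \<equiv> complex_of_real (1 / norm y) *\<^sub>C y"
  shows "orthonormal (insert e B)" "e \<notin> B"
proof -
  have ee: "cinner e e = 1"
    using y by (simp add: e_def cinner_self norm_scaleC norm_divide)
  have eb: "cinner e b = 0" "cinner b e = 0" if "b \<in> B" for b
  proof -
    show "cinner e b = 0" using orth[OF that] by (simp add: e_def cinner_scaleC_left)
    then show "cinner b e = 0" by (metis cinner_commute complex_cnj_zero)
  qed
  show "e \<notin> B" using ee eb by fastforce
  then show "orthonormal (insert e B)"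
    using B ee eb by (auto simp: orthonormal_def)
qed

text \<open>Among the orthonormal sets between B and S, whose sizes are bounded by that of the
  spanning set F, take a largest one. A vector of S outside its span would enlarge it by one
  Gram-Schmidt step.\<close>

theorem orthonormal_basis_extension:
  assumes F: "finite F" and SF: "S \<subseteq> complex_vector.span F" and S: "complex_vector.subspace S"
    and B: "orthonormal B" "B \<subseteq> S"
  obtains C where "finite C" "orthonormal C" "B \<subseteq> C" "complex_vector.span C = S"
proof -
  let ?P = "\<lambda>C. orthonormal C \<and> B \<subseteq> C \<and> C \<subseteq> S"
  have card: "finite C \<and> card C \<le> card F" if "?P C" for C
    by (rule complex_vector.independent_span_bound[OF F orthonormal_independent])
      (use that SF in auto)
  obtain C where C: "?P C" and max: "\<And>C'. ?P C' \<Longrightarrow> card C' \<le> card C"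
    using ex_has_greatest_nat[of ?P B card "Suc (card F)"] B card
    by (metis (no_types, lifting) le_imp_less_Suc order_refl)
  have fC: "finite C" using card C by blast
  have "S \<subseteq> complex_vector.span C"
  proof (rule ccontr)
    assume "\<not> S \<subseteq> complex_vector.span C"
    then obtain x where x: "x \<in> S" "x \<notin> complex_vector.span C" by blast
    define y where "y = x - (\<Sum>b\<in>C. cinner x b *\<^sub>C b)"
    have sC: "(\<Sum>b\<in>C. cinner x b *\<^sub>C b) \<in> complex_vector.span C"
      by (intro complex_vector.span_sum complex_vector.span_scale complex_vector.span_base)
    then have "y \<noteq> 0" using x(2) by (auto simp: y_def)
    have orth: "cinner y b = 0" if "b \<in> C" for b
      using orthonormal_sum[OF _ fC that] C by (simp add: y_def cinner_diff_left)
    define e where "e = complex_of_real (1 / norm y) *\<^sub>C y"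
    have e: "orthonormal (insert e C)" "e \<notin> C"
      using orthonormal_insert_scaled[OF _ \<open>y \<noteq> 0\<close> orth] C unfolding e_def by blast+
    have "complex_vector.span C \<subseteq> S" by (rule complex_vector.span_minimal[OF _ S]) (use C in blast)
    then have "y \<in> S" unfolding y_def using sC x(1) S complex_vector.subspace_diff by blast
    then have "e \<in> S" unfolding e_def by (rule complex_vector.subspace_scale[OF S])
    then have "card (insert e C) \<le> card C" by (intro max) (use C e(1) in auto)
    then show False using e(2) fC by simp
  qed
  moreover have "complex_vector.span C \<subseteq> S"
    by (rule complex_vector.span_minimal[OF _ S]) (use C in blast)
  ultimately show thesis using that fC C by blast
qed

lemma orthonormal_basis_card_unique:
  assumes "finite B" "finite C" "orthonormal B" "orthonormal C"
    "complex_vector.span B = complex_vector.span C"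
  shows "card B = card C"
proof (rule le_antisym)
  have BC: "B \<subseteq> complex_vector.span C" "C \<subseteq> complex_vector.span B"
    using assms(5) complex_vector.span_superset by auto
  show "card B \<le> card C"
    using complex_vector.independent_span_bound[OF assms(2) orthonormal_independent[OF assms(3)]] BC
    by blast
  show "card C \<le> card B"
    using complex_vector.independent_span_bound[OF assms(1) orthonormal_independent[OF assms(4)]] BC
    by blast
qed

text \<open>The span is the solution set of ?P x = x for the continuous orthogonal projection ?P,
  given by the finite expansion in B.\<close>

lemma orthonormal_span_closed:
  fixes B :: "'a::complex_hilbert set"
  assumes "finite B" "orthonormal B"
  shows "closed (complex_vector.span B)"
proof -
  let ?P = "\<lambda>x. \<Sum>b\<in>B. cinner x b *\<^sub>C b"
  have "bounded_linear (\<lambda>c. c *\<^sub>C b)" for b :: 'a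
    by (rule bounded_linear_intro[where K = "norm b"])
      (auto simp: scaleC_add_left norm_scaleC scaleC_of_real[symmetric] scaleC_scaleC
        scaleR_conv_of_real)
  from bounded_linear_compose[OF this bounded_linear_cinner_left]
  have "bounded_linear (\<lambda>x. cinner x b *\<^sub>C b)" for b :: 'a .
  then have "bounded_linear ?P" by (intro bounded_linear_sum)
  then have "closed {x. ?P x - x = 0}"
    by (intro closed_Collect_eq continuous_intros linear_continuous_on)
  moreover have "{x. ?P x - x = 0} = complex_vector.span B"
  proof safe
    fix x assume "?P x - x = 0"
    then have "x = ?P x" by simp
    moreover have "?P x \<in> complex_vector.span B"
      by (intro complex_vector.span_sum complex_vector.span_scale complex_vector.span_base)
    ultimately show "x \<in> complex_vector.span B" by simp
  qed (use orthonormal_expansion[OF assms(2,1)] in simp)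
  ultimately show ?thesis by simp
qed

lemma fin_dim_subspace:
  fixes E S :: "'a::complex_hilbert set"
  assumes E: "fin_dim E" and S: "complex_vector.subspace S" "S \<subseteq> E"
  obtains B where "finite B" "orthonormal B" "complex_vector.span B = S"
proof -
  obtain F where "finite F" "E = complex_vector.span F" using E by (auto simp: fin_dim_def)
  with orthonormal_basis_extension[of F S "{}"] S that show thesis
    by (auto simp: orthonormal_def)
qed

lemma fin_dim_hilbert_subspace:
  assumes "fin_dim E" "complex_vector.subspace S" "S \<subseteq> E"
  shows "hilbert_subspace S" "fin_dim S"
proof -
  obtain B where B: "finite B" "orthonormal B" "complex_vector.span B = S"
    by (rule fin_dim_subspace[OF assms])
  show "hilbert_subspace S"
    using orthonormal_span_closed[OF B(1,2)] assms(2) B(3) by (simp add: hilbert_subspace_def)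
  show "fin_dim S" using B(1,3) by (auto simp: fin_dim_def)
qed

text \<open>T maps an orthonormal basis of S to an orthonormal subset of S of the same size;
  extended to a basis it cannot grow, so it is a basis already.\<close>

lemma fin_dim_isometry_surj:
  fixes T :: "'a::complex_hilbert \<Rightarrow> 'a"
  assumes S: "fin_dim S" and T: "bounded_op T" and TS: "\<And>x. x \<in> S \<Longrightarrow> T x \<in> S"
    and iso: "\<And>x y. x \<in> S \<Longrightarrow> y \<in> S \<Longrightarrow> cinner (T x) (T y) = cinner x y" and y: "y \<in> S"
  obtains x where "x \<in> S" "T x = y"
proof -
  obtain F where F: "finite F" "S = complex_vector.span F" using S by (auto simp: fin_dim_def)
  have sub: "complex_vector.subspace S" unfolding F by (rule complex_vector.subspace_span)
  obtain B where B: "finite B" "orthonormal B" "complex_vector.span B = S"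
    using fin_dim_subspace[OF S sub] by blast
  have BS: "B \<subseteq> S" using B complex_vector.span_superset by blast
  have inj: "inj_on T B"
  proof (rule inj_onI)
    fix a b assume ab: "a \<in> B" "b \<in> B" "T a = T b"
    have "cinner a b = cinner (T a) (T b)" using iso[of a b] ab(1,2) BS by (metis subsetD)
    also have "\<dots> = cinner a a" using iso[of a a] ab BS by auto
    finally show "a = b" using B(2) ab unfolding orthonormal_def by (metis zero_neq_one)
  qed
  have on: "orthonormal (T ` B)"
    using B(2) BS inj unfolding orthonormal_def
    by (auto simp: iso subset_iff inj_on_eq_iff)
  have "T ` B \<subseteq> S" using TS BS by auto
  then obtain C where C: "finite C" "orthonormal C" "T ` B \<subseteq> C" "complex_vector.span C = S"
    using orthonormal_basis_extension[OF F(1) _ sub on] F(2) by blast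
  have "card C = card B" by (rule orthonormal_basis_card_unique) (use B C in auto)
  then have "C = T ` B" using C(1,3) inj by (metis card_image card_subset_eq)
  then have "y = (\<Sum>b\<in>T ` B. cinner y b *\<^sub>C b)"
    using orthonormal_expansion[OF C(2,1)] y C(4) by simp
  also have "\<dots> = (\<Sum>b\<in>B. cinner y (T b) *\<^sub>C T b)" by (simp add: sum.reindex[OF inj])
  also have "\<dots> = T (\<Sum>b\<in>B. cinner y (T b) *\<^sub>C b)"
    by (simp add: bounded_op_sum[OF T] bounded_op_scaleC[OF T])
  finally show thesis
    using that complex_vector.subspace_sum[OF sub] complex_vector.subspace_scale[OF sub] BS
    by (metis (no_types, lifting) subsetD)
qed

section \<open>Extension of isometries to unitaries in finite dimension\<close>

lemma bounded_op_rank_one: "bounded_op (\<lambda>x. cinner x a *\<^sub>C b)"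
  for a :: "'a::complex_hilbert" and b :: "'b::complex_hilbert"
proof (rule bounded_opI[where C = "norm a * norm b"])
  fix x
  show "norm (cinner x a *\<^sub>C b) \<le> norm a * norm b * norm x"
    using mult_right_mono[OF norm_cinner_le[of x a], of "norm b"] by (simp add: norm_scaleC mult_ac)
qed (auto simp: cinner_add_left scaleC_add_left cinner_scaleC_left scaleC_scaleC)

lemma polarization:
  fixes A :: "'h::complex_hilbert \<Rightarrow> 'a::complex_hilbert" and B :: "'h \<Rightarrow> 'b::complex_hilbert"
  assumes A: "bounded_op A" and B: "bounded_op B" and norm: "\<And>h. norm (A h) = norm (B h)"
  shows "cinner (A g) (A h) = cinner (B g) (B h)"
proof -
  have re: "Re (cinner (A g) (A h)) = Re (cinner (B g) (B h))" for g h
    using norm[of "g + h"] norm[of g] norm[of h] norm_add_squared[of "A g" "A h"]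
      norm_add_squared[of "B g" "B h"] by (simp add: bounded_op_add[OF A] bounded_op_add[OF B])
  show ?thesis
  proof (rule complex_eqI[OF re])
    show "Im (cinner (A g) (A h)) = Im (cinner (B g) (B h))"
      using re[of g "\<i> *\<^sub>C h"]
      by (simp add: bounded_op_scaleC[OF A] bounded_op_scaleC[OF B] cinner_scaleC_right)
  qed
qed

text \<open>The two operators are inverse to each other only on E, but adjoint on the whole space,
  so inner products can be rewritten without membership conditions. The pairs built from bases below
  vanish on the orthogonal complement of E.\<close>

definition unitary_pair :: "'a::complex_hilbert set \<Rightarrow> ('a \<Rightarrow> 'a) \<Rightarrow> ('a \<Rightarrow> 'a) \<Rightarrow> bool"
  where "unitary_pair E U U' \<longleftrightarrow> bounded_op U \<and> bounded_op U'
    \<and> (\<forall>x y. cinner (U x) y = cinner x (U' y))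
    \<and> (\<forall>x\<in>E. U x \<in> E \<and> U' x \<in> E \<and> U (U' x) = x \<and> U' (U x) = x)"

lemma unitary_pair_sym:
  assumes "unitary_pair E U U'"
  shows "unitary_pair E U' U"
proof -
  have adj: "cinner (U x) y = cinner x (U' y)" for x y
    using assms by (simp add: unitary_pair_def)
  have "cinner (U' x) y = cinner x (U y)" for x y
    using adj[of y x] cinner_commute[of "U' x" y] cinner_commute[of x "U y"] by simp
  then show ?thesis using assms by (simp add: unitary_pair_def)
qed

lemma unitary_pair_bases:
  assumes B: "finite B" "orthonormal B" "complex_vector.span B = E"
    and C: "orthonormal C" "complex_vector.span C = E" and \<beta>: "bij_betw \<beta> B C"
  defines "U \<equiv> \<lambda>x. \<Sum>b\<in>B. cinner x b *\<^sub>C \<beta> b" and "U' \<equiv> \<lambda>x. \<Sum>b\<in>B. cinner x (\<beta> b) *\<^sub>C b"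
  shows "unitary_pair E U U'"
proof -
  have inj: "inj_on \<beta> B" and im: "\<beta> ` B = C" using \<beta> by (auto simp: bij_betw_def)
  have fC: "finite C" using im B(1) by auto
  have Ub: "cinner (U x) (\<beta> b) = cinner x b" if "b \<in> B" for x b
  proof -
    have "U x = (\<Sum>c\<in>C. cinner x (inv_into B \<beta> c) *\<^sub>C c)"
      unfolding U_def im[symmetric] by (simp add: sum.reindex[OF inj] inj)
    then show ?thesis using orthonormal_sum[OF C(1) fC] that im inj by auto
  qed
  have U'b: "cinner (U' x) b = cinner x (\<beta> b)" if "b \<in> B" for x b
    unfolding U'_def by (rule orthonormal_sum[OF B(2,1) that])
  have "U' (U x) = x" if "x \<in> E" for x
    using orthonormal_expansion[OF B(2,1)] that B(3) by (simp add: U'_def Ub)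
  moreover have "U (U' x) = x" if "x \<in> E" for x
  proof -
    have "U (U' x) = (\<Sum>b\<in>B. cinner x (\<beta> b) *\<^sub>C \<beta> b)"
      by (subst U_def) (simp add: U'b)
    also have "\<dots> = (\<Sum>c\<in>C. cinner x c *\<^sub>C c)" by (simp add: im[symmetric] sum.reindex[OF inj])
    finally show ?thesis using orthonormal_expansion[OF C(1) fC] that C(2) by simp
  qed
  moreover have "U x \<in> E" for x
    unfolding U_def C(2)[symmetric]
    by (intro complex_vector.span_sum complex_vector.span_scale complex_vector.span_base)
      (use im in blast)
  moreover have "U' x \<in> E" for x
    unfolding U'_def B(3)[symmetric]
    by (intro complex_vector.span_sum complex_vector.span_scale complex_vector.span_base)
  moreover have "cinner (U x) y = cinner x (U' y)" for x y
    by (simp add: U_def U'_def cinner_sum_left cinner_sum_right cinner_scaleC_left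
        cinner_scaleC_right cinner_commute[symmetric] mult.commute)
  moreover have "bounded_op U" "bounded_op U'"
    unfolding U_def U'_def by (intro bounded_op_setsum bounded_op_rank_one)+
  ultimately show ?thesis unfolding unitary_pair_def by blast
qed

text \<open>Equal norms make \<open>A h\<close> to \<open>B h\<close> an isometry of the ranges. An
  orthonormal basis \<open>Ba\<close> of the range of A and its image are both extended to bases of
  E; these have the same size, so the added vectors can be matched by a bijection.\<close>

theorem isometry_extension:
  fixes A B :: "'h::complex_hilbert \<Rightarrow> 'a::complex_hilbert"
  assumes E: "fin_dim E" and A: "bounded_op A" "\<And>h. A h \<in> E" and B: "bounded_op B" "\<And>h. B h \<in> E"
    and norm: "\<And>h. norm (A h) = norm (B h)"
  obtains U U' where "unitary_pair E U U'" "\<And>h. U (A h) = B h"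
proof -
  obtain F where F: "finite F" "E = complex_vector.span F" using E by (auto simp: fin_dim_def)
  have subE: "complex_vector.subspace E" unfolding F by (rule complex_vector.subspace_span)
  have pol: "cinner (A g) (A h) = cinner (B g) (B h)" for g h
    by (rule polarization[OF A(1) B(1) norm])
  have "complex_vector.subspace (range A)"
    unfolding complex_vector.subspace_def
    using bounded_op_zero[OF A(1)] bounded_op_add[OF A(1)] bounded_op_scaleC[OF A(1)]
    by (auto simp: image_iff) metis+
  then obtain Ba where Ba: "finite Ba" "orthonormal Ba" "complex_vector.span Ba = range A"
    using fin_dim_subspace[OF E] A(2) by blast
  have BaA: "Ba \<subseteq> range A" using Ba(3) complex_vector.span_superset by blast
  then have "\<forall>a\<in>Ba. \<exists>h. A h = a" by blast
  then obtain h where h: "\<And>a. a \<in> Ba \<Longrightarrow> A (h a) = a" by metis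
  define \<beta> where "\<beta> a = B (h a)" for a
  have \<beta>: "cinner (\<beta> a) (\<beta> b) = cinner a b" if "a \<in> Ba" "b \<in> Ba" for a b
    using pol[of "h a" "h b"] that h by (simp add: \<beta>_def)
  have inj: "inj_on \<beta> Ba"
  proof (rule inj_onI)
    fix a b assume ab: "a \<in> Ba" "b \<in> Ba" "\<beta> a = \<beta> b"
    then have "cinner a b = cinner a a" using \<beta>[of a b] \<beta>[of a a] by simp
    then show "a = b" using Ba(2) ab unfolding orthonormal_def by (metis zero_neq_one)
  qed
  have on: "orthonormal (\<beta> ` Ba)"
    using Ba(2) inj unfolding orthonormal_def by (auto simp: \<beta> inj_on_eq_iff)
  obtain B1 where B1: "finite B1" "orthonormal B1" "Ba \<subseteq> B1" "complex_vector.span B1 = E"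
    by (rule orthonormal_basis_extension[OF F(1) _ subE Ba(2)]) (use F(2) BaA A(2) in auto)
  obtain B2 where B2: "finite B2" "orthonormal B2" "\<beta> ` Ba \<subseteq> B2" "complex_vector.span B2 = E"
    by (rule orthonormal_basis_extension[OF F(1) _ subE on]) (use F(2) B(2) in \<open>auto simp: \<beta>_def\<close>)
  have "card B1 = card B2" by (rule orthonormal_basis_card_unique) (use B1 B2 in auto)
  then have "card (B1 - Ba) = card (B2 - \<beta> ` Ba)"
    using B1(3) B2(3) Ba(1) inj by (simp add: card_Diff_subset card_image)
  then obtain \<gamma> where \<gamma>: "bij_betw \<gamma> (B1 - Ba) (B2 - \<beta> ` Ba)"
    using finite_same_card_bij[of "B1 - Ba" "B2 - \<beta> ` Ba"] B1(1) B2(1) by auto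
  define \<delta> where "\<delta> b = (if b \<in> Ba then \<beta> b else \<gamma> b)" for b
  have "bij_betw \<delta> (Ba \<union> (B1 - Ba)) (\<beta> ` Ba \<union> (B2 - \<beta> ` Ba))"
  proof (rule bij_betw_combine)
    show "bij_betw \<delta> Ba (\<beta> ` Ba)"
      using inj by (simp add: bij_betw_def \<delta>_def inj_on_def)
    show "bij_betw \<delta> (B1 - Ba) (B2 - \<beta> ` Ba)"
      using \<gamma> by (rule bij_betw_cong[THEN iffD2, rotated]) (simp add: \<delta>_def)
  qed auto
  then have \<delta>: "bij_betw \<delta> B1 B2" using B1(3) B2(3) by (simp add: Un_absorb1)
  define U where "U x = (\<Sum>b\<in>B1. cinner x b *\<^sub>C \<delta> b)" for x
  have "U (A g) = B g" for g
  proof -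
    let ?c = "\<lambda>a. cinner (A g) a"
    have exp: "A g = (\<Sum>a\<in>Ba. ?c a *\<^sub>C a)"
      by (rule orthonormal_expansion[OF Ba(2,1)]) (simp add: Ba(3))
    \<comment> \<open>This vector lies in the kernel of A, hence in that of B by equality of norms.
      So the image of \<open>A g\<close> does not depend on the preimages \<open>h a\<close> chosen
      for the basis vectors.\<close>
    define g' where "g' = g - (\<Sum>a\<in>Ba. ?c a *\<^sub>C h a)"
    have "A g' = A g - (\<Sum>a\<in>Ba. ?c a *\<^sub>C a)"
      by (simp add: g'_def bounded_op_diff[OF A(1)] bounded_op_sum[OF A(1)] bounded_op_scaleC[OF A(1)] h)
    then have "norm (B g') = 0" using exp norm[of g'] by simp
    then have "B g = (\<Sum>a\<in>Ba. ?c a *\<^sub>C \<beta> a)"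
      by (simp add: g'_def bounded_op_diff[OF B(1)] bounded_op_sum[OF B(1)] bounded_op_scaleC[OF B(1)] \<beta>_def)
    also have "\<dots> = (\<Sum>a\<in>B1. ?c a *\<^sub>C \<delta> a)"
    proof (rule sum.mono_neutral_cong_left[OF B1(1,3)])
      show "\<forall>b\<in>B1 - Ba. ?c b *\<^sub>C \<delta> b = 0"
      proof
        fix b assume b: "b \<in> B1 - Ba"
        have "?c b = (\<Sum>a\<in>Ba. ?c a * cinner a b)"
          by (subst exp) (simp add: cinner_sum_left cinner_scaleC_left)
        also have "\<dots> = 0"
        proof (rule sum.neutral, rule ballI)
          fix a assume "a \<in> Ba"
          then have "cinner a b = 0" using b B1(2,3) unfolding orthonormal_def by (metis DiffD1 DiffD2 subsetD)
          then show "?c a * cinner a b = 0" by simp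
        qed
        finally show "?c b *\<^sub>C \<delta> b = 0" by simp
      qed
    qed (simp add: \<delta>_def)
    finally show ?thesis by (simp add: U_def)
  qed
  moreover have "unitary_pair E U (\<lambda>x. \<Sum>b\<in>B1. cinner x (\<delta> b) *\<^sub>C b)"
    unfolding U_def by (rule unitary_pair_bases[OF B1(1,2,4) B2(2,4) \<delta>])
  ultimately show thesis using that by blast
qed

text \<open>Bolzano-Weierstrass, one coordinate of an orthonormal basis at a time: each induction
  step passes to a further subsequence, which keeps the coordinates treated before
  convergent.\<close>

lemma fin_dim_bounded_subseq:
  fixes v :: "nat \<Rightarrow> 'a::complex_hilbert"
  assumes E: "fin_dim E" and v: "\<And>m. v m \<in> E" "\<And>m. norm (v m) \<le> K"
  obtains r w where "strict_mono r" "(\<lambda>m. v (r m)) \<longlonglongrightarrow> w"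
proof -
  obtain F where F: "E = complex_vector.span F" using E by (auto simp: fin_dim_def)
  obtain B where B: "finite B" "orthonormal B" "complex_vector.span B = E"
    using fin_dim_subspace[OF E] F complex_vector.subspace_span by blast
  have "\<exists>r :: nat \<Rightarrow> nat. strict_mono r \<and> (\<forall>b\<in>D. convergent (\<lambda>m. cinner (v (r m)) b))"
    if "finite D" for D :: "'a set"
    using that
  proof induction
    case empty
    show ?case by (rule exI[of _ id]) (simp add: strict_mono_def)
  next
    case (insert d D)
    then obtain r :: "nat \<Rightarrow> nat" where r: "strict_mono r" "\<forall>b\<in>D. convergent (\<lambda>m. cinner (v (r m)) b)"
      by blast
    have "bounded (range (\<lambda>m. cinner (v (r m)) d))"
    proof (rule boundedI[of _ "K * norm d"], safe)
      fix m show "norm (cinner (v (r m)) d) \<le> K * norm d"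
        by (rule order_trans[OF norm_cinner_le]) (intro mult_right_mono v norm_ge_zero)
    qed
    then obtain l s where s: "strict_mono s" "((\<lambda>m. cinner (v (r m)) d) \<circ> s) \<longlonglongrightarrow> l"
      using bounded_imp_convergent_subsequence by blast
    have "\<forall>b\<in>insert d D. convergent (\<lambda>m. cinner (v ((r \<circ> s) m)) b)"
      using s r(2) convergent_subseq_convergent[OF _ s(1)]
      by (fastforce simp: convergent_def o_def)
    then show ?case using strict_mono_o[OF r(1) s(1)] by blast
  qed
  from this[OF B(1)] obtain r :: "nat \<Rightarrow> nat" where r: "strict_mono r"
    "\<forall>b\<in>B. convergent (\<lambda>m. cinner (v (r m)) b)" by blast
  then obtain l where l: "\<And>b. b \<in> B \<Longrightarrow> (\<lambda>m. cinner (v (r m)) b) \<longlonglongrightarrow> l b"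
    unfolding convergent_def by metis
  have bl: "bounded_linear (\<lambda>c. c *\<^sub>C b)" for b :: 'a
    by (rule bounded_linear_intro[where K = "norm b"])
      (auto simp: scaleC_add_left norm_scaleC scaleC_of_real[symmetric] scaleC_scaleC
        scaleR_conv_of_real)
  have "(\<lambda>m. \<Sum>b\<in>B. cinner (v (r m)) b *\<^sub>C b) \<longlonglongrightarrow> (\<Sum>b\<in>B. l b *\<^sub>C b)"
    by (intro tendsto_sum bounded_linear.tendsto[OF bl] l)
  moreover have "(\<Sum>b\<in>B. cinner (v m) b *\<^sub>C b) = v m" for m
    using orthonormal_expansion[OF B(2,1)] v(1) B(3) by simp
  ultimately show thesis using that r(1) by simp
qed

section \<open>Removing the unitary part of a contraction\<close>

text \<open>For unitary \<open>V\<close> and a projection \<open>Q\<close> this is the unitary part of \<open>V Q\<close>.\<close>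

definition fixed_part :: "'a::complex_hilbert set \<Rightarrow> ('a \<Rightarrow> 'a) \<Rightarrow> ('a \<Rightarrow> 'a) \<Rightarrow> 'a set"
  where "fixed_part E V Q = {v \<in> E. \<forall>m. Q ((V ^^ m) v) = (V ^^ m) v}"

definition orth_compl :: "'a::complex_hilbert set \<Rightarrow> 'a set"
  where "orth_compl S = {x. \<forall>s\<in>S. cinner x s = 0}"

lemma subspace_orth_compl: "complex_vector.subspace (orth_compl S)"
  by (auto simp: orth_compl_def complex_vector.subspace_def cinner_add_left cinner_scaleC_left)

definition projection_op :: "('a::complex_hilbert \<Rightarrow> 'a) \<Rightarrow> bool"
  where "projection_op Q \<longleftrightarrow> bounded_op Q \<and> (\<forall>x. Q (Q x) = Q x) \<and> (\<forall>x y. cinner (Q x) y = cinner x (Q y))"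

lemma projection_op_pythagoras:
  assumes "projection_op Q"
  shows "(norm x)\<^sup>2 = (norm (Q x))\<^sup>2 + (norm (x - Q x))\<^sup>2"
proof -
  have "cinner (Q x) (x - Q x) = 0"
    using assms by (simp add: projection_op_def cinner_diff_right)
  then show ?thesis using norm_add_squared[of "Q x" "x - Q x"] by simp
qed

lemma projection_op_le:
  assumes "projection_op Q"
  shows "norm (Q x) \<le> norm x"
proof (rule power2_le_imp_le)
  show "(norm (Q x))\<^sup>2 \<le> (norm x)\<^sup>2"
    using projection_op_pythagoras[OF assms, of x] zero_le_power2[of "norm (x - Q x)"] by linarith
qed simp

lemma projection_op_norm_eq:
  assumes "projection_op Q" and eq: "norm (Q x) = norm x"
  shows "Q x = x"
proof -
  have "(norm (x - Q x))\<^sup>2 = 0"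
    using projection_op_pythagoras[OF assms(1), of x] unfolding eq by linarith
  then show ?thesis by simp
qed

context
  fixes E :: "'a::complex_hilbert set" and V V' Q :: "'a \<Rightarrow> 'a"
  assumes E: "fin_dim E" and V: "unitary_pair E V V'" and Q: "projection_op Q"
    and QE: "\<And>x. x \<in> E \<Longrightarrow> Q x \<in> E"
begin

lemma fin_dim_subspace_E: "complex_vector.subspace E"
  using E complex_vector.subspace_span by (auto simp: fin_dim_def)

lemma bounded_V: "bounded_op V" and bounded_Q: "bounded_op Q"
  using V Q by (auto simp: unitary_pair_def projection_op_def)

lemma unitary_cinner: "y \<in> E \<Longrightarrow> cinner (V x) (V y) = cinner x y"
  using V by (simp add: unitary_pair_def)

lemma unitary_norm: "x \<in> E \<Longrightarrow> norm (V x) = norm x"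
  using unitary_cinner[of x x] by (simp add: cinner_self flip: of_real_power)

lemma fixed_part_subspace: "complex_vector.subspace (fixed_part E V Q)"
  using fin_dim_subspace_E bounded_op_funpow[OF bounded_V]
  unfolding fixed_part_def complex_vector.subspace_def
  by (auto simp: bounded_op_add bounded_op_scaleC bounded_op_zero bounded_Q)

lemma fixed_part_sub: "fixed_part E V Q \<subseteq> E"
  by (auto simp: fixed_part_def)

lemma fixed_part_Q: "v \<in> fixed_part E V Q \<Longrightarrow> Q v = v"
  unfolding fixed_part_def by (metis (mono_tags, lifting) funpow_0 mem_Collect_eq)

lemma fixed_part_V:
  assumes v: "v \<in> fixed_part E V Q"
  shows "V v \<in> fixed_part E V Q"
proof -
  have "Q ((V ^^ m) (V v)) = (V ^^ m) (V v)" for m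
  proof -
    have "Q ((V ^^ Suc m) v) = (V ^^ Suc m) v"
      using v unfolding fixed_part_def by blast
    then show ?thesis by (simp only: funpow_Suc_right o_apply)
  qed
  moreover have "V v \<in> E" using v V by (simp add: fixed_part_def unitary_pair_def)
  ultimately show ?thesis by (simp add: fixed_part_def)
qed

text \<open>The definition involves forward powers of V only. Backward invariance holds because V
  maps the finite-dimensional fixed part isometrically into itself, hence onto itself.\<close>

lemma fixed_part_V': 
  assumes v: "v \<in> fixed_part E V Q"
  shows "V' v \<in> fixed_part E V Q"
proof -
  obtain u where u: "u \<in> fixed_part E V Q" "V u = v"
  proof (rule fin_dim_isometry_surj[OF _ bounded_V fixed_part_V _ v])
    show "fin_dim (fixed_part E V Q)"
      by (rule fin_dim_hilbert_subspace[OF E fixed_part_subspace fixed_part_sub])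
  qed (use fixed_part_sub unitary_cinner in auto)
  then have "V' v = u" using V fixed_part_sub unfolding unitary_pair_def by blast
  with u show ?thesis by simp
qed

text \<open>By adjointness, invariance of the complement under \<open>V\<close>, \<open>V'\<close>
  and \<open>Q\<close> amounts to invariance of the fixed part under \<open>V'\<close>,
  \<open>V\<close> and \<open>Q\<close>.\<close>

lemma fixed_part_compl:
  assumes x: "x \<in> E \<inter> orth_compl (fixed_part E V Q)"
  shows "V x \<in> E \<inter> orth_compl (fixed_part E V Q)" "V' x \<in> E \<inter> orth_compl (fixed_part E V Q)"
    "Q x \<in> E \<inter> orth_compl (fixed_part E V Q)"
proof -
  have x0: "cinner x s = 0" if "s \<in> fixed_part E V Q" for s
    using x that by (auto simp: orth_compl_def)
  have adj: "cinner (V y) z = cinner y (V' z)" "cinner (V' y) z = cinner y (V z)" for y z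
    using V unitary_pair_sym[OF V] unfolding unitary_pair_def by auto
  show "V x \<in> E \<inter> orth_compl (fixed_part E V Q)" "V' x \<in> E \<inter> orth_compl (fixed_part E V Q)"
    using x V fixed_part_V fixed_part_V' x0
    by (auto simp: unitary_pair_def orth_compl_def adj)
  show "Q x \<in> E \<inter> orth_compl (fixed_part E V Q)"
    using x QE Q fixed_part_Q x0 by (auto simp: orth_compl_def projection_op_def)
qed

text \<open>The norms along an orbit of the contraction V Q decrease to some L. By compactness the
  orbit has a cluster point w, and the orbit of w has constant norm L. Then Q loses no norm along
  it, so Q fixes it and w lies in the fixed part; being also orthogonal to it, w is 0 and L =
  0.\<close>

theorem fixed_part_compl_pure:
  assumes x: "x \<in> E \<inter> orth_compl (fixed_part E V Q)"
  shows "(\<lambda>m. ((\<lambda>y. V (Q y)) ^^ m) x) \<longlonglongrightarrow> 0"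
proof -
  let ?C = "\<lambda>y. V (Q y)" and ?D = "E \<inter> orth_compl (fixed_part E V Q)"
  define v where "v m = (?C ^^ m) x" for m
  have vS: "v (Suc m) = ?C (v m)" for m by (simp add: v_def)
  have CD: "?C y \<in> ?D" if "y \<in> ?D" for y
    by (rule fixed_part_compl(1)[OF fixed_part_compl(3)[OF that]])
  have vD: "v m \<in> ?D" for m
  proof (induction m)
    case 0
    show ?case using x by (simp add: v_def)
  next
    case (Suc m)
    then show ?case unfolding vS by (rule CD)
  qed
  have C_le: "norm (?C y) \<le> norm y" if "y \<in> E" for y
    using unitary_norm[OF QE[OF that]] projection_op_le[OF Q] by simp
  have dec: "norm (v (Suc m)) \<le> norm (v m)" for m
    using C_le[of "v m"] vD[of m] by (auto simp: vS)
  have "norm (v m) \<le> norm x" for m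
    using lift_Suc_antimono_le[of "\<lambda>m. norm (v m)" 0 m] dec by (simp add: v_def)
  then obtain r w where r: "strict_mono r" "(\<lambda>m. v (r m)) \<longlonglongrightarrow> w"
    using fin_dim_bounded_subseq[OF E, of v "norm x"] vD by blast
  have "convergent (\<lambda>m. norm (v m))"
  proof (rule Bseq_monoseq_convergent)
    show "Bseq (\<lambda>m. norm (v m))"
      by (rule BseqI'[of _ "norm x"]) (use \<open>\<And>m. norm (v m) \<le> norm x\<close> in auto)
    show "monoseq (\<lambda>m. norm (v m))"
      using dec by (intro decseq_imp_monoseq decseq_SucI)
  qed
  then obtain L where L: "(\<lambda>m. norm (v m)) \<longlonglongrightarrow> L" unfolding convergent_def by blast
  have sub: "complex_vector.subspace ?D"
    by (intro complex_vector.subspace_inter fin_dim_subspace_E subspace_orth_compl)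
  have "closed ?D"
    using fin_dim_hilbert_subspace(1)[OF E sub] by (auto simp: hilbert_subspace_def)
  then have w: "w \<in> ?D" using closed_sequentially[of ?D "\<lambda>m. v (r m)" w] vD r(2) by blast
  define u where "u m = (?C ^^ m) w" for m
  have bC: "bounded_op ?C" by (rule bounded_op_comp[OF bounded_V bounded_Q])
  \<comment> \<open>Both limits are taken along the subsequence r: by continuity the left side tends
    to the norm of \<open>u j\<close>, while shifting the decreasing norms by j does not change
    their limit.\<close>
  have uL: "norm (u j) = L" for j
  proof (rule LIMSEQ_unique)
    show "(\<lambda>m. norm ((?C ^^ j) (v (r m)))) \<longlonglongrightarrow> norm (u j)"
      unfolding u_def by (intro tendsto_norm bounded_op_tendsto[OF bounded_op_funpow[OF bC]] r)
    have "(?C ^^ j) (v m) = v (m + j)" for m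
      by (simp add: v_def funpow_add add.commute[of m j])
    moreover have "(\<lambda>m. norm (v (r m + j))) \<longlonglongrightarrow> L"
      using LIMSEQ_subseq_LIMSEQ[OF LIMSEQ_ignore_initial_segment[OF L] r(1)] by (simp add: o_def)
    ultimately show "(\<lambda>m. norm ((?C ^^ j) (v (r m)))) \<longlonglongrightarrow> L" by simp
  qed
  have uS: "u (Suc j) = ?C (u j)" for j by (simp add: u_def)
  have uD: "u m \<in> ?D" for m
  proof (induction m)
    case 0
    show ?case using w by (simp add: u_def)
  next
    case (Suc m)
    then show ?case unfolding uS by (rule CD)
  qed
  have Qu: "Q (u j) = u j" for j
  proof (rule projection_op_norm_eq[OF Q])
    show "norm (Q (u j)) = norm (u j)"
      using unitary_norm[OF QE, of "u j"] uD[of j] uS[of j] uL[of j] uL[of "Suc j"] by auto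
  qed
  have "u m = (V ^^ m) w" for m
  proof (induction m)
    case 0
    show ?case by (simp add: u_def)
  next
    case (Suc m)
    have "u (Suc m) = V (u m)" by (simp add: uS Qu)
    then show ?case by (simp add: Suc)
  qed
  then have "w \<in> fixed_part E V Q" using w Qu by (auto simp: fixed_part_def)
  then have "cinner w w = 0" using w by (auto simp: orth_compl_def)
  then have "L = 0" using uL[of 0] by (simp add: u_def)
  with L show ?thesis by (simp add: v_def tendsto_norm_zero_iff)
qed

end

section \<open>Uniqueness of Taylor coefficients\<close>

text \<open>Once the coefficients below n are known to vanish, the series can be divided by t^n, and
  t tending to 0 isolates a n.\<close>

lemma power_series_zero_imp_coeff_zero:
  fixes a :: "nat \<Rightarrow> complex"
  assumes zero: "\<And>t. cmod t < 1 \<Longrightarrow> (\<lambda>m. a m * t ^ m) sums 0"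
  shows "a n = 0"
proof (induction n rule: less_induct)
  case (less n)
  have "(\<lambda>m. a (m + n) * t ^ m) sums 0" if t: "t \<noteq> 0" "norm t < 1" for t
  proof -
    have "(\<lambda>m. a (m + n) * t ^ (m + n)) sums 0"
      using sums_split_initial_segment[OF zero[OF t(2)], of n] less by simp
    from sums_mult[OF this, of "inverse (t ^ n)"] show ?thesis
      using t(1) by (simp add: power_add field_simps)
  qed
  from powser_limit_0_strong[OF zero_less_one this]
  have "((\<lambda>t :: complex. 0 :: complex) \<longlongrightarrow> a (0 + n)) (at 0)" .
  from LIM_const_eq[OF this] show ?case by simp
qed

lemma multi_indices_insert:
  assumes "i \<notin> J"
  shows "bij_betw (\<lambda>(m, k). k(i := m)) (UNIV \<times> multi_indices J) (multi_indices (insert i J))"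
  unfolding bij_betw_def
proof
  show "inj_on (\<lambda>(m, k). k(i := m)) (UNIV \<times> multi_indices J)"
    using inj_combinator[OF assms, of "\<lambda>_. UNIV"] by (simp add: multi_indices_def)
  show "(\<lambda>(m, k). k(i := m)) ` (UNIV \<times> multi_indices J) = multi_indices (insert i J)"
    unfolding multi_indices_def PiE_insert_eq by simp
qed

lemma monomial_insert:
  assumes "finite J" "i \<notin> J"
  shows "monomial (insert i J) (k(i := m)) (z(i := t)) = t ^ m * monomial J k z"
proof -
  have "(\<Prod>j\<in>J. (z(i := t)) j ^ (k(i := m)) j) = (\<Prod>j\<in>J. z j ^ k j)"
    by (rule prod.cong) (use assms(2) in auto)
  then show ?thesis using assms by (simp add: monomial_def)
qed

text \<open>Induction on the number of variables. With the other variables fixed, the sum is a power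
  series in the new variable t, and its coefficients are series in the remaining variables.
  Boundedness of c makes the full series absolutely convergent in the open polydisc, so it may be
  summed iteratively.\<close>

lemma scalar_taylor_unique:
  fixes c :: "(nat \<Rightarrow> nat) \<Rightarrow> complex"
  assumes "finite J" "\<And>k. k \<in> multi_indices J \<Longrightarrow> cmod (c k) \<le> C"
    "\<And>z. z \<in> polydisc J \<Longrightarrow> (\<Sum>\<^sub>\<infinity>k\<in>multi_indices J. monomial J k z * c k) = 0"
    "k \<in> multi_indices J"
  shows "c k = 0"
  using assms
proof (induction J arbitrary: c k rule: finite_induct)
  case empty
  have "(\<lambda>_. undefined) \<in> polydisc {}" by (simp add: polydisc_def)
  from empty.prems(2)[OF this] empty.prems(3) show ?case
    by (simp add: multi_indices_def monomial_def)
next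
  case (insert i J)
  let ?M = "multi_indices J"
  have mem: "k'(i := m) \<in> multi_indices (insert i J)" if "k' \<in> ?M" for k' m
    using bij_betwE[OF multi_indices_insert[OF insert.hyps(2)]] that by auto
  have bij: "bij_betw (\<lambda>(m, k). k(i := m)) (UNIV \<times> ?M) (multi_indices (insert i J))"
    by (rule multi_indices_insert[OF insert.hyps(2)])
  have zero: "c (k'(i := m)) = 0" if k': "k' \<in> ?M" for k' m
  proof (rule insert.IH[where c = "\<lambda>k. c (k(i := m))"])
    show "cmod (c (k(i := m))) \<le> C" if "k \<in> ?M" for k
      using insert.prems(1) mem[OF that] by blast
    show "k' \<in> ?M" by (rule k')
    fix z assume z: "z \<in> polydisc J"
    define a where "a m = (\<Sum>\<^sub>\<infinity>k\<in>?M. monomial J k z * c (k(i := m)))" for m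
    have "(\<lambda>m. a m * t ^ m) sums 0" if t: "cmod t < 1" for t
    proof -
      define F where "F = (\<lambda>(m, k). t ^ m * (monomial J k z * c (k(i := m))))"
      let ?z = "z(i := t)"
      have z': "?z \<in> polydisc (insert i J)"
        using z t by (auto simp: polydisc_def PiE_iff extensional_def)
      have F: "F x = monomial (insert i J) ((\<lambda>(m, k). k(i := m)) x) ?z * c ((\<lambda>(m, k). k(i := m)) x)" for x
        by (simp add: F_def monomial_insert insert.hyps split: prod.split)
      have fin: "finite (insert i J)" using insert.hyps by simp
      have "(\<lambda>k. norm (monomial (insert i J) k ?z) * C) summable_on multi_indices (insert i J)"
        by (intro summable_on_cmult_left monomial_abs_summable[OF fin])
          (use z' in \<open>auto simp: polydisc_def PiE_iff\<close>)
      then have abs: "(\<lambda>k. norm (monomial (insert i J) k ?z * c k)) summable_on multi_indices (insert i J)"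
        by (rule Infinite_Sum.abs_summable_on_comparison_test')
          (use insert.prems(1) in \<open>simp add: norm_mult mult_left_mono\<close>)
      have "F summable_on (UNIV \<times> ?M)"
        unfolding F using summable_on_reindex_bij_betw[OF bij, of "\<lambda>k. monomial (insert i J) k ?z * c k"]
          abs_summable_summable[OF abs] by simp
      note sF = this
      have infF: "infsum F (UNIV \<times> ?M) = 0"
        unfolding F using infsum_reindex_bij_betw[OF bij, of "\<lambda>k. monomial (insert i J) k ?z * c k"]
          insert.prems(2)[OF z'] by simp
      have hs: "(F has_sum 0) (UNIV \<times> ?M)"
        using has_sum_infsum[OF sF] infF by simp
      have inner: "((\<lambda>k. F (m, k)) has_sum (t ^ m * a m)) ?M" for m
      proof -
        have "(\<lambda>k. norm (monomial J k z) * C) summable_on ?M"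
          by (intro summable_on_cmult_left monomial_abs_summable insert.hyps(1))
            (use z in \<open>auto simp: polydisc_def PiE_iff\<close>)
        then have "(\<lambda>k. norm (monomial J k z * c (k(i := m)))) summable_on ?M"
        proof (rule Infinite_Sum.abs_summable_on_comparison_test')
          fix k assume "k \<in> ?M"
          then show "norm (monomial J k z * c (k(i := m))) \<le> norm (monomial J k z) * C"
            unfolding norm_mult by (intro mult_left_mono insert.prems(1) mem norm_ge_zero)
        qed
        then have "((\<lambda>k. monomial J k z * c (k(i := m))) has_sum a m) ?M"
          unfolding a_def by (rule has_sum_infsum[OF abs_summable_summable])
        then show ?thesis unfolding F_def prod.case by (rule has_sum_cmult_right)
      qed
      have "((\<lambda>m. t ^ m * a m) has_sum 0) UNIV"
        by (rule has_sum_SigmaD[OF hs]) (use inner in auto)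
      then show ?thesis using has_sum_imp_sums by (simp add: mult.commute)
    qed
    then have "a m = 0" by (rule power_series_zero_imp_coeff_zero)
    then show "(\<Sum>\<^sub>\<infinity>k\<in>?M. monomial J k z * c (k(i := m))) = 0" by (simp add: a_def)
  qed
  have "k \<in> (\<lambda>(m, k). k(i := m)) ` (UNIV \<times> ?M)"
    using bij insert.prems(3) by (simp add: bij_betw_def)
  then show ?case using zero by auto
qed

lemma bounded_op_infsum:
  assumes A: "bounded_op A" and f: "f summable_on S"
  shows "(\<Sum>\<^sub>\<infinity>k\<in>S. A (f k)) = A (infsum f S)"
  by (rule infsum_bounded_linear_strong[OF _ bounded_op_bounded_linear[OF A]])
    (use f summable_on_bounded_linear[OF bounded_op_bounded_linear[OF A]] in blast)

lemma subspace_hardy: "hilbert_subspace E \<Longrightarrow> complex_vector.subspace (hardy J E)"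
  unfolding hilbert_subspace_def complex_vector.subspace_def hardy_def
  by (auto simp: zero_ell2.rep_eq plus_ell2.rep_eq scaleC_ell2.rep_eq)

lemma bounded_op_nth: "bounded_op (\<lambda>f. ell2_nth f k)"
  by (rule bounded_opI[where C = 1])
    (simp_all add: plus_ell2.rep_eq scaleC_ell2.rep_eq norm_ell2_nth_le)

lemma hilbert_subspace_hardy:
  assumes "hilbert_subspace E"
  shows "hilbert_subspace (hardy J E)"
  unfolding hilbert_subspace_def
proof
  have "hardy J E = (\<Inter>k. (\<lambda>f. ell2_nth f k) -` (if k \<in> multi_indices J then E else {0}))"
    by (auto simp: hardy_def split: if_splits)
  moreover have "closed ((\<lambda>f. ell2_nth f k) -` (if k \<in> multi_indices J then E else {0}))" for k
    using assms linear_continuous_at[OF bounded_op_bounded_linear[OF bounded_op_nth]]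
    by (intro continuous_closed_vimage) (auto simp: hilbert_subspace_def)
  ultimately show "closed (hardy J E)" by auto
qed (rule subspace_hardy[OF assms])

lemma hardy_eval_add:
  assumes "finite J" "z \<in> polydisc J"
  shows "hardy_eval J (f + g) z = hardy_eval J f z + hardy_eval J g z"
  unfolding hardy_eval_def
  by (subst infsum_add[symmetric])
    (simp_all add: hardy_eval_summable[OF assms] plus_ell2.rep_eq scaleC_add_right)

lemma hardy_eval_diff:
  assumes "finite J" "z \<in> polydisc J"
  shows "hardy_eval J (f - g) z = hardy_eval J f z - hardy_eval J g z"
  using hardy_eval_add[OF assms, of "f - g" g] by simp

text \<open>To see that a coefficient of f - g vanishes, all coefficients are paired with that one,
  which reduces to scalar series. This settles uniqueness in \<open>mult_op\<close> and lets
  identities between operators be checked pointwise on the polydisc.\<close>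

lemma hardy_eval_inject:
  fixes f g :: "(nat \<Rightarrow> nat, 'e::complex_hilbert) ell2"
  assumes J: "finite J" and E: "hilbert_subspace E" and fg: "f \<in> hardy J E" "g \<in> hardy J E"
    and eq: "\<And>z. z \<in> polydisc J \<Longrightarrow> hardy_eval J f z = hardy_eval J g z"
  shows "f = g"
proof -
  let ?d = "f - g"
  have "ell2_nth ?d k = 0" for k
  proof (cases "k \<in> multi_indices J")
    case True
    let ?x = "ell2_nth ?d k"
    have "cinner (ell2_nth ?d k) ?x = 0"
    proof (rule scalar_taylor_unique[OF J _ _ True, where c = "\<lambda>k. cinner (ell2_nth ?d k) ?x"])
      show "cmod (cinner (ell2_nth ?d k) ?x) \<le> norm ?d * norm ?x" for k
        by (rule order_trans[OF norm_cinner_le]) (intro mult_right_mono norm_ell2_nth_le norm_ge_zero)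
      fix z assume z: "z \<in> polydisc J"
      have "(\<Sum>\<^sub>\<infinity>k\<in>multi_indices J. cinner (monomial J k z *\<^sub>C ell2_nth ?d k) ?x)
          = cinner (hardy_eval J ?d z) ?x"
        unfolding hardy_eval_def
        by (rule infsum_bounded_linear_strong[OF _ bounded_linear_cinner_left])
          (use hardy_eval_summable[OF J z] summable_on_bounded_linear[OF bounded_linear_cinner_left] in blast)
      then show "(\<Sum>\<^sub>\<infinity>k\<in>multi_indices J. monomial J k z * cinner (ell2_nth ?d k) ?x) = 0"
        using eq[OF z] by (simp add: hardy_eval_diff[OF J z] cinner_scaleC_left)
    qed
    then show ?thesis by simp
  next
    case False
    then show ?thesis using fg by (simp add: hardy_def minus_ell2.rep_eq)
  qed
  then have "ell2_nth f k = ell2_nth g k" for k by (simp add: minus_ell2.rep_eq)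
  then show ?thesis by (simp add: ell2_nth_inject[symmetric] fun_eq_iff)
qed

lemma mult_op_eqI:
  assumes "finite J" "hilbert_subspace E" "g \<in> hardy J E"
    "\<And>z. z \<in> polydisc J \<Longrightarrow> hardy_eval J g z = \<Phi> z (hardy_eval J f z)"
  shows "mult_op J E \<Phi> f = g"
  unfolding mult_op_def
proof (rule the_equality)
  show "g \<in> hardy J E \<and> (\<forall>z\<in>polydisc J. hardy_eval J g z = \<Phi> z (hardy_eval J f z))"
    using assms by blast
  fix h assume "h \<in> hardy J E \<and> (\<forall>z\<in>polydisc J. hardy_eval J h z = \<Phi> z (hardy_eval J f z))"
  then show "h = g" using assms by (intro hardy_eval_inject[OF assms(1,2)]) auto
qed

lemma hilbert_subspace_infsum:
  fixes f :: "'i \<Rightarrow> 'a::complex_hilbert"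
  assumes E: "hilbert_subspace E" and f: "\<And>k. k \<in> S \<Longrightarrow> f k \<in> E"
  shows "infsum f S \<in> E"
proof (cases "f summable_on S")
  case True
  have sub: "complex_vector.subspace E" and cl: "closed E"
    using E by (auto simp: hilbert_subspace_def)
  have "(sum f \<longlongrightarrow> infsum f S) (finite_subsets_at_top S)"
    using has_sum_infsum[OF True] by (simp add: has_sum_def)
  moreover have "\<forall>\<^sub>F F in finite_subsets_at_top S. sum f F \<in> E"
    by (rule eventually_finite_subsets_at_top_weakI)
      (use f in \<open>auto intro!: complex_vector.subspace_sum[OF sub]\<close>)
  ultimately show ?thesis
    using Lim_in_closed_set[OF cl] finite_subsets_at_top_neq_bot by blast
next
  \<comment> \<open>A divergent \<open>infsum\<close> is 0 by convention, and 0 lies in E. For this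
    reason \<open>hardy_eval_in\<close> holds at every z.\<close>
  case False
  then show ?thesis using E complex_vector.subspace_0
    by (auto simp: infsum_not_exists hilbert_subspace_def)
qed

lemma hardy_eval_in:
  assumes "hilbert_subspace E" "f \<in> hardy J E"
  shows "hardy_eval J f z \<in> E"
  unfolding hardy_eval_def
  by (rule hilbert_subspace_infsum[OF assms(1)])
    (use assms in \<open>auto simp: hardy_def hilbert_subspace_def intro: complex_vector.subspace_scale\<close>)

section \<open>Shifts and constant operators on the Hardy space\<close>

abbreviation raise :: "nat \<Rightarrow> (nat \<Rightarrow> nat) \<Rightarrow> nat \<Rightarrow> nat"
  where "raise i k \<equiv> k(i := Suc (k i))"

text \<open>Truncated subtraction leaves an index with i-th entry 0 unchanged; \<open>lower\<close>
  inverts \<open>raise\<close> only at positive entries, which is why \<open>shift\<close> treats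
  entry 0 separately.\<close>

abbreviation lower :: "nat \<Rightarrow> (nat \<Rightarrow> nat) \<Rightarrow> nat \<Rightarrow> nat"
  where "lower i k \<equiv> k(i := k i - 1)"

lemma inj_raise: "inj (raise i)"
proof (rule injI)
  fix k l :: "nat \<Rightarrow> nat" assume "raise i k = raise i l"
  then have "lower i (raise i k) = lower i (raise i l)" by simp
  then show "k = l" by simp
qed

lemma range_raise: "range (raise i) = {k. k i \<noteq> 0}"
proof safe
  fix k :: "nat \<Rightarrow> nat" assume "0 < k i"
  then show "k \<in> range (raise i)" using rangeI[of "raise i" "lower i k"] by simp
qed simp

lift_definition shift :: "nat \<Rightarrow> (nat \<Rightarrow> nat, 'e::complex_inner) ell2 \<Rightarrow> (nat \<Rightarrow> nat, 'e) ell2"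
  is "\<lambda>i f k. if k i = 0 then 0 else f (lower i k)"
proof -
  fix i and f :: "(nat \<Rightarrow> nat) \<Rightarrow> 'e"
  let ?g = "\<lambda>k. (norm (if k i = 0 then 0 else f (lower i k)))\<^sup>2"
  assume "(\<lambda>k. (norm (f k))\<^sup>2) summable_on UNIV"
  then have "(?g \<circ> raise i) summable_on UNIV" by (simp add: o_def)
  then have "?g summable_on range (raise i)" by (simp only: summable_on_reindex[OF inj_raise])
  then show "?g summable_on UNIV"
    by (rule summable_on_cong_neutral[THEN iffD1, rotated 3]) (auto simp: range_raise)
qed

lift_definition unshift :: "nat \<Rightarrow> (nat \<Rightarrow> nat, 'e::complex_inner) ell2 \<Rightarrow> (nat \<Rightarrow> nat, 'e) ell2"
  is "\<lambda>i f k. f (raise i k)"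
proof -
  fix i and f :: "(nat \<Rightarrow> nat) \<Rightarrow> 'e"
  assume "(\<lambda>k. (norm (f k))\<^sup>2) summable_on UNIV"
  then have "(\<lambda>k. (norm (f k))\<^sup>2) summable_on range (raise i)"
    by (rule summable_on_subset_banach) simp
  then show "(\<lambda>k. (norm (f (raise i k)))\<^sup>2) summable_on UNIV"
    by (simp add: summable_on_reindex[OF inj_raise] o_def)
qed

text \<open>The operator I tensor A, acting on each coefficient. For bounded A the image family is
  square-summable, and only then is \<open>Abs_ell2\<close> applied within its domain.\<close>

definition ampliation :: "('a::complex_hilbert \<Rightarrow> 'b::complex_hilbert) \<Rightarrow> ('i, 'a) ell2 \<Rightarrow> ('i, 'b) ell2"
  where "ampliation A f = Abs_ell2 (\<lambda>k. A (ell2_nth f k))"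

lemma ampliation_nth:
  assumes A: "bounded_op A"
  shows "ell2_nth (ampliation A f) k = A (ell2_nth f k)"
proof -
  obtain C where C: "C > 0" "\<And>x. norm (A x) \<le> C * norm x" using bounded_op_bound[OF A] by blast
  have "(\<lambda>k. C\<^sup>2 * (norm (ell2_nth f k))\<^sup>2) summable_on UNIV"
    using ell2_nth[of f] by (intro summable_on_cmult_right) auto
  then have "(\<lambda>k. norm ((norm (A (ell2_nth f k)))\<^sup>2)) summable_on UNIV"
  proof (rule Infinite_Sum.abs_summable_on_comparison_test')
    fix k
    show "norm ((norm (A (ell2_nth f k)))\<^sup>2) \<le> C\<^sup>2 * (norm (ell2_nth f k))\<^sup>2"
      using power_mono[OF C(2), of _ 2] by (simp add: power_mult_distrib)
  qed
  then show ?thesis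
    unfolding ampliation_def by (subst Abs_ell2_inverse) auto
qed

lemma cinner_ampliation:
  assumes "bounded_op A" "bounded_op B" "\<And>x y. cinner (A x) y = cinner x (B y)"
  shows "cinner (ampliation A f) g = cinner f (ampliation B g)"
  by (simp add: cinner_ell2.rep_eq ampliation_nth assms)

lemma cinner_shift: "cinner (shift i f) g = cinner f (unshift i g)"
proof -
  let ?h = "\<lambda>k. cinner (if k i = 0 then 0 else ell2_nth f (lower i k)) (ell2_nth g k)"
  have "infsum ?h UNIV = infsum ?h (range (raise i))"
    by (rule infsum_cong_neutral) (auto simp: range_raise)
  also have "\<dots> = infsum (?h \<circ> raise i) UNIV" by (rule infsum_reindex[OF inj_raise])
  also have "?h \<circ> raise i = (\<lambda>k. cinner (ell2_nth f k) (ell2_nth g (raise i k)))"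
    by (auto simp: o_def)
  finally show ?thesis by (simp add: cinner_ell2.rep_eq shift.rep_eq unshift.rep_eq)
qed

lemma hardy_eval_ampliation:
  assumes "finite J" "z \<in> polydisc J" "bounded_op A"
  shows "hardy_eval J (ampliation A f) z = A (hardy_eval J f z)"
  unfolding hardy_eval_def ampliation_nth[OF assms(3)] bounded_op_scaleC[OF assms(3), symmetric]
  by (rule bounded_op_infsum[OF assms(3) hardy_eval_summable[OF assms(1,2)]])

lemma monomial_raise:
  assumes "finite J" "i \<in> J"
  shows "monomial J (raise i k) z = z i * monomial J k z"
proof -
  have "(\<Prod>j\<in>J - {i}. z j ^ (raise i k) j) = (\<Prod>j\<in>J - {i}. z j ^ k j)"
    by (rule prod.cong) auto
  then show ?thesis
    using assms by (simp add: monomial_def prod.remove[of J i])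
qed

lemma raise_multi_indices: "i \<in> J \<Longrightarrow> raise i k \<in> multi_indices J \<longleftrightarrow> k \<in> multi_indices J"
  by (auto simp: multi_indices_def PiE_iff extensional_def)

lemma lower_multi_indices: "i \<in> J \<Longrightarrow> lower i k \<in> multi_indices J \<longleftrightarrow> k \<in> multi_indices J"
  by (auto simp: multi_indices_def PiE_iff extensional_def)

lemma hardy_eval_shift:
  assumes J: "finite J" and i: "i \<in> J" and z: "z \<in> polydisc J"
  shows "hardy_eval J (shift i f) z = z i *\<^sub>C hardy_eval J f z"
proof -
  let ?M = "multi_indices J"
  let ?h = "\<lambda>k. monomial J k z *\<^sub>C (if k i = 0 then 0 else ell2_nth f (lower i k))"
  have "raise i ` ?M = {k\<in>?M. k i \<noteq> 0}"
  proof safe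
    fix k assume k: "k \<in> ?M" "0 < k i"
    then have "lower i k \<in> ?M" using lower_multi_indices[OF i] by blast
    then show "k \<in> raise i ` ?M" using imageI[of "lower i k" ?M "raise i"] k(2) by simp
  qed (use raise_multi_indices[OF i] in auto)
  then have "infsum ?h ?M = infsum ?h (raise i ` ?M)"
    by (intro infsum_cong_neutral) auto
  also have "\<dots> = infsum (?h \<circ> raise i) ?M"
    by (rule infsum_reindex) (rule inj_on_subset[OF inj_raise], simp)
  also have "?h \<circ> raise i = (\<lambda>k. z i *\<^sub>C (monomial J k z *\<^sub>C ell2_nth f k))"
    by (auto simp: o_def monomial_raise[OF J i] scaleC_scaleC)
  also have "infsum (\<lambda>k. z i *\<^sub>C (monomial J k z *\<^sub>C ell2_nth f k)) ?M
      = z i *\<^sub>C infsum (\<lambda>k. monomial J k z *\<^sub>C ell2_nth f k) ?M"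
    by (rule bounded_op_infsum[OF bounded_op_scale[OF bounded_op_id] hardy_eval_summable[OF J z]])
  finally show ?thesis by (simp add: hardy_eval_def shift.rep_eq)
qed

text \<open>On multi-indices this is the monomial x z^k. On \<open>(nat, 'h) ell2\<close> the
  indices 0 and 1 serve as the embeddings of the two summands of a direct sum.\<close>

lift_definition single :: "'i \<Rightarrow> 'a::complex_inner \<Rightarrow> ('i, 'a) ell2"
  is "\<lambda>k x j. if j = k then x else 0"
proof -
  fix k :: 'i and x :: 'a
  have "(\<lambda>j. (norm (if j = k then x else 0))\<^sup>2) summable_on {k}" by simp
  then show "(\<lambda>j. (norm (if j = k then x else 0))\<^sup>2) summable_on UNIV"
    by (rule summable_on_cong_neutral[THEN iffD1, rotated 3]) auto
qed

lemma cinner_single: "cinner f (single k x) = cinner (ell2_nth f k) x"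
proof -
  have "(\<Sum>\<^sub>\<infinity>j. cinner (ell2_nth f j) (if j = k then x else 0)) = (\<Sum>\<^sub>\<infinity>j\<in>{k}. cinner (ell2_nth f j) x)"
    by (rule infsum_cong_neutral) auto
  then show ?thesis by (simp add: cinner_ell2.rep_eq single.rep_eq)
qed

lemma norm_single: "norm (single k x) = norm x"
proof -
  have "cinner (single k x) (single k x) = cinner x x" by (simp add: cinner_single single.rep_eq)
  then have "(norm (single k x))\<^sup>2 = (norm x)\<^sup>2" using Re_cinner_self by metis
  then show ?thesis by simp
qed

lemma bounded_op_single: "bounded_op (single k)"
  by (rule bounded_opI[where C = 1])
    (auto simp: norm_single ell2_nth_inject[symmetric] fun_eq_iff plus_ell2.rep_eq
      scaleC_ell2.rep_eq single.rep_eq)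

text \<open>Density of polynomials, used to reduce purity of a multiplication operator to monomials.
  The squared distance to a truncation is |f|^2 minus the partial sum of the squared coefficient
  norms.\<close>

lemma single_sum_approx:
  fixes f :: "('i, 'a::complex_hilbert) ell2"
  assumes "e > 0"
  obtains F where "finite F" "norm (f - (\<Sum>k\<in>F. single k (ell2_nth f k))) < e"
proof -
  have "(\<lambda>k. (norm (ell2_nth f k))\<^sup>2) summable_on UNIV" using ell2_nth[of f] by simp
  moreover have nf: "(norm f)\<^sup>2 = (\<Sum>\<^sub>\<infinity>k. (norm (ell2_nth f k))\<^sup>2)"
    by (simp add: norm_ell2.rep_eq infsum_nonneg)
  ultimately have "((\<lambda>k. (norm (ell2_nth f k))\<^sup>2) has_sum (norm f)\<^sup>2) UNIV"
    by (metis has_sum_infsum)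
  then have "\<forall>\<^sub>F F in finite_subsets_at_top UNIV.
      dist (\<Sum>k\<in>F. (norm (ell2_nth f k))\<^sup>2) ((norm f)\<^sup>2) < e\<^sup>2"
    unfolding has_sum_def using assms by (intro tendstoD) auto
  then obtain F where F: "finite F" "dist (\<Sum>k\<in>F. (norm (ell2_nth f k))\<^sup>2) ((norm f)\<^sup>2) < e\<^sup>2"
    unfolding eventually_finite_subsets_at_top by blast
  let ?g = "\<Sum>k\<in>F. single k (ell2_nth f k)" and ?s = "\<Sum>k\<in>F. (norm (ell2_nth f k))\<^sup>2"
  have nth: "ell2_nth (sum (\<lambda>k. single k (ell2_nth f k)) F) j = (if j \<in> F then ell2_nth f j else 0)" for j
    using F(1) by (subst bounded_op_sum[OF bounded_op_nth, of _ F])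
      (simp add: single.rep_eq)
  have fg: "cinner f ?g = complex_of_real ?s" "cinner ?g ?g = complex_of_real ?s"
    unfolding cinner_sum_right cinner_single nth by (simp_all add: cinner_self)
  then have "(norm ?g)\<^sup>2 = ?s" by (metis Re_cinner_self Re_complex_of_real)
  then have "(norm (f - ?g))\<^sup>2 = (norm f)\<^sup>2 - ?s"
    by (simp add: norm_diff_squared fg(1))
  also have "\<dots> < e\<^sup>2" using F(2) by (simp add: dist_real_def)
  finally have "norm (f - ?g) < e" using assms by (simp add: power_less_imp_less_base)
  with F(1) that show thesis by blast
qed

section \<open>Inner functions of degree one in one variable\<close>

lemma ell2_eqI: "(\<And>k. ell2_nth f k = ell2_nth g k) \<Longrightarrow> f = g"
  by (simp add: ell2_nth_inject[symmetric] fun_eq_iff)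

lemma unshift_shift: "unshift i (shift i f) = f"
  by (rule ell2_eqI) (simp add: unshift.rep_eq shift.rep_eq)

lemma bounded_op_shift: "bounded_op (shift i :: (nat \<Rightarrow> nat, 'e::complex_hilbert) ell2 \<Rightarrow> _)"
proof (rule bounded_opI[where C = 1])
  show "shift i (f + g) = shift i f + shift i g" for f g :: "(nat \<Rightarrow> nat, 'e) ell2"
    by (rule ell2_eqI) (simp add: shift.rep_eq plus_ell2.rep_eq)
  show "shift i (c *\<^sub>C f) = c *\<^sub>C shift i f" for c and f :: "(nat \<Rightarrow> nat, 'e) ell2"
    by (rule ell2_eqI) (simp add: shift.rep_eq scaleC_ell2.rep_eq)
  fix f :: "(nat \<Rightarrow> nat, 'e) ell2"
  have "Re (cinner (shift i f) (shift i f)) = Re (cinner f f)"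
    unfolding cinner_shift unshift_shift ..
  then have "norm (shift i f) = norm f" by simp
  then show "norm (shift i f) \<le> 1 * norm f" by simp
qed

lemma bounded_op_unshift: "bounded_op (unshift i :: (nat \<Rightarrow> nat, 'e::complex_hilbert) ell2 \<Rightarrow> _)"
  by (rule bounded_op_adjoint[OF bounded_op_shift cinner_shift])

lemma bounded_op_ampliation:
  assumes A: "bounded_op A"
  shows "bounded_op (ampliation A :: ('i, 'a::complex_hilbert) ell2 \<Rightarrow> ('i, 'b::complex_hilbert) ell2)"
proof -
  obtain C where C: "C > 0" "\<And>x. norm (A x) \<le> C * norm x" using bounded_op_bound[OF A] by blast
  show ?thesis
  proof (rule bounded_opI[where C = C])
    show "ampliation A (f + g) = ampliation A f + ampliation A g" for f g :: "('i, 'a) ell2"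
      by (rule ell2_eqI) (simp add: ampliation_nth[OF A] plus_ell2.rep_eq bounded_op_add[OF A])
    show "ampliation A (c *\<^sub>C f) = c *\<^sub>C ampliation A f" for c and f :: "('i, 'a) ell2"
      by (rule ell2_eqI) (simp add: ampliation_nth[OF A] scaleC_ell2.rep_eq bounded_op_scaleC[OF A])
    fix f :: "('i, 'a) ell2"
    have s: "(\<lambda>k. (norm (ell2_nth g k))\<^sup>2) summable_on UNIV" for g :: "('i, 'c::complex_hilbert) ell2"
      using ell2_nth[of g] by simp
    have n: "(norm g)\<^sup>2 = (\<Sum>\<^sub>\<infinity>k. (norm (ell2_nth g k))\<^sup>2)" for g :: "('i, 'c::complex_hilbert) ell2"
      by (simp add: norm_ell2.rep_eq infsum_nonneg)
    have "(norm (ampliation A f))\<^sup>2 \<le> (\<Sum>\<^sub>\<infinity>k. C\<^sup>2 * (norm (ell2_nth f k))\<^sup>2)"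
      unfolding n
    proof (rule infsum_mono[OF s summable_on_cmult_right[OF s]])
      fix k
      show "(norm (ell2_nth (ampliation A f) k))\<^sup>2 \<le> C\<^sup>2 * (norm (ell2_nth f k))\<^sup>2"
        using power_mono[OF C(2), of _ 2] by (simp add: ampliation_nth[OF A] power_mult_distrib)
    qed
    also have "\<dots> = (C * norm f)\<^sup>2"
      by (simp add: infsum_cmult_right' power_mult_distrib n)
    finally show "norm (ampliation A f) \<le> C * norm f"
      by (rule power2_le_imp_le) (use C(1) in simp)
  qed
qed

lemma unshift_single:
  "unshift i (single k x) = (if k i = 0 then 0 else single (lower i k) x)"
proof (rule ell2_eqI)
  fix j
  have "raise i j = k \<longleftrightarrow> k i \<noteq> 0 \<and> j = lower i k" by auto
  then show "ell2_nth (unshift i (single k x)) j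
      = ell2_nth (if k i = 0 then 0 else single (lower i k) x) j"
    by (simp add: unshift.rep_eq single.rep_eq zero_ell2.rep_eq)
qed

lemma ampliation_single: "bounded_op A \<Longrightarrow> ampliation A (single k x) = single k (A x)"
  by (rule ell2_eqI) (simp add: ampliation_nth single.rep_eq bounded_op_zero)

lemma single_in_hardy:
  "hilbert_subspace E \<Longrightarrow> k \<in> multi_indices J \<Longrightarrow> x \<in> E \<Longrightarrow> single k x \<in> hardy J E"
  by (auto simp: hardy_def single.rep_eq hilbert_subspace_def complex_vector.subspace_0)

text \<open>\<open>A'\<close> and \<open>B'\<close> are the adjoints of \<open>A\<close> and \<open>B\<close>. Multiplication by \<open>A + z\<^sub>i B\<close> is an isometry iff
  \<open>A' A + B' B = 1\<close> and \<open>A' B = 0\<close>, and it is pure if its constant term is.\<close>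

locale inner_pencil =
  fixes J :: "nat set" and i :: nat and E :: "'e::complex_hilbert set" and A B A' B' :: "'e \<Rightarrow> 'e"
  assumes finite_J: "finite J" and i_J: "i \<in> J" and E: "hilbert_subspace E"
    and bounded: "bounded_op A" "bounded_op B" "bounded_op A'" "bounded_op B'"
    and maps: "\<And>x. x \<in> E \<Longrightarrow> A x \<in> E" "\<And>x. x \<in> E \<Longrightarrow> B x \<in> E"
      "\<And>x. x \<in> E \<Longrightarrow> A' x \<in> E" "\<And>x. x \<in> E \<Longrightarrow> B' x \<in> E"
    and adjoint: "\<And>x y. cinner (A x) y = cinner x (A' y)" "\<And>x y. cinner (B x) y = cinner x (B' y)"
    and isometric: "\<And>x. x \<in> E \<Longrightarrow> A' (A x) + B' (B x) = x"
      "\<And>x. x \<in> E \<Longrightarrow> A' (B x) = 0" "\<And>x. x \<in> E \<Longrightarrow> B' (A x) = 0"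
    and pure: "\<And>x. x \<in> E \<Longrightarrow> (\<lambda>m. (A' ^^ m) x) \<longlonglongrightarrow> 0"
begin

definition symbol :: "(nat \<Rightarrow> complex) \<Rightarrow> 'e \<Rightarrow> 'e"
  where "symbol z x = A x + z i *\<^sub>C B x"

definition mult :: "(nat \<Rightarrow> nat, 'e) ell2 \<Rightarrow> (nat \<Rightarrow> nat, 'e) ell2"
  where "mult f = ampliation A f + shift i (ampliation B f)"

definition mult' :: "(nat \<Rightarrow> nat, 'e) ell2 \<Rightarrow> (nat \<Rightarrow> nat, 'e) ell2"
  where "mult' f = ampliation A' f + unshift i (ampliation B' f)"

abbreviation K :: "(nat \<Rightarrow> nat, 'e) ell2 set"
  where "K \<equiv> hardy J E"

lemma subspaces: "complex_vector.subspace E" "complex_vector.subspace K"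
  using E subspace_hardy[OF E] by (auto simp: hilbert_subspace_def)

lemma bounded_mult: "bounded_op mult" "bounded_op mult'"
  unfolding mult_def[abs_def] mult'_def[abs_def]
  by (intro bounded_op_plus bounded_op_ampliation bounded
      bounded_op_comp[OF bounded_op_shift] bounded_op_comp[OF bounded_op_unshift])+

lemma mult_nth:
  "ell2_nth (mult f) k = A (ell2_nth f k) + (if k i = 0 then 0 else B (ell2_nth f (lower i k)))"
  by (simp add: mult_def plus_ell2.rep_eq shift.rep_eq ampliation_nth bounded)

lemma mult'_nth: "ell2_nth (mult' f) k = A' (ell2_nth f k) + B' (ell2_nth f (raise i k))"
  by (simp add: mult'_def plus_ell2.rep_eq unshift.rep_eq ampliation_nth bounded)

lemma nth_in:
  assumes "f \<in> K"
  shows "ell2_nth f k \<in> E" "k \<notin> multi_indices J \<Longrightarrow> ell2_nth f k = 0"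
proof -
  show 0: "ell2_nth f k = 0" if "k \<notin> multi_indices J"
    using assms that by (simp add: hardy_def)
  show "ell2_nth f k \<in> E"
    using assms 0 complex_vector.subspace_0[OF subspaces(1)]
    by (cases "k \<in> multi_indices J") (auto simp: hardy_def)
qed

lemma mult_in:
  assumes f: "f \<in> K"
  shows "mult f \<in> K"
proof -
  have "ell2_nth (mult f) k \<in> E" for k
    unfolding mult_nth
    by (auto intro!: complex_vector.subspace_add[OF subspaces(1)] maps nth_in[OF f]
        complex_vector.subspace_0[OF subspaces(1)])
  moreover have "ell2_nth (mult f) k = 0" if k: "k \<notin> multi_indices J" for k
  proof -
    have "lower i k \<notin> multi_indices J" using k lower_multi_indices[OF i_J] by blast
    then show ?thesis
      unfolding mult_nth nth_in(2)[OF f k]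
      by (simp add: nth_in(2)[OF f] bounded_op_zero[OF bounded(1)] bounded_op_zero[OF bounded(2)])
  qed
  ultimately show ?thesis by (simp add: hardy_def)
qed

lemma mult'_in:
  assumes f: "f \<in> K"
  shows "mult' f \<in> K"
proof -
  have "ell2_nth (mult' f) k \<in> E" for k
    unfolding mult'_nth
    by (intro complex_vector.subspace_add[OF subspaces(1)] maps nth_in[OF f])
  moreover have "ell2_nth (mult' f) k = 0" if k: "k \<notin> multi_indices J" for k
  proof -
    have "raise i k \<notin> multi_indices J" using k raise_multi_indices[OF i_J] by blast
    then show ?thesis
      unfolding mult'_nth nth_in(2)[OF f k]
      by (simp add: nth_in(2)[OF f] bounded_op_zero[OF bounded(3)] bounded_op_zero[OF bounded(4)])
  qed
  ultimately show ?thesis by (simp add: hardy_def)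
qed

lemma cinner_mult: "cinner (mult f) g = cinner f (mult' g)"
proof -
  have "unshift i (ampliation B' g) = ampliation B' (unshift i g)"
    by (rule ell2_eqI) (simp add: unshift.rep_eq ampliation_nth bounded)
  then show ?thesis
    by (simp add: mult_def mult'_def cinner_add_left cinner_add_right cinner_shift
      cinner_ampliation[OF bounded(1,3) adjoint(1)] cinner_ampliation[OF bounded(2,4) adjoint(2)])
qed

lemma mult'_mult:
  assumes f: "f \<in> K"
  shows "mult' (mult f) = f"
proof (rule ell2_eqI)
  fix k
  note inE = nth_in(1)[OF f]
  have "ell2_nth (mult' (mult f)) k = A' (A (ell2_nth f k)) + B' (B (ell2_nth f k))"
    by (simp add: mult'_nth mult_nth bounded_op_add[OF bounded(3)] bounded_op_add[OF bounded(4)]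
        isometric(2,3)[OF inE] bounded_op_zero[OF bounded(3)])
  then show "ell2_nth (mult' (mult f)) k = ell2_nth f k" by (simp add: isometric(1)[OF inE])
qed

lemma norm_mult_eq:
  assumes "f \<in> K"
  shows "norm (mult f) = norm f"
proof -
  have "Re (cinner (mult f) (mult f)) = Re (cinner f f)"
    unfolding cinner_mult mult'_mult[OF assms] ..
  then show ?thesis by simp
qed

lemma norm_mult'_le:
  assumes f: "f \<in> K"
  shows "norm (mult' f) \<le> norm f"
proof -
  have "(norm (mult' f))\<^sup>2 = Re (cinner (mult (mult' f)) f)" by (simp add: cinner_mult)
  also have "\<dots> \<le> norm (mult (mult' f)) * norm f"
    by (rule order_trans[OF complex_Re_le_cmod norm_cinner_le])
  also have "\<dots> = norm (mult' f) * norm f" by (simp add: norm_mult_eq mult'_in f)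
  finally show ?thesis
    by (cases "mult' f = 0") (simp_all add: power2_eq_square)
qed

lemma hardy_eval_mult:
  assumes z: "z \<in> polydisc J"
  shows "hardy_eval J (mult f) z = symbol z (hardy_eval J f z)"
  by (simp add: mult_def symbol_def hardy_eval_add[OF finite_J z] hardy_eval_shift[OF finite_J i_J z]
      hardy_eval_ampliation[OF finite_J z] bounded)

lemma mult_op_symbol:
  assumes f: "f \<in> K"
  shows "mult_op J E symbol f = mult f"
  by (rule mult_op_eqI[OF finite_J E mult_in[OF f]]) (rule hardy_eval_mult)

lemma hardy_eval_mult_op:
  assumes f: "f \<in> K" and z: "z \<in> polydisc J"
  shows "hardy_eval J (mult_op J E symbol f) z = symbol z (hardy_eval J f z)"
  unfolding mult_op_symbol[OF f] by (rule hardy_eval_mult[OF z])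

lemma isometry_mult_op: "isometry K K (mult_op J E symbol)"
proof -
  have "mult \<in> bounded_ops K K" by (rule bounded_op_on[OF bounded_mult(1) mult_in])
  then have "mult_op J E symbol \<in> bounded_ops K K"
    using complex_vector.subspace_add[OF subspaces(2)] complex_vector.subspace_scale[OF subspaces(2)]
    by (simp add: bounded_ops_def mult_op_symbol)
  then show ?thesis by (simp add: isometry_def mult_op_symbol norm_mult_eq)
qed

lemma adj_mult_op:
  assumes "g \<in> K"
  shows "adj K (mult_op J E symbol) g = mult' g"
proof (rule adj_eqI[OF hilbert_subspace_hardy[OF E] mult'_in[OF assms]])
  show "cinner (mult_op J E symbol f) g = cinner f (mult' g)" if "f \<in> K" for f
    unfolding mult_op_symbol[OF that] by (rule cinner_mult)
qed

section \<open>Purity of multiplication by a pencil\<close>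

lemma funpow_mult'_in: "f \<in> K \<Longrightarrow> (mult' ^^ m) f \<in> K"
  by (induction m) (auto intro: mult'_in)

lemma norm_funpow_mult'_le: "f \<in> K \<Longrightarrow> norm ((mult' ^^ m) f) \<le> norm f"
  by (induction m) (auto intro: order_trans[OF norm_mult'_le[OF funpow_mult'_in]])

text \<open>Since \<open>mult'\<close> contracts \<open>K\<close>, vectors close to one with a null
  orbit stay small from some time on. Allowing m initial steps before the approximation is what the
  induction over monomials exploits.\<close>

lemma mult'_tendsto_zeroI:
  assumes f: "f \<in> K"
    and approx: "\<And>e. e > 0 \<Longrightarrow>
      \<exists>m g. g \<in> K \<and> (\<lambda>j. (mult' ^^ j) g) \<longlonglongrightarrow> 0 \<and> norm ((mult' ^^ m) f - g) < e"
  shows "(\<lambda>j. (mult' ^^ j) f) \<longlonglongrightarrow> 0"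
proof (rule metric_LIMSEQ_I)
  fix e :: real assume e: "e > 0"
  then obtain m g where g: "g \<in> K" "(\<lambda>j. (mult' ^^ j) g) \<longlonglongrightarrow> 0" "norm ((mult' ^^ m) f - g) < e / 2"
    using approx[of "e / 2"] by auto
  obtain N where N: "\<And>j. j \<ge> N \<Longrightarrow> norm ((mult' ^^ j) g) < e / 2"
    using LIMSEQ_D[OF g(2), of "e / 2"] e by auto
  have "norm ((mult' ^^ j) f) < e" if j: "j \<ge> N + m" for j
  proof -
    let ?h = "(mult' ^^ m) f - g" and ?j = "j - m"
    have h: "?h \<in> K" by (intro complex_vector.subspace_diff[OF subspaces(2)] funpow_mult'_in f g(1))
    have "(mult' ^^ j) f = (mult' ^^ ?j) ((mult' ^^ m) f)"
      using j by (simp add: funpow_add[symmetric] flip: o_apply[of "mult' ^^ _"])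
    also have "\<dots> = (mult' ^^ ?j) ?h + (mult' ^^ ?j) g"
      by (simp add: bounded_op_diff[OF bounded_op_funpow[OF bounded_mult(2)]])
    finally have "norm ((mult' ^^ j) f) \<le> norm ((mult' ^^ ?j) ?h) + norm ((mult' ^^ ?j) g)"
      by (simp add: norm_triangle_ineq)
    also have "\<dots> < e / 2 + e / 2"
    proof (rule add_le_less_mono)
      show "norm ((mult' ^^ ?j) ?h) \<le> e / 2" using norm_funpow_mult'_le[OF h, of ?j] g(3) by linarith
      show "norm ((mult' ^^ ?j) g) < e / 2" using j by (intro N) simp
    qed
    finally show ?thesis by simp
  qed
  then show "\<exists>N. \<forall>j\<ge>N. dist ((mult' ^^ j) f) 0 < e" by auto
qed

text \<open>Induction on the exponent of z_i. One application of \<open>mult'\<close> to x z^k keeps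
  A' x at z^k and sends B' x to the next lower power of z_i. After m steps the top term is A'^m x,
  small by purity of A', and the rest is a finite sum of vectors whose orbits tend to 0 by the
  induction hypothesis.\<close>

lemma mult'_tendsto_zero_single:
  "k \<in> multi_indices J \<Longrightarrow> x \<in> E \<Longrightarrow> (\<lambda>j. (mult' ^^ j) (single k x)) \<longlonglongrightarrow> 0"
proof (induction "k i" arbitrary: k x)
  case (0 k)
  \<comment> \<open>At exponent 0 there is no factor z_i to strip, so \<open>unshift\<close>
    annihilates the second term.\<close>
  have "(mult' ^^ j) (single k x) = single k ((A' ^^ j) x)" for j
    using 0(1) by (induction j)
      (simp_all add: mult'_def ampliation_single bounded unshift_single)
  moreover have "(\<lambda>j. single k ((A' ^^ j) x)) \<longlonglongrightarrow> single k 0"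
    by (rule bounded_op_tendsto[OF bounded_op_single pure[OF 0(3)]])
  ultimately show ?case by (simp add: bounded_op_zero[OF bounded_op_single])
next
  case (Suc n k)
  have A'x: "(A' ^^ m) x \<in> E" for m by (induction m) (auto simp: maps Suc.prems)
  have step: "mult' (single k y) = single k (A' y) + single (lower i k) (B' y)" for y
    using Suc(2) by (simp add: mult'_def ampliation_single bounded unshift_single)
  have low: "lower i k \<in> multi_indices J" using Suc.prems lower_multi_indices[OF i_J] by blast
  have n: "n = lower i k i" using Suc(2) by simp
  have ex: "\<exists>g. g \<in> K \<and> (\<lambda>j. (mult' ^^ j) g) \<longlonglongrightarrow> 0
      \<and> (mult' ^^ m) (single k x) = single k ((A' ^^ m) x) + g" for m
  proof (induction m)
    case 0
    show ?case
      by (rule exI[of _ 0])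
        (simp add: complex_vector.subspace_0[OF subspaces(2)]
          bounded_op_zero[OF bounded_op_funpow[OF bounded_mult(2)]])
  next
    case (Suc m)
    then obtain g where g: "g \<in> K" "(\<lambda>j. (mult' ^^ j) g) \<longlonglongrightarrow> 0"
      "(mult' ^^ m) (single k x) = single k ((A' ^^ m) x) + g" by blast
    let ?s = "single (lower i k) (B' ((A' ^^ m) x))"
    have s: "?s \<in> K" by (intro single_in_hardy E low maps A'x)
    have "(\<lambda>j. (mult' ^^ j) ?s) \<longlonglongrightarrow> 0" by (intro Suc.hyps(1) n low maps A'x)
    moreover have "(\<lambda>j. (mult' ^^ j) (mult' g)) \<longlonglongrightarrow> 0"
      using LIMSEQ_Suc[OF g(2)] by (simp add: funpow_swap1)
    ultimately have "(\<lambda>j. (mult' ^^ j) (?s + mult' g)) \<longlonglongrightarrow> 0 + 0"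
      by (simp only: bounded_op_add[OF bounded_op_funpow[OF bounded_mult(2)]] tendsto_add)
    moreover have "?s + mult' g \<in> K"
      by (intro complex_vector.subspace_add[OF subspaces(2)] s mult'_in g)
    moreover have "(mult' ^^ Suc m) (single k x) = single k ((A' ^^ Suc m) x) + (?s + mult' g)"
      by (simp add: g(3) bounded_op_add[OF bounded_mult(2)] step add.assoc)
    ultimately show ?case by auto
  qed
  show ?case
  proof (rule mult'_tendsto_zeroI)
    show "single k x \<in> K" by (intro single_in_hardy E Suc.prems)
    fix e :: real assume "e > 0"
    then obtain m where m: "norm ((A' ^^ m) x) < e"
      using LIMSEQ_D[OF pure[OF Suc.prems(2)], of e] by auto
    then show "\<exists>m g. g \<in> K \<and> (\<lambda>j. (mult' ^^ j) g) \<longlonglongrightarrow> 0 \<and> norm ((mult' ^^ m) (single k x) - g) < e"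
      using ex[of m] by (metis add_diff_cancel_right' norm_single)
  qed
qed

lemma mult'_tendsto_zero:
  assumes f: "f \<in> K"
  shows "(\<lambda>j. (mult' ^^ j) f) \<longlonglongrightarrow> 0"
proof (rule mult'_tendsto_zeroI[OF f])
  fix e :: real assume "e > 0"
  then obtain F where F: "finite F" "norm (f - (\<Sum>k\<in>F. single k (ell2_nth f k))) < e"
    by (rule single_sum_approx)
  let ?g = "\<Sum>k\<in>F. single k (ell2_nth f k)"
  have s: "single k (ell2_nth f k) \<in> K \<and> (\<lambda>j. (mult' ^^ j) (single k (ell2_nth f k))) \<longlonglongrightarrow> 0" for k
  proof (cases "k \<in> multi_indices J")
    case True
    then show ?thesis using f mult'_tendsto_zero_single single_in_hardy[OF E]
      by (auto simp: hardy_def)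
  next
    case False
    then have "single k (ell2_nth f k) = 0"
      using f bounded_op_zero[OF bounded_op_single] by (auto simp: hardy_def)
    then show ?thesis
      by (simp add: complex_vector.subspace_0[OF subspaces(2)]
          bounded_op_zero[OF bounded_op_funpow[OF bounded_mult(2)]])
  qed
  have "(\<lambda>j. \<Sum>k\<in>F. (mult' ^^ j) (single k (ell2_nth f k))) \<longlonglongrightarrow> (\<Sum>k\<in>F. 0)"
    by (intro tendsto_sum) (use s in blast)
  then have "(\<lambda>j. (mult' ^^ j) ?g) \<longlonglongrightarrow> 0"
    by (simp add: bounded_op_sum[OF bounded_op_funpow[OF bounded_mult(2)]])
  moreover have "?g \<in> K" using s by (intro complex_vector.subspace_sum[OF subspaces(2)]) blast
  moreover have "norm ((mult' ^^ 0) f - ?g) < e" using F(2) by simp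
  ultimately show "\<exists>m g. g \<in> K \<and> (\<lambda>j. (mult' ^^ j) g) \<longlonglongrightarrow> 0 \<and> norm ((mult' ^^ m) f - g) < e"
    by blast
qed

theorem pure_isometry_mult_op: "pure_isometry K (mult_op J E symbol)"
proof -
  have "(\<lambda>m. (adj K (mult_op J E symbol) ^^ m) f) \<longlonglongrightarrow> 0" if f: "f \<in> K" for f
  proof -
    have "(adj K (mult_op J E symbol) ^^ m) f = (mult' ^^ m) f" for m
      by (induction m) (simp_all add: adj_mult_op funpow_mult'_in f)
    then show ?thesis using mult'_tendsto_zero[OF f] by simp
  qed
  then show ?thesis
    using isometry_mult_op by (simp add: pure_isometry_def pure_contraction_def contraction_def isometry_def)
qed

section \<open>Pencils as inner polynomials of degree at most one\<close>

definition zero_index :: "nat \<Rightarrow> nat"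
  where "zero_index = (\<lambda>j\<in>J. 0)"

definition coeff :: "(nat \<Rightarrow> nat) \<Rightarrow> 'e \<Rightarrow> 'e"
  where "coeff k = (if k = zero_index then A else if k = raise i zero_index then B else (\<lambda>x. 0))"

lemma indices: "zero_index \<in> multi_indices J" "raise i zero_index \<in> multi_indices J"
  "zero_index \<noteq> raise i zero_index"
proof -
  show "zero_index \<in> multi_indices J" by (simp add: zero_index_def multi_indices_def)
  then show "raise i zero_index \<in> multi_indices J" using raise_multi_indices[OF i_J] by blast
  show "zero_index \<noteq> raise i zero_index" by (metis fun_upd_same n_not_Suc_n)
qed

lemma coeff_in: "coeff k \<in> bounded_ops E E"
proof (rule bounded_op_on)
  show "bounded_op (coeff k)"
    unfolding coeff_def by (simp only: bounded(1,2) bounded_op_const_zero split: if_split) simp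
  show "coeff k x \<in> E" if "x \<in> E" for x
    using maps(1,2)[OF that] complex_vector.subspace_0[OF subspaces(1)] by (simp add: coeff_def)
qed

lemma symbol_sum:
  assumes F: "finite F" "{zero_index, raise i zero_index} \<subseteq> F"
  shows "(\<Sum>k\<in>F. monomial J k z *\<^sub>C coeff k x) = symbol z x"
proof -
  have m: "monomial J zero_index z = 1"
    by (simp add: monomial_def zero_index_def)
  have "(\<Sum>k\<in>F. monomial J k z *\<^sub>C coeff k x)
      = (\<Sum>k\<in>{zero_index, raise i zero_index}. monomial J k z *\<^sub>C coeff k x)"
    by (rule sum.mono_neutral_right[OF F]) (auto simp: coeff_def)
  also have "\<dots> = monomial J zero_index z *\<^sub>C A x + monomial J (raise i zero_index) z *\<^sub>C B x"
    using indices(3) by (simp add: coeff_def)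
  also have "\<dots> = symbol z x"
    by (simp only: monomial_raise[OF finite_J i_J] m symbol_def) simp
  finally show ?thesis .
qed

lemma op_polynomial_symbol: "op_polynomial J E 1 symbol"
  unfolding op_polynomial_def
proof (intro exI[of _ coeff] conjI ballI)
  fix z x
  let ?F = "{k \<in> multi_indices J. (\<Sum>j\<in>J. k j) \<le> 1}"
  \<comment> \<open>Finiteness of the index set is essential: a sum over an infinite set is 0 by
    convention.\<close>
  have "?F \<subseteq> (\<Pi>\<^sub>E j\<in>J. {..1})"
  proof
    fix k assume k: "k \<in> ?F"
    have "k j \<le> 1" if "j \<in> J" for j
      using member_le_sum[OF that, of k] finite_J k by auto
    then show "k \<in> (\<Pi>\<^sub>E j\<in>J. {..1})" using k by (auto simp: multi_indices_def PiE_iff)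
  qed
  then have "finite ?F" by (rule finite_subset) (simp add: finite_J finite_PiE)
  moreover have "{zero_index, raise i zero_index} \<subseteq> ?F"
  proof -
    have "(\<Sum>j\<in>J. zero_index j) = 0" by (simp add: zero_index_def)
    moreover have "(\<Sum>j\<in>J. raise i zero_index j) = (\<Sum>j\<in>J. if j = i then 1 else 0)"
      by (rule sum.cong) (auto simp: zero_index_def)
    ultimately show ?thesis using indices finite_J by auto
  qed
  ultimately show "symbol z x = (\<Sum>k | k \<in> multi_indices J \<and> (\<Sum>j\<in>J. k j) \<le> 1. monomial J k z *\<^sub>C coeff k x)"
    by (simp only: symbol_sum)
qed (rule coeff_in)

lemma H_infinity_symbol: "symbol \<in> H_infinity J E"
proof -
  have E0: "0 \<in> E" by (rule complex_vector.subspace_0[OF subspaces(1)])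
  obtain C where C: "C > 0" "\<And>x. norm (A x) \<le> C * norm x" using bounded_op_bound[OF bounded(1)] by blast
  obtain D where D: "D > 0" "\<And>x. norm (B x) \<le> D * norm x" using bounded_op_bound[OF bounded(2)] by blast
  have "opnorm E (symbol z) \<le> C + D" if z: "z \<in> polydisc J" for z
    unfolding opnorm_def
  proof (rule cSUP_least)
    fix x
    have "norm (symbol z x) \<le> norm (A x) + cmod (z i) * norm (B x)"
      unfolding symbol_def by (rule order_trans[OF norm_triangle_ineq]) (simp add: norm_scaleC)
    also have "cmod (z i) * norm (B x) \<le> 1 * norm (B x)"
      using z i_J by (intro mult_right_mono) (auto simp: polydisc_def PiE_iff intro: less_imp_le)
    also have "norm (A x) + 1 * norm (B x) \<le> (C + D) * norm x"
      using C(2)[of x] D(2)[of x] by (simp add: distrib_right)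
    \<comment> \<open>The supremum in \<open>opnorm\<close> includes x = 0, where the quotient is 0
      by the convention on division.\<close>
    finally show "norm (symbol z x) / norm x \<le> C + D"
      using C(1) D(1) by (cases "x = 0") (simp_all add: divide_le_eq)
  qed (use E0 in blast)
  then have bdd: "bdd_above ((\<lambda>z. opnorm E (symbol z)) ` polydisc J)"
    by (auto intro!: bdd_aboveI[of _ "C + D"])
  have "symbol z \<in> bounded_ops E E" for z
  proof (rule bounded_op_on)
    show "bounded_op (symbol z)"
      unfolding symbol_def[abs_def] by (intro bounded_op_plus bounded_op_scale bounded)
    show "symbol z x \<in> E" if "x \<in> E" for x
      unfolding symbol_def using that
      by (intro complex_vector.subspace_add[OF subspaces(1)] complex_vector.subspace_scale[OF subspaces(1)] maps)
  qed
  moreover have "((\<lambda>F. opnorm E (\<lambda>x. symbol z x - (\<Sum>k\<in>F. monomial J k z *\<^sub>C coeff k x))) \<longlongrightarrow> 0)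
      (finite_subsets_at_top (multi_indices J))" for z
  \<comment> \<open>The coefficient family is supported on two indices. As soon as a finite set
    contains both, the remainder is exactly 0.\<close>
  proof (rule tendsto_eventually)
    have "\<forall>\<^sub>F F in finite_subsets_at_top (multi_indices J). finite F \<and> {zero_index, raise i zero_index} \<subseteq> F"
      unfolding eventually_finite_subsets_at_top
      by (rule exI[of _ "{zero_index, raise i zero_index}"]) (use indices in auto)
    then show "\<forall>\<^sub>F F in finite_subsets_at_top (multi_indices J).
        opnorm E (\<lambda>x. symbol z x - (\<Sum>k\<in>F. monomial J k z *\<^sub>C coeff k x)) = 0"
    proof eventually_elim
      case (elim F)
      then have "opnorm E (\<lambda>x. symbol z x - (\<Sum>k\<in>F. monomial J k z *\<^sub>C coeff k x)) = (SUP x\<in>E. 0)"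
        unfolding opnorm_def by (simp add: symbol_sum)
      also have "\<dots> = 0" using E0 by (intro cSUP_const) blast
      finally show ?case .
    qed
  qed
  ultimately show ?thesis
    using bdd coeff_in unfolding H_infinity_def by blast
qed

theorem inner_function_symbol: "inner_function J E symbol"
  using H_infinity_symbol isometry_mult_op by (simp add: inner_function_def)

end

section \<open>Defect forms of commuting contractions\<close>

text \<open>For a tuple \<open>Z\<close> of adjoints this is \<open>\<langle>(\<Prod>\<^sub>i\<^sub>\<in>\<^sub>F (1 - C\<^sub>i)) 1 h, h\<rangle>\<close> with \<open>C\<^sub>i T = Z\<^sub>i\<^sup>* T Z\<^sub>i\<close>.\<close>

definition defect_form :: "(nat \<Rightarrow> 'h::complex_hilbert \<Rightarrow> 'h) \<Rightarrow> nat set \<Rightarrow> 'h \<Rightarrow> real"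
  where "defect_form Z F h = (\<Sum>G\<in>Pow F. (- 1) ^ card G * (norm (op_prod Z G h))\<^sup>2)"

text \<open>\<open>op_prod\<close> multiplies in increasing order of the indices; commutation moves
  a new factor from its sorted position to the front.\<close>

lemma foldr_insort_commute:
  fixes Z :: "nat \<Rightarrow> 'h \<Rightarrow> 'h"
  assumes "\<And>j x. j \<in> set xs \<Longrightarrow> Z i (Z j x) = Z j (Z i x)"
  shows "foldr (\<circ>) (map Z (insort i xs)) id x = Z i (foldr (\<circ>) (map Z xs) id x)"
  using assms by (induction xs arbitrary: x) auto

lemma op_prod_empty: "op_prod Z {} h = h"
  by (simp add: op_prod_def)

lemma commuting_onD:
  "commuting_on UNIV J Z \<Longrightarrow> i \<in> J \<Longrightarrow> j \<in> J \<Longrightarrow> Z i (Z j x) = Z j (Z i x)"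
  by (simp add: commuting_on_def)

lemma op_prod_insert:
  assumes "finite F" "i \<notin> F" "commuting_on UNIV (insert i F) Z"
  shows "op_prod Z (insert i F) h = Z i (op_prod Z F h)"
proof -
  have "sorted_list_of_set (insert i F) = insort i (sorted_list_of_set F)"
    by (rule sorted_list_of_set_insert) (use assms in auto)
  moreover have "foldr (\<circ>) (map Z (insort i (sorted_list_of_set F))) id h
      = Z i (foldr (\<circ>) (map Z (sorted_list_of_set F)) id h)"
    by (rule foldr_insort_commute, rule commuting_onD[OF assms(3)]) (use assms(1) in auto)
  ultimately show ?thesis by (simp only: op_prod_def)
qed

lemma op_prod_cong:
  assumes "finite F" "\<And>i. i \<in> F \<Longrightarrow> Y i = Z i"
  shows "op_prod Y F = op_prod Z F"
proof -
  have "map Y (sorted_list_of_set F) = map Z (sorted_list_of_set F)"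
    by (rule map_cong) (use assms in auto)
  then show ?thesis by (simp only: op_prod_def)
qed

lemma op_prod_commute:
  assumes "finite F" "\<And>i x. i \<in> F \<Longrightarrow> T (Z i x) = Z i (T x)"
  shows "T (op_prod Z F x) = op_prod Z F (T x)"
proof -
  have "T (foldr (\<circ>) (map Z xs) id x) = foldr (\<circ>) (map Z xs) id (T x)" if "set xs \<subseteq> F" for xs
    using that by (induction xs arbitrary: x) (auto simp: assms(2))
  then show ?thesis using assms(1) by (simp add: op_prod_def)
qed

lemma commuting_on_subset: "commuting_on K F Z \<Longrightarrow> G \<subseteq> F \<Longrightarrow> commuting_on K G Z"
  by (auto simp: commuting_on_def)

lemma op_prod_insert':
  assumes "finite F" "i \<notin> F" "commuting_on UNIV (insert i F) Z"
  shows "op_prod Z (insert i F) h = op_prod Z F (Z i h)"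
  unfolding op_prod_insert[OF assms]
  by (rule op_prod_commute[OF assms(1)], rule commuting_onD[OF assms(3)]) auto

lemma bounded_op_op_prod:
  assumes "finite F" "\<And>i. i \<in> F \<Longrightarrow> bounded_op (Z i)"
  shows "bounded_op (op_prod Z F)"
proof -
  have "bounded_op (foldr (\<circ>) (map Z xs) id)" if "set xs \<subseteq> F" for xs
    using that
    by (induction xs) (auto simp: id_def o_def assms(2) intro: bounded_op_id bounded_op_comp)
  then show ?thesis using assms(1) by (simp add: op_prod_def)
qed

lemma commuting_on_adj:
  assumes "commuting_on UNIV F X" "\<And>i. i \<in> F \<Longrightarrow> bounded_op (X i)"
  shows "commuting_on UNIV F (\<lambda>i. adj UNIV (X i))"
  unfolding commuting_on_def
proof (intro ballI)
  fix i j x assume ij: "i \<in> F" "j \<in> F"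
  show "adj UNIV (X i) (adj UNIV (X j) x) = adj UNIV (X j) (adj UNIV (X i) x)"
  proof (rule cinner_eqI_UNIV)
    fix y
    have "cinner (X j (X i y)) x = cinner (X i (X j y)) x"
      using assms(1) ij by (simp add: commuting_on_def)
    then show "cinner y (adj UNIV (X i) (adj UNIV (X j) x)) = cinner y (adj UNIV (X j) (adj UNIV (X i) x))"
      by (simp add: cinner_adj assms(2) ij)
  qed
qed

lemma cinner_op_prod:
  assumes "finite F" "commuting_on UNIV F X" "\<And>i. i \<in> F \<Longrightarrow> bounded_op (X i)"
  shows "cinner (op_prod X F x) y = cinner x (op_prod (\<lambda>i. adj UNIV (X i)) F y)"
  using assms
proof (induction F arbitrary: x y rule: finite_induct)
  case empty
  show ?case by (simp add: op_prod_empty)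
next
  case (insert i F)
  have comm: "commuting_on UNIV F X" using insert.prems(1) by (auto simp: commuting_on_def)
  have "commuting_on UNIV (insert i F) (\<lambda>i. adj UNIV (X i))"
    by (rule commuting_on_adj) (use insert.prems in auto)
  from op_prod_insert'[OF insert.hyps this]
  have "op_prod (\<lambda>i. adj UNIV (X i)) (insert i F) y
      = op_prod (\<lambda>i. adj UNIV (X i)) F (adj UNIV (X i) y)" .
  then show ?case
    using insert comm by (simp add: op_prod_insert cinner_adj)
qed

lemma defect_form_empty: "defect_form Z {} h = (norm h)\<^sup>2"
  by (simp add: defect_form_def op_prod_empty)

text \<open>Subsets are split by whether they contain i, which extracts the factor 1 - C_i. The
  later identities for defects come from this recursion.\<close>

lemma defect_form_insert:
  assumes F: "finite F" "i \<notin> F" and comm: "commuting_on UNIV (insert i F) Z"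
  shows "defect_form Z (insert i F) h = defect_form Z F h - defect_form Z F (Z i h)"
proof -
  let ?f = "\<lambda>G. (- 1 :: real) ^ card G * (norm (op_prod Z G h))\<^sup>2"
  have fin: "finite G" if "G \<in> Pow F" for G using that F(1) finite_subset by blast
  have inj: "inj_on (insert i) (Pow F)"
    using F(2) by (auto simp: inj_on_def)
  have "sum ?f (Pow (insert i F)) = sum ?f (Pow F) + sum ?f (insert i ` Pow F)"
    unfolding Pow_insert by (rule sum.union_disjoint) (use F in auto)
  also have "sum ?f (insert i ` Pow F) = (\<Sum>G\<in>Pow F. ?f (insert i G))"
    using inj by (simp add: sum.reindex)
  also have "\<dots> = (\<Sum>G\<in>Pow F. - ((- 1) ^ card G * (norm (op_prod Z G (Z i h)))\<^sup>2))"
  proof (rule sum.cong[OF refl])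
    fix G assume G: "G \<in> Pow F"
    then have "i \<notin> G" using F(2) by blast
    moreover have "commuting_on UNIV (insert i G) Z"
      by (rule commuting_on_subset[OF comm]) (use G in blast)
    ultimately show "?f (insert i G) = - ((- 1) ^ card G * (norm (op_prod Z G (Z i h)))\<^sup>2)"
      using fin[OF G] by (simp add: op_prod_insert')
  qed
  finally show ?thesis by (simp add: defect_form_def sum_negf)
qed

lemma defect_form_cong:
  assumes "finite F" "\<And>i. i \<in> F \<Longrightarrow> Y i = Z i"
  shows "defect_form Y F h = defect_form Z F h"
  unfolding defect_form_def
proof (rule sum.cong[OF refl])
  fix G assume "G \<in> Pow F"
  then have "op_prod Y G = op_prod Z G"
    using assms finite_subset by (intro op_prod_cong) auto
  then show "(- 1) ^ card G * (norm (op_prod Y G h))\<^sup>2 = (- 1) ^ card G * (norm (op_prod Z G h))\<^sup>2"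
    by simp
qed

text \<open>Taking adjoints reverses the order of the factors, which is harmless for commuting
  operators. From here on the defect is handled through its quadratic form.\<close>

lemma szego_inv_form:
  assumes F: "finite F" and comm: "commuting_on UNIV F X" and b: "\<And>i. i \<in> F \<Longrightarrow> bounded_op (X i)"
  shows "Re (cinner (szego_inv F X h) h) = defect_form (\<lambda>i. adj UNIV (X i)) F h"
proof -
  have "cinner ((- 1) ^ card G *\<^sub>C op_prod X G (adj UNIV (op_prod X G) h)) h
      = complex_of_real ((- 1) ^ card G * (norm (op_prod (\<lambda>i. adj UNIV (X i)) G h))\<^sup>2)"
    if G: "G \<in> Pow F" for G
  proof -
    have GF: "G \<subseteq> F" using G by simp
    note fG = finite_subset[OF GF F] and cG = commuting_on_subset[OF comm GF]
    have bG: "\<And>i. i \<in> G \<Longrightarrow> bounded_op (X i)" using GF b by blast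
    note adj = cinner_op_prod[OF fG cG bG]
    have "adj UNIV (op_prod X G) h = op_prod (\<lambda>i. adj UNIV (X i)) G h"
      by (rule adj_eqI) (simp_all add: adj)
    then show ?thesis by (simp add: cinner_scaleC_left adj cinner_self)
  qed
  then have "cinner (szego_inv F X h) h = complex_of_real (defect_form (\<lambda>i. adj UNIV (X i)) F h)"
    unfolding szego_inv_def cinner_sum_left defect_form_def of_real_sum by (rule sum.cong[OF refl])
  then show ?thesis by simp
qed

lemma defect_form_tendsto_zero:
  assumes F: "finite F" "\<And>i. i \<in> F \<Longrightarrow> bounded_op (Z i)" and h: "h \<longlonglongrightarrow> 0"
  shows "(\<lambda>m. defect_form Z F (h m)) \<longlonglongrightarrow> 0"
proof -
  have "(\<lambda>m. (- 1) ^ card G * (norm (op_prod Z G (h m)))\<^sup>2) \<longlonglongrightarrow> (- 1) ^ card G * (norm (0 :: 'a))\<^sup>2"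
    if "G \<in> Pow F" for G
  proof -
    have b: "bounded_op (op_prod Z G)"
      by (rule bounded_op_op_prod) (use F that finite_subset in auto)
    show ?thesis
      using bounded_op_tendsto[OF b h] bounded_op_zero[OF b] by (intro tendsto_intros) simp
  qed
  from tendsto_sum[OF this, of "Pow F"] show ?thesis by (simp add: defect_form_def)
qed

text \<open>Positivity passes to smaller index sets because \<open>q\<^sub>F(h) \<ge> q\<^sub>F(Z\<^sub>i h) \<ge> q\<^sub>F(Z\<^sub>i\<^sup>2 h) \<ge> \<dots>\<close>, which tends
  to \<open>0\<close> by purity.\<close>

lemma defect_form_nonneg_subset:
  assumes "finite D" "finite F" "D \<inter> F = {}" "commuting_on UNIV (F \<union> D) Z"
    "\<And>i. i \<in> F \<union> D \<Longrightarrow> bounded_op (Z i)"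
    "\<And>i h. i \<in> D \<Longrightarrow> (\<lambda>m. (Z i ^^ m) h) \<longlonglongrightarrow> 0"
    "\<And>h. 0 \<le> defect_form Z (F \<union> D) h"
  shows "0 \<le> defect_form Z F h"
  using assms
proof (induction D arbitrary: h rule: finite_induct)
  case empty
  then show ?case by simp
next
  case (insert d D)
  have "0 \<le> defect_form Z (F \<union> D) h" for h
  proof -
    let ?q = "defect_form Z (F \<union> D)"
    have "0 \<le> defect_form Z (insert d (F \<union> D)) h" for h
      using insert.prems(6) by simp
    moreover have "defect_form Z (insert d (F \<union> D)) h = ?q h - ?q (Z d h)" for h
      by (rule defect_form_insert) (use insert in auto)
    ultimately have step: "?q (Z d h) \<le> ?q h" for h by simp
    have "?q ((Z d ^^ m) h) \<le> ?q h" for m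
      by (induction m) (auto intro: order_trans[OF step])
    moreover have "(\<lambda>m. ?q ((Z d ^^ m) h)) \<longlonglongrightarrow> 0"
      by (rule defect_form_tendsto_zero) (use insert in auto)
    ultimately show "0 \<le> ?q h" by (intro LIMSEQ_le_const2[of _ 0 "?q h"]) auto
  qed
  moreover have "commuting_on UNIV (F \<union> D) Z"
    by (rule commuting_on_subset[OF insert.prems(3)]) auto
  ultimately show ?case using insert.prems by (intro insert.IH) auto
qed

section \<open>Expansion of the norm along powers of a tuple\<close>

definition op_power :: "(nat \<Rightarrow> 'h \<Rightarrow> 'h) \<Rightarrow> nat set \<Rightarrow> (nat \<Rightarrow> nat) \<Rightarrow> 'h \<Rightarrow> 'h"
  where "op_power Z F k = op_prod (\<lambda>i. Z i ^^ k i) F"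

lemma funpow_commute:
  assumes "\<And>x. f (g x) = g (f x)"
  shows "(f ^^ m) ((g ^^ n) x) = (g ^^ n) ((f ^^ m) x)"
proof -
  have 1: "f ((g ^^ n) x) = (g ^^ n) (f x)" for x by (induction n) (simp_all add: assms)
  show ?thesis by (induction m) (simp_all add: 1)
qed

lemma commuting_on_funpow:
  "commuting_on UNIV F Z \<Longrightarrow> commuting_on UNIV F (\<lambda>i. Z i ^^ k i)"
  unfolding commuting_on_def by (blast intro: funpow_commute)

lemma op_power_commute:
  assumes "finite F" "\<And>i x. i \<in> F \<Longrightarrow> T (Z i x) = Z i (T x)"
  shows "T (op_power Z F k h) = op_power Z F k (T h)"
  unfolding op_power_def
proof (rule op_prod_commute[OF assms(1)])
  fix i x assume "i \<in> F"
  then show "T ((Z i ^^ k i) x) = (Z i ^^ k i) (T x)"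
    using funpow_commute[of T "Z i" 1 "k i"] assms(2) by simp
qed

lemma op_power_cong:
  "finite F \<Longrightarrow> (\<And>i. i \<in> F \<Longrightarrow> k i = l i) \<Longrightarrow> op_power Z F k = op_power Z F l"
  unfolding op_power_def by (rule op_prod_cong) auto

lemma op_power_insert:
  assumes "finite F" "i \<notin> F" "commuting_on UNIV (insert i F) Z"
  shows "op_power Z (insert i F) (k(i := m)) h = op_power Z F k ((Z i ^^ m) h)"
proof -
  have "op_power Z (insert i F) (k(i := m)) h = op_power Z F (k(i := m)) ((Z i ^^ m) h)"
    unfolding op_power_def
    by (subst op_prod_insert'[OF assms(1,2) commuting_on_funpow[OF assms(3)]]) simp
  also have "op_power Z F (k(i := m)) = op_power Z F k"
    by (rule op_power_cong[OF assms(1)]) (use assms(2) in auto)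
  finally show ?thesis .
qed

lemma op_power_raise:
  assumes J: "finite J" "i \<in> J" "commuting_on UNIV J Z"
  shows "op_power Z J (raise i k) h = op_power Z J k (Z i h)"
proof -
  have J': "J = insert i (J - {i})" "finite (J - {i})" "i \<notin> J - {i}" using J by auto
  have comm: "commuting_on UNIV (insert i (J - {i})) Z" using J(3) J'(1) by simp
  have "op_power Z (insert i (J - {i})) (k(i := Suc (k i))) h
      = op_power Z (insert i (J - {i})) (k(i := k i)) (Z i h)"
    unfolding op_power_insert[OF J'(2,3) comm] by (simp add: funpow_swap1)
  then show ?thesis using J'(1) by simp
qed

lemma bounded_op_op_power:
  "finite F \<Longrightarrow> (\<And>i. i \<in> F \<Longrightarrow> bounded_op (Z i)) \<Longrightarrow> bounded_op (op_power Z F k)"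
  unfolding op_power_def by (rule bounded_op_op_prod) (auto intro: bounded_op_funpow)

text \<open>Formally, the sum of C^k over all k inverts the product of the factors 1 - C_i.
  Variables are added one at a time: summation over the old exponents gives the difference of |Z_i^m
  h|^2 and |Z_i^(m+1) h|^2, which telescopes in m to |h|^2 by purity. All terms are nonnegative, so
  the iterated sum is a sum over the product.\<close>

theorem defect_form_has_sum:
  fixes Z :: "nat \<Rightarrow> 'h::complex_hilbert \<Rightarrow> 'h"
  assumes J: "finite J" and comm: "commuting_on UNIV J Z" and b: "\<And>i. i \<in> J \<Longrightarrow> bounded_op (Z i)"
    and pure: "\<And>i h. i \<in> J \<Longrightarrow> (\<lambda>m. (Z i ^^ m) h) \<longlonglongrightarrow> 0"
    and nonneg: "\<And>h. 0 \<le> defect_form Z J h"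
  shows "((\<lambda>k. defect_form Z J (op_power Z J k h)) has_sum (norm h)\<^sup>2) (multi_indices J)"
proof -
  \<comment> \<open>The induction meets defects of smaller index sets, while positivity is given for
    J; purity carries it down.\<close>
  have nonneg_sub: "0 \<le> defect_form Z F h" if "F \<subseteq> J" for F h
    by (rule defect_form_nonneg_subset[of "J - F"])
      (use that J comm b pure nonneg finite_subset in \<open>auto simp: Un_absorb1\<close>)
  have "((\<lambda>k. defect_form Z F (op_power Z F k h)) has_sum (norm h)\<^sup>2) (multi_indices F)"
    if "finite F" "F \<subseteq> J" for F h
    using that
  proof (induction F arbitrary: h rule: finite_induct)
    case empty
    show ?case
      using has_sum_finite[of "{\<lambda>_. undefined :: nat}" "\<lambda>_. (norm h)\<^sup>2"]
      by (simp add: multi_indices_def defect_form_empty op_power_def op_prod_empty)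
  next
    case (insert i F)
    let ?q = "defect_form Z F" and ?q' = "defect_form Z (insert i F)" and ?M = "multi_indices F"
    have commF: "commuting_on UNIV (insert i F) Z"
      by (rule commuting_on_subset[OF comm insert.prems])
    define G where "G = (\<lambda>(m, k). ?q' (op_power Z F k ((Z i ^^ m) h)))"
    have inner: "((\<lambda>k. G (m, k)) has_sum ((norm ((Z i ^^ m) h))\<^sup>2 - (norm ((Z i ^^ Suc m) h))\<^sup>2)) ?M" for m
    proof -
      have IH: "((\<lambda>k. ?q (op_power Z F k g)) has_sum (norm g)\<^sup>2) ?M" for g
        using insert by blast
      have "Z i (op_power Z F k g) = op_power Z F k (Z i g)" for k g
        by (rule op_power_commute[OF insert.hyps(1)], rule commuting_onD[OF commF]) auto
      then have "G (m, k) = ?q (op_power Z F k ((Z i ^^ m) h)) + - ?q (op_power Z F k ((Z i ^^ Suc m) h))" for k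
        by (simp add: G_def defect_form_insert[OF insert.hyps commF])
      moreover have "((\<lambda>k. ?q (op_power Z F k ((Z i ^^ m) h)) + - ?q (op_power Z F k ((Z i ^^ Suc m) h)))
          has_sum ((norm ((Z i ^^ m) h))\<^sup>2 + - (norm ((Z i ^^ Suc m) h))\<^sup>2)) ?M"
        by (intro has_sum_add IH) (simp only: has_sum_uminus minus_minus IH)
      ultimately show ?thesis by simp
    qed
    have G0: "0 \<le> G (m, k)" for m k
      using nonneg_sub[OF insert.prems] by (simp add: G_def)
    have outer: "((\<lambda>m. (norm ((Z i ^^ m) h))\<^sup>2 - (norm ((Z i ^^ Suc m) h))\<^sup>2) has_sum (norm h)\<^sup>2) UNIV"
    proof -
      have "(\<lambda>m. (norm ((Z i ^^ m) h))\<^sup>2) \<longlonglongrightarrow> (norm (0::'h))\<^sup>2"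
        by (intro tendsto_intros pure) (use insert.prems in simp)
      from telescope_sums'[OF this]
      have s: "(\<lambda>m. (norm ((Z i ^^ m) h))\<^sup>2 - (norm ((Z i ^^ Suc m) h))\<^sup>2) sums (norm h)\<^sup>2" by simp
      moreover have "0 \<le> (norm ((Z i ^^ m) h))\<^sup>2 - (norm ((Z i ^^ Suc m) h))\<^sup>2" for m
        by (rule has_sum_nonneg[OF inner]) (rule G0)
      ultimately show ?thesis
        by (intro norm_summable_imp_has_sum) (simp_all add: sums_iff del: funpow.simps)
    qed
    have "(G has_sum (norm h)\<^sup>2) (UNIV \<times> ?M)"
    proof (rule has_sum_SigmaI[OF inner outer])
      show "G summable_on UNIV \<times> ?M"
        by (rule summable_on_SigmaI[OF inner has_sum_imp_summable[OF outer] G0])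
    qed
    moreover have "G = (\<lambda>x. ?q' (op_power Z (insert i F) ((\<lambda>(m, k). k(i := m)) x) h))"
      by (rule ext) (simp add: G_def op_power_insert[OF insert.hyps commF] split: prod.split)
    ultimately show ?case
      by (simp only: has_sum_reindex_bij_betw[OF multi_indices_insert[OF insert.hyps(2)],
          of "\<lambda>k. ?q' (op_power Z (insert i F) k h)"])
  qed
  with J show ?thesis by blast
qed

section \<open>The dilation\<close>

locale szego_pair =
  fixes X :: "nat \<Rightarrow> 'h::complex_hilbert \<Rightarrow> 'h" and n p q :: nat
  assumes pq: "p \<in> {1..n}" "q \<in> {1..n}" "p \<noteq> q"
    and X_class: "X_class n p q X" and pure: "pure_tuple {1..n} X" and rank: "finite_rank n p q X"
begin

definition J :: "nat set" where "J = {1..n} - {q}"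

abbreviation Z :: "nat \<Rightarrow> 'h \<Rightarrow> 'h" where "Z \<equiv> \<lambda>i. adj UNIV (X i)"

text \<open>The adjoints of the tuple in which the product of \<open>X p\<close> and
  \<open>X q\<close> stands at label p; the label q is absent from \<open>J\<close>.\<close>

definition Zpq :: "nat \<Rightarrow> 'h \<Rightarrow> 'h" where "Zpq i = (if i = p then (\<lambda>h. Z p (Z q h)) else Z i)"

definition R :: "nat \<Rightarrow> 'h \<Rightarrow> 'h" where "R r = op_sqrt (szego_inv ({1..n} - {r}) X)"

text \<open>The direct sum of two copies of the space is encoded by sequences supported on the
  indices 0 and 1. Since |A h|^2 is the defect form of \<open>Zpq\<close>, \<open>A\<close> plays
  the part of the square root of that defect.\<close>

definition A :: "'h \<Rightarrow> (nat, 'h) ell2" where "A h = single 0 (R q h) + single 1 (R p (Z p h))"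

definition B :: "'h \<Rightarrow> (nat, 'h) ell2" where "B h = single 0 (R q (Z q h)) + single 1 (R p h)"

definition P :: "(nat, 'h) ell2 \<Rightarrow> (nat, 'h) ell2" where "P f = single 0 (ell2_nth f 0)"

text \<open>On sequences supported on 0 and 1 this is the projection to the second
  component.\<close>

definition P' :: "(nat, 'h) ell2 \<Rightarrow> (nat, 'h) ell2" where "P' f = f - P f"

lemma contraction_X: "i \<in> {1..n} \<Longrightarrow> contraction UNIV (X i)"
  using X_class by (simp add: X_class_def commuting_contractions_def)

lemma bounded_X: "i \<in> {1..n} \<Longrightarrow> bounded_op (X i)"
  by (rule contraction_bounded_op[OF contraction_X])

lemma bounded_Z: "i \<in> {1..n} \<Longrightarrow> bounded_op (Z i)"
  by (rule bounded_op_adj[OF bounded_X])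

lemma commuting_X: "commuting_on UNIV {1..n} X"
  using X_class by (simp add: X_class_def commuting_contractions_def)

lemma commuting_Z: "commuting_on UNIV {1..n} Z"
  by (rule commuting_on_adj[OF commuting_X bounded_X])

lemma pure_Z: "i \<in> {1..n} \<Longrightarrow> (\<lambda>m. (Z i ^^ m) h) \<longlonglongrightarrow> 0"
  using pure by (simp add: pure_tuple_def pure_contraction_def)

lemma norm_Z_le: "i \<in> {1..n} \<Longrightarrow> norm (Z i h) \<le> norm h"
  by (rule norm_adj_contraction_le[OF contraction_X])

lemma positive_szego_inv: "r \<in> {p, q} \<Longrightarrow> positive_op UNIV (szego_inv ({1..n} - {r}) X)"
  using X_class by (auto simp: X_class_def szego_class_def)

lemma bounded_R: "r \<in> {p, q} \<Longrightarrow> bounded_op (R r)"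
  unfolding R_def by (intro positive_op_bounded_op op_sqrt(1) positive_szego_inv)

lemma norm_R:
  assumes "r \<in> {p, q}"
  shows "(norm (R r h))\<^sup>2 = defect_form Z ({1..n} - {r}) h"
  unfolding R_def norm_op_sqrt_squared[OF positive_szego_inv[OF assms]]
  by (rule szego_inv_form) (auto intro: commuting_on_subset[OF commuting_X] bounded_X)

lemma J_eq: "J = insert p ({1..n} - {p, q})"
  using pq by (auto simp: J_def)

lemma J: "finite J" "p \<in> J" "i \<in> J \<Longrightarrow> i \<in> {1..n}" "i \<in> J \<Longrightarrow> i \<noteq> q"
  using pq by (auto simp: J_def)

lemma Zp_Zq: "Z p (Z q h) = Z q (Z p h)"
  by (rule commuting_onD[OF commuting_Z pq(1,2)])

lemma Z_Zpq: "i \<in> {1..n} \<Longrightarrow> j \<in> J \<Longrightarrow> Z i (Zpq j h) = Zpq j (Z i h)"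
proof -
  assume i: "i \<in> {1..n}" and j: "j \<in> J"
  note comm = commuting_onD[OF commuting_Z i]
  show ?thesis
    using comm[OF J(3)[OF j]] comm[OF pq(1)] comm[OF pq(2)] by (simp only: Zpq_def split: if_split) simp
qed

lemma commuting_Zpq: "commuting_on UNIV J Zpq"
  unfolding commuting_on_def
proof (intro ballI)
  fix i j h assume ij: "i \<in> J" "j \<in> J"
  show "Zpq i (Zpq j h) = Zpq j (Zpq i h)"
  proof (cases "i = p")
    case True
    then have "Zpq i g = Z p (Z q g)" for g by (simp add: Zpq_def)
    then show ?thesis using Z_Zpq[OF pq(1) ij(2)] Z_Zpq[OF pq(2) ij(2)] by simp
  next
    case False
    then have "Zpq i g = Z i g" for g by (simp add: Zpq_def)
    then show ?thesis using Z_Zpq[OF J(3)[OF ij(1)] ij(2)] by simp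
  qed
qed

lemma bounded_Zpq:
  assumes "i \<in> J"
  shows "bounded_op (Zpq i)"
  using bounded_op_comp[OF bounded_Z[OF pq(1)] bounded_Z[OF pq(2)]] bounded_Z[of i] J(3)[OF assms]
  by (cases "i = p") (simp_all add: Zpq_def[abs_def])

lemma pure_Zpq:
  assumes i: "i \<in> J"
  shows "(\<lambda>m. (Zpq i ^^ m) h) \<longlonglongrightarrow> 0"
proof (cases "i = p")
  case True
  \<comment> \<open>Powers of the product split, so the decay is supplied by \<open>Z p\<close>
    while \<open>Z q\<close> contributes contractions.\<close>
  have eq: "(Zpq p ^^ m) h = (Z q ^^ m) ((Z p ^^ m) h)" for m
  proof (induction m)
    case (Suc m)
    have "Z p ((Z q ^^ m) g) = (Z q ^^ m) (Z p g)" for g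
      using funpow_commute[of "Z p" "Z q" 1 m g] Zp_Zq by simp
    note comm = this
    have "(Zpq p ^^ Suc m) h = Zpq p ((Z q ^^ m) ((Z p ^^ m) h))"
      by (simp only: funpow.simps o_apply Suc)
    also have "\<dots> = Z q (Z p ((Z q ^^ m) ((Z p ^^ m) h)))" by (simp add: Zpq_def Zp_Zq)
    finally show ?case by (simp only: comm funpow.simps o_apply)
  qed simp
  have "norm ((Z q ^^ m) g) \<le> norm g" for m g
    by (induction m) (auto intro: order_trans[OF norm_Z_le] pq)
  then have "norm ((Zpq i ^^ m) h) \<le> norm ((Z p ^^ m) h)" for m by (simp add: True eq)
  then show ?thesis
    by (intro Lim_null_comparison[OF always_eventually tendsto_norm_zero[OF pure_Z[OF pq(1)]]]) blast
next
  case False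
  then show ?thesis using pure_Z[OF J(3)[OF i]] by (simp add: Zpq_def)
qed

text \<open>\<open>1 - C\<^sub>p C\<^sub>q = (1 - C\<^sub>p) + C\<^sub>p (1 - C\<^sub>q) = (1 - C\<^sub>q) + C\<^sub>q (1 - C\<^sub>p)\<close>.\<close>

lemma defect_form_Zpq:
  "defect_form Zpq J h = (norm (R q h))\<^sup>2 + (norm (R p (Z p h)))\<^sup>2"
  "defect_form Zpq J h = (norm (R p h))\<^sup>2 + (norm (R q (Z q h)))\<^sup>2"
proof -
  let ?F = "{1..n} - {p, q}"
  let ?d = "defect_form Z ?F"
  have Jp: "{1..n} - {p} = insert q ?F" using pq by auto
  have "defect_form Zpq J h = defect_form Zpq ?F h - defect_form Zpq ?F (Zpq p h)"
    unfolding J_eq by (rule defect_form_insert[OF _ _ commuting_Zpq[unfolded J_eq]]) auto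
  also have "\<dots> = ?d h - ?d (Z p (Z q h))"
  proof -
    have "defect_form Zpq ?F g = ?d g" for g
      by (rule defect_form_cong) (auto simp: Zpq_def)
    then show ?thesis by (simp only: Zpq_def[of p] if_True simp_thms)
  qed
  finally have d: "defect_form Zpq J h = ?d h - ?d (Z p (Z q h))" .
  have Rq: "(norm (R q g))\<^sup>2 = ?d g - ?d (Z p g)" for g
  proof -
    have "(norm (R q g))\<^sup>2 = defect_form Z (insert p ?F) g"
      using norm_R[of q g] unfolding J_def[symmetric] J_eq[symmetric] by blast
    moreover have "commuting_on UNIV (insert p ?F) Z"
      by (rule commuting_on_subset[OF commuting_Z]) (use pq in blast)
    then have "defect_form Z (insert p ?F) g = ?d g - ?d (Z p g)"
      by (intro defect_form_insert) auto
    ultimately show ?thesis by simp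
  qed
  have Rp: "(norm (R p g))\<^sup>2 = ?d g - ?d (Z q g)" for g
  proof -
    have "(norm (R p g))\<^sup>2 = defect_form Z (insert q ?F) g"
      using norm_R[of p g] unfolding Jp by blast
    moreover have "commuting_on UNIV (insert q ?F) Z"
      by (rule commuting_on_subset[OF commuting_Z]) (use pq in blast)
    then have "defect_form Z (insert q ?F) g = ?d g - ?d (Z q g)"
      by (intro defect_form_insert) auto
    ultimately show ?thesis by simp
  qed
  show "defect_form Zpq J h = (norm (R q h))\<^sup>2 + (norm (R p (Z p h)))\<^sup>2"
    unfolding d Rq Rp Zp_Zq by simp
  show "defect_form Zpq J h = (norm (R p h))\<^sup>2 + (norm (R q (Z q h)))\<^sup>2"
    unfolding d Rq Rp Zp_Zq by simp
qed

lemma norm_pair: "(norm (single 0 x + single (1 :: nat) y))\<^sup>2 = (norm x)\<^sup>2 + (norm y)\<^sup>2"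
  by (simp add: norm_add_squared norm_single cinner_single single.rep_eq)

lemma norm_A: "(norm (A h))\<^sup>2 = defect_form Zpq J h"
  by (simp only: A_def norm_pair defect_form_Zpq(1))

lemma norm_A_B: "norm (A h) = norm (B h)"
proof -
  have "(norm (A h))\<^sup>2 = (norm (B h))\<^sup>2"
    unfolding norm_A B_def norm_pair defect_form_Zpq(2) by simp
  then show ?thesis by simp
qed

lemma bounded_A: "bounded_op A" and bounded_B: "bounded_op B"
  unfolding A_def[abs_def] B_def[abs_def] using pq
  by (auto intro!: bounded_op_plus bounded_op_comp[OF bounded_op_single]
      bounded_op_comp[OF bounded_R] bounded_R bounded_Z)

lemma bounded_P: "bounded_op P" and bounded_P': "bounded_op P'"
  unfolding P'_def[abs_def] P_def[abs_def]
  by (intro bounded_op_minus bounded_op_id bounded_op_comp[OF bounded_op_single] bounded_op_nth)+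

lemma P_P: "P (P f) = P f" "P' (P' f) = P' f" "P (P' f) = 0" "P' (P f) = 0"
proof -
  show 1: "P (P f) = P f" by (simp add: P_def single.rep_eq)
  then show 2: "P (P' f) = 0" by (simp add: P'_def bounded_op_diff[OF bounded_P])
  show "P' (P' f) = P' f" using 2 by (simp add: P'_def[of "P' f"])
  show "P' (P f) = 0" by (simp add: P'_def 1)
qed

lemma P_plus_P': "P f + P' f = f"
  by (simp add: P'_def)

lemma cinner_P: "cinner (P f) g = cinner f (P g)" "cinner (P' f) g = cinner f (P' g)"
proof -
  have "cinner (P f) g = cnj (cinner g (single 0 (ell2_nth f 0)))"
    unfolding P_def by (rule cinner_commute)
  also have "\<dots> = cinner (ell2_nth f 0) (ell2_nth g 0)"
    by (simp add: cinner_single cinner_commute[symmetric])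
  finally show "cinner (P f) g = cinner f (P g)" by (simp add: P_def cinner_single)
  then show "cinner (P' f) g = cinner f (P' g)"
    by (simp add: P'_def cinner_diff_left cinner_diff_right)
qed

lemma projection_P: "projection_op P" "projection_op P'"
  by (simp_all add: projection_op_def bounded_P bounded_P' P_P cinner_P)

lemma P_pair:
  "P (single 0 x + single 1 y) = single 0 x" "P' (single 0 x + single 1 y) = single 1 y"
proof -
  show "P (single 0 x + single 1 y) = single 0 x"
    by (simp add: P_def plus_ell2.rep_eq single.rep_eq)
  then show "P' (single 0 x + single 1 y) = single 1 y" by (simp add: P'_def)
qed

text \<open>With B = U A this is already the coefficient relation for the adjoint of multiplication
  by \<open>\<Phi>q\<close>: P U A + P' U A Z_p Z_q = A Z_q. In the same way \<open>B_Zp\<close>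
  yields the relation for \<open>\<Phi>p\<close> after applying \<open>U'\<close>.\<close>

lemma A_Zq: "A (Z q h) = P (B h) + P' (B (Z p (Z q h)))"
  by (simp only: A_def B_def P_pair)

lemma B_Zp: "B (Z p h) = P (A (Z p (Z q h))) + P' (A h)"
  by (simp only: A_def B_def P_pair Zp_Zq)

text \<open>Finite rank enters here. The space is spanned by a spanning set of each defect space,
  embedded at index 0 or 1; \<open>P\<close> preserves it because each generator is either fixed or
  annihilated.\<close>

lemma fin_dim_range:
  obtains E0 :: "(nat, 'h) ell2 set"
  where "fin_dim E0" "\<And>h. A h \<in> E0" "\<And>h. B h \<in> E0" "\<And>f. f \<in> E0 \<Longrightarrow> P f \<in> E0"
proof -
  have R_span: "\<exists>F. finite F \<and> (\<forall>h. R r h \<in> complex_vector.span F)" if "r \<in> {p, q}" for r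
  proof -
    have "fin_dim (closure (range (R r)))"
      using rank that by (simp add: finite_rank_def defect_space_def R_def) blast
    then obtain F where F: "finite F" "closure (range (R r)) = complex_vector.span F"
      by (auto simp: fin_dim_def)
    have "R r h \<in> complex_vector.span F" for h
      unfolding F(2)[symmetric] by (rule subsetD[OF closure_subset rangeI])
    with F(1) show ?thesis by blast
  qed
  from R_span[of q] R_span[of p] obtain Fq Fp where F: "finite Fq" "finite Fp"
    "\<And>h. R q h \<in> complex_vector.span Fq" "\<And>h. R p h \<in> complex_vector.span Fp"
    by auto
  define G where "G = single (0::nat) ` Fq \<union> single 1 ` Fp"
  let ?E = "complex_vector.span G"
  note subE = complex_vector.subspace_span[of G]
  have preimage: "complex_vector.subspace (T -` ?E)"
    if T: "bounded_op (T :: 'c::complex_hilbert \<Rightarrow> (nat, 'h) ell2)" for T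
    using complex_vector.subspace_0[OF subE] complex_vector.subspace_add[OF subE]
      complex_vector.subspace_scale[OF subE]
    by (auto simp: complex_vector.subspace_def bounded_op_zero[OF T] bounded_op_add[OF T]
        bounded_op_scaleC[OF T])
  have s0: "single 0 x \<in> ?E" if "x \<in> complex_vector.span Fq" for x
  proof -
    have "single 0 ` Fq \<subseteq> ?E"
      by (rule order_trans[OF _ complex_vector.span_superset]) (simp add: G_def)
    then have "complex_vector.span Fq \<subseteq> single 0 -` ?E"
      by (intro complex_vector.span_minimal preimage bounded_op_single) blast
    then show ?thesis using that by auto
  qed
  have s1: "single 1 x \<in> ?E" if "x \<in> complex_vector.span Fp" for x
  proof -
    have "single 1 ` Fp \<subseteq> ?E"
      by (rule order_trans[OF _ complex_vector.span_superset]) (simp add: G_def)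
    then have "complex_vector.span Fp \<subseteq> single 1 -` ?E"
      by (intro complex_vector.span_minimal preimage bounded_op_single) blast
    then show ?thesis using that by auto
  qed
  have "?E \<subseteq> P -` ?E"
  proof (rule complex_vector.span_minimal[OF _ preimage[OF bounded_P]])
    show "G \<subseteq> P -` ?E"
    proof
      fix f assume f: "f \<in> G"
      then have "P f = f \<or> P f = 0"
        by (auto simp: G_def P_def single.rep_eq bounded_op_zero[OF bounded_op_single])
      then show "f \<in> P -` ?E"
        using complex_vector.span_base[OF f] complex_vector.span_zero by auto
    qed
  qed
  then have "\<And>f. f \<in> ?E \<Longrightarrow> P f \<in> ?E" by blast
  moreover have "finite G" using F(1,2) by (simp add: G_def)
  then have "fin_dim ?E" unfolding fin_dim_def by blast
  moreover have "\<And>h. A h \<in> ?E" "\<And>h. B h \<in> ?E"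
    unfolding A_def B_def by (intro complex_vector.span_add s0 s1 F)+
  ultimately show thesis using that by blast
qed

end

text \<open>Multiplication by z_i is the pencil with constant term 0 and linear coefficient 1. Its
  constant term is pure since all powers of 0 but the zeroth vanish.\<close>

lemma inner_pencil_coordinate:
  assumes "finite J" "i \<in> J" "hilbert_subspace E"
  shows "inner_pencil J i E (\<lambda>x. 0) (\<lambda>x. x) (\<lambda>x. 0) (\<lambda>x. x)"
proof
  show "(\<lambda>m. ((\<lambda>x. 0 :: 'a) ^^ m) x) \<longlonglongrightarrow> 0" for x :: 'a
  proof (rule tendsto_eventually)
    have "((\<lambda>x. 0 :: 'a) ^^ Suc m) x = 0" for m by simp
    then show "\<forall>\<^sub>F m in sequentially. ((\<lambda>x. 0 :: 'a) ^^ m) x = 0"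
      unfolding eventually_sequentially by (metis Suc_le_D)
  qed
qed (use assms in \<open>auto simp: bounded_op_id bounded_op_const_zero hilbert_subspace_def complex_vector.subspace_0\<close>)

section \<open>The coefficient space without the unitary parts\<close>

locale szego_pair_unitary = szego_pair X n p q
  for X :: "nat \<Rightarrow> 'h::complex_hilbert \<Rightarrow> 'h" and n p q :: nat +
  fixes E0 :: "(nat, 'h) ell2 set" and U U' :: "(nat, 'h) ell2 \<Rightarrow> (nat, 'h) ell2"
  assumes E0: "fin_dim E0" and A_E0: "\<And>h. A h \<in> E0" and P_E0: "\<And>f. f \<in> E0 \<Longrightarrow> P f \<in> E0"
    and U: "unitary_pair E0 U U'" and UA: "\<And>h. U (A h) = B h"
begin

text \<open>Orthogonality to the first fixed part makes multiplication by \<open>\<Phi>q\<close>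
  pure, orthogonality to the second does so for \<open>\<Phi>p\<close>.\<close>

definition E :: "(nat, 'h) ell2 set"
  where "E = E0 \<inter> orth_compl (fixed_part E0 U P) \<inter> orth_compl (fixed_part E0 U' P')"

lemma U': "unitary_pair E0 U' U"
  by (rule unitary_pair_sym[OF U])

lemma bounded_U: "bounded_op U" "bounded_op U'"
  using U by (auto simp: unitary_pair_def)

lemma cinner_U: "cinner (U f) g = cinner f (U' g)" "cinner (U' f) g = cinner f (U g)"
  using U U' by (auto simp: unitary_pair_def)

lemma subspace_E0: "complex_vector.subspace E0"
  using E0 complex_vector.subspace_span by (auto simp: fin_dim_def)

lemma subspace_E: "complex_vector.subspace E"
  unfolding E_def by (intro complex_vector.subspace_inter subspace_E0 subspace_orth_compl)

lemma hilbert_E: "hilbert_subspace E"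
  by (rule fin_dim_hilbert_subspace(1)[OF E0 subspace_E]) (auto simp: E_def)

lemma P'_E0: "f \<in> E0 \<Longrightarrow> P' f \<in> E0"
  unfolding P'_def by (intro complex_vector.subspace_diff[OF subspace_E0] P_E0)

text \<open>The complement of the fixed part of \<open>U\<close>, \<open>P\<close> is invariant
  under \<open>P\<close>, that of the fixed part of \<open>U'\<close>, \<open>P'\<close> under
  \<open>P'\<close>. As P + P' = 1, each is invariant under both projections, so \<open>E\<close>
  reduces everything.\<close>

lemma E_invariant:
  assumes f: "f \<in> E"
  shows "U f \<in> E" "U' f \<in> E" "P f \<in> E" "P' f \<in> E"
proof -
  let ?S = "orth_compl (fixed_part E0 U P)" and ?S' = "orth_compl (fixed_part E0 U' P')"
  have f1: "f \<in> E0 \<inter> ?S" and f2: "f \<in> E0 \<inter> ?S'" using f by (auto simp: E_def)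
  note c1 = fixed_part_compl[OF E0 U projection_P(1) P_E0 f1]
  note c2 = fixed_part_compl[OF E0 U' projection_P(2) P'_E0 f2]
  have fS: "f \<in> ?S" "f \<in> ?S'" using f1 f2 by auto
  have PS: "P f \<in> ?S" "P' f \<in> ?S'" using c1(3) c2(3) by auto
  have "P' f \<in> ?S"
    unfolding P'_def by (rule complex_vector.subspace_diff[OF subspace_orth_compl fS(1) PS(1)])
  moreover have "P f \<in> ?S'"
    using complex_vector.subspace_diff[OF subspace_orth_compl fS(2) PS(2)] by (simp add: P'_def)
  ultimately show "U f \<in> E" "U' f \<in> E" "P f \<in> E" "P' f \<in> E"
    using c1 c2 by (auto simp: E_def)
qed

lemma U_U': "f \<in> E \<Longrightarrow> U (U' f) = f" "f \<in> E \<Longrightarrow> U' (U f) = f"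
  using U by (auto simp: E_def unitary_pair_def)

lemma U'B: "U' (B h) = A h"
  using U A_E0 UA by (metis unitary_pair_def)

text \<open>Purity of the given contractions makes the dilation space avoid the unitary parts of \<open>U P\<close> and
  \<open>U' P'\<close>: pairing with a vector of such a part is invariant when the contraction is applied on one
  side and the unitary on the other.\<close>

lemma orth_fixed_part:
  assumes V: "unitary_pair E0 V V'" and Q: "projection_op Q" and QE: "\<And>f. f \<in> E0 \<Longrightarrow> Q f \<in> E0"
    and T: "\<And>h. (\<lambda>m. (T ^^ m) h) \<longlonglongrightarrow> 0"
    and inv: "\<And>h v. v \<in> fixed_part E0 V Q \<Longrightarrow> cinner (A h) v = cinner (A (T h)) (V v)"
  shows "A h \<in> orth_compl (fixed_part E0 V Q)"
  unfolding orth_compl_def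
proof (intro CollectI ballI)
  fix v assume v: "v \<in> fixed_part E0 V Q"
  have Vv: "(V ^^ m) v \<in> fixed_part E0 V Q" for m
    by (induction m) (auto intro: v fixed_part_V[OF E0 V Q QE])
  have "norm ((V ^^ m) v) = norm v" for m
  proof (induction m)
    case (Suc m)
    have "(V ^^ m) v \<in> E0" using Vv[of m] by (auto simp: fixed_part_def)
    then show ?case using unitary_norm[OF E0 V Q QE] Suc by simp
  qed simp
  moreover have "cinner (A h) v = cinner (A ((T ^^ m) h)) ((V ^^ m) v)" for m
    by (induction m) (auto simp: inv[OF Vv])
  ultimately have "norm (cinner (A h) v) \<le> norm (A ((T ^^ m) h)) * norm v" for m
    by (metis norm_cinner_le)
  moreover have "(\<lambda>m. norm (A ((T ^^ m) h)) * norm v) \<longlonglongrightarrow> norm (A 0) * norm v"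
    by (intro tendsto_intros bounded_op_tendsto[OF bounded_A] T)
  ultimately have "norm (cinner (A h) v) \<le> norm (A 0) * norm v"
    by (intro LIMSEQ_le_const) auto
  then show "cinner (A h) v = 0" by (simp add: bounded_op_zero[OF bounded_A])
qed

text \<open>Purity of the q-th contraction handles the fixed part of \<open>U\<close>,
  \<open>P\<close>, and purity of the p-th one that of \<open>U'\<close>, \<open>P'\<close>.\<close>

lemma A_in: "A h \<in> E"
proof -
  have "A h \<in> orth_compl (fixed_part E0 U P)"
  proof (rule orth_fixed_part[OF U projection_P(1) P_E0 pure_Z[OF pq(2)]])
    fix h v assume v: "v \<in> fixed_part E0 U P"
    have Uv: "U v \<in> fixed_part E0 U P" by (rule fixed_part_V[OF E0 U projection_P(1) P_E0 v])
    have PU: "P (U v) = U v" by (rule fixed_part_Q[OF E0 U projection_P(1) P_E0 Uv])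
    then have P'U: "P' (U v) = 0" by (simp add: P'_def)
    \<comment> \<open>In the expansion \<open>A_Zq\<close> the summand under \<open>P'\<close> drops
      out because \<open>P'\<close> annihilates \<open>U v\<close>.\<close>
    have "cinner (A (Z q h)) (U v) = cinner (U (A h)) (P (U v))"
      by (simp add: A_Zq cinner_add_left cinner_P UA P'U PU)
    also have "\<dots> = cinner (A h) v"
      using v U by (simp add: PU cinner_U fixed_part_def unitary_pair_def)
    finally show "cinner (A h) v = cinner (A (Z q h)) (U v)" by simp
  qed
  moreover have "A h \<in> orth_compl (fixed_part E0 U' P')"
  proof (rule orth_fixed_part[OF U' projection_P(2) P'_E0 pure_Z[OF pq(1)]])
    fix h v assume v: "v \<in> fixed_part E0 U' P'"
    have P'v: "P' v = v" by (rule fixed_part_Q[OF E0 U' projection_P(2) P'_E0 v])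
    then have Pv: "P v = 0" by (simp add: P'_def)
    have "cinner (A (Z p h)) (U' v) = cinner (B (Z p h)) v"
      by (simp add: cinner_U(1)[symmetric] UA)
    also have "\<dots> = cinner (A h) v"
      by (simp add: B_Zp cinner_add_left cinner_P Pv P'v)
    finally show "cinner (A h) v = cinner (A (Z p h)) (U' v)" by simp
  qed
  ultimately show ?thesis using A_E0 by (simp add: E_def)
qed

lemma pencil_q: "inner_pencil J p E (\<lambda>x. U' (P x)) (\<lambda>x. U' (P' x)) (\<lambda>x. P (U x)) (\<lambda>x. P' (U x))"
proof
  fix x assume x: "x \<in> E"
  \<comment> \<open>The adjoint of the constant term is P U, whereas the decay is known for U P; the
    two are linked by (P U)^(m+1) = P (U P)^m U.\<close>
  have "(\<lambda>m. P (((\<lambda>y. U (P y)) ^^ m) (U x))) \<longlonglongrightarrow> P 0"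
    using E_invariant(1)[OF x]
    by (intro bounded_op_tendsto[OF bounded_P] fixed_part_compl_pure[OF E0 U projection_P(1) P_E0])
      (auto simp: E_def)
  moreover have "P (((\<lambda>y. U (P y)) ^^ m) (U x)) = ((\<lambda>x. P (U x)) ^^ Suc m) x" for m
    by (induction m) auto
  ultimately have "(\<lambda>m. ((\<lambda>x. P (U x)) ^^ Suc m) x) \<longlonglongrightarrow> 0"
    by (simp only: bounded_op_zero[OF bounded_P])
  then show "(\<lambda>m. ((\<lambda>x. P (U x)) ^^ m) x) \<longlonglongrightarrow> 0" by (rule LIMSEQ_imp_Suc)
  show "P (U (U' (P x))) + P' (U (U' (P' x))) = x"
    "P (U (U' (P' x))) = 0" "P' (U (U' (P x))) = 0"
    by (simp_all add: U_U' E_invariant x P_P P_plus_P')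
qed (use J hilbert_E E_invariant in
  \<open>auto simp: cinner_P cinner_U intro: bounded_op_comp bounded_P bounded_P' bounded_U\<close>)

lemma pencil_p: "inner_pencil J p E (\<lambda>x. P' (U x)) (\<lambda>x. P (U x)) (\<lambda>x. U' (P' x)) (\<lambda>x. U' (P x))"
proof
  fix x assume x: "x \<in> E"
  show "(\<lambda>m. ((\<lambda>x. U' (P' x)) ^^ m) x) \<longlonglongrightarrow> 0"
    by (rule fixed_part_compl_pure[OF E0 U' projection_P(2) P'_E0]) (use x in \<open>auto simp: E_def\<close>)
  have "U' (P' (U x)) + U' (P (U x)) = U' (P (U x) + P' (U x))"
    by (simp add: bounded_op_add[OF bounded_U(2)])
  then show "U' (P' (P' (U x))) + U' (P (P (U x))) = x"
    by (simp add: P_P P_plus_P' U_U' x)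
  show "U' (P' (P (U x))) = 0" "U' (P (P' (U x))) = 0"
    by (simp_all add: P_P bounded_op_zero[OF bounded_U(2)])
qed (use J hilbert_E E_invariant in
  \<open>auto simp: cinner_P cinner_U intro: bounded_op_comp bounded_P bounded_P' bounded_U\<close>)

section \<open>The isometry into the Hardy space\<close>

definition W :: "'h \<Rightarrow> (nat \<Rightarrow> nat, (nat, 'h) ell2) ell2"
  where "W h = Abs_ell2 (\<lambda>k. if k \<in> multi_indices J then A (op_power Zpq J k h) else 0)"

text \<open>The norm expansion of the product tuple, rewritten with |A g|^2 for its defect form; it
  makes \<open>W\<close> well defined and isometric at once.\<close>

lemma W_has_sum: "((\<lambda>k. (norm (A (op_power Zpq J k h)))\<^sup>2) has_sum (norm h)\<^sup>2) (multi_indices J)"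
proof -
  have "0 \<le> defect_form Zpq J h" for h using norm_A[of h] by (metis zero_le_power2)
  from defect_form_has_sum[OF J(1) commuting_Zpq bounded_Zpq pure_Zpq this]
  show ?thesis by (simp add: norm_A)
qed

lemma W_has_sum_UNIV:
  "((\<lambda>k. (norm (if k \<in> multi_indices J then A (op_power Zpq J k h) else 0))\<^sup>2) has_sum (norm h)\<^sup>2) UNIV"
  using W_has_sum[of h] by (rule has_sum_cong_neutral[THEN iffD1, rotated 3]) auto

lemma W_nth: "ell2_nth (W h) k = (if k \<in> multi_indices J then A (op_power Zpq J k h) else 0)"
  unfolding W_def
  using has_sum_imp_summable[OF W_has_sum_UNIV[of h]] by (subst Abs_ell2_inverse) auto

lemma norm_W: "norm (W h) = norm h"
  using infsumI[OF W_has_sum_UNIV[of h]] by (simp add: norm_ell2.rep_eq W_nth)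

lemma bounded_op_power: "bounded_op (op_power Zpq J k)"
  by (rule bounded_op_op_power[OF J(1) bounded_Zpq])

lemma W_in: "W h \<in> hardy J E"
  by (simp add: hardy_def W_nth A_in)

lemma isometry_W: "isometry UNIV (hardy J E) W"
proof -
  have "bounded_op W"
  proof (rule bounded_opI[where C = 1])
    show "W (x + y) = W x + W y" for x y
      by (rule ell2_eqI) (simp add: W_nth plus_ell2.rep_eq bounded_op_add[OF bounded_A]
          bounded_op_add[OF bounded_op_power])
    show "W (c *\<^sub>C x) = c *\<^sub>C W x" for c x
      by (rule ell2_eqI) (simp add: W_nth scaleC_ell2.rep_eq bounded_op_scaleC[OF bounded_A]
          bounded_op_scaleC[OF bounded_op_power])
  qed (simp add: norm_W)
  then have "W \<in> bounded_ops UNIV (hardy J E)" by (rule bounded_op_on) (rule W_in)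
  then show ?thesis by (simp add: isometry_def norm_W)
qed

lemma op_power_Z: "i \<in> {1..n} \<Longrightarrow> Z i (op_power Zpq J k h) = op_power Zpq J k (Z i h)"
  by (rule op_power_commute[OF J(1)]) (rule Z_Zpq)

text \<open>The adjoint multiplication combines the coefficients at k and \<open>raise i k\<close>,
  and raising k means one more application of \<open>Zpq i\<close>. All these operators commute with
  \<open>Z j\<close>, so the intertwining relation follows from \<open>rel\<close> at the vectors
  \<open>op_power Zpq J k h\<close>.\<close>

lemma W_intertwines:
  assumes pencil: "inner_pencil J i E C D C' D'" and i: "i \<in> J" and j: "j \<in> {1..n}"
    and rel: "\<And>h. C' (A h) + D' (A (Zpq i h)) = A (Z j h)"
  shows "W (Z j h) = adj (hardy J E) (mult_op J E (inner_pencil.symbol i C D)) (W h)"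
proof -
  interpret inner_pencil J i E C D C' D' by (rule pencil)
  have "mult' (W h) = W (Z j h)"
  proof (rule ell2_eqI)
    fix k
    show "ell2_nth (mult' (W h)) k = ell2_nth (W (Z j h)) k"
    proof (cases "k \<in> multi_indices J")
      case True
      let ?g = "op_power Zpq J k h"
      have Zpq: "Zpq i ?g = op_power Zpq J k (Zpq i h)"
        by (rule op_power_commute[OF J(1)]) (rule commuting_onD[OF commuting_Zpq i])
      have r: "raise i k \<in> multi_indices J" using raise_multi_indices[OF i] True by blast
      have "ell2_nth (mult' (W h)) k = C' (A ?g) + D' (A (op_power Zpq J (raise i k) h))"
        by (simp only: mult'_nth W_nth True r if_True)
      also have "op_power Zpq J (raise i k) h = Zpq i ?g"
        unfolding Zpq by (rule op_power_raise[OF J(1) i commuting_Zpq])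
      also have "C' (A ?g) + D' (A (Zpq i ?g)) = A (Z j ?g)" by (rule rel)
      also have "\<dots> = ell2_nth (W (Z j h)) k" by (simp add: W_nth True op_power_Z[OF j])
      finally show ?thesis .
    next
      case False
      then show ?thesis using nth_in(2)[OF mult'_in[OF W_in]] W_nth by simp
    qed
  qed
  then show ?thesis by (simp add: adj_mult_op W_in)
qed

lemma W_q: "W (Z q h) = adj (hardy J E)
    (mult_op J E (inner_pencil.symbol p (\<lambda>x. U' (P x)) (\<lambda>x. U' (P' x)))) (W h)"
  by (rule W_intertwines[OF pencil_q J(2) pq(2)]) (simp add: UA A_Zq Zpq_def)

lemma W_p: "W (Z p h) = adj (hardy J E)
    (mult_op J E (inner_pencil.symbol p (\<lambda>x. P' (U x)) (\<lambda>x. P (U x)))) (W h)"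
proof (rule W_intertwines[OF pencil_p J(2) pq(1)])
  fix h
  have "U' (P' (A h)) + U' (P (A (Zpq p h))) = U' (B (Z p h))"
    by (simp add: B_Zp Zpq_def bounded_op_add[OF bounded_U(2)] add.commute)
  then show "U' (P' (A h)) + U' (P (A (Zpq p h))) = A (Z p h)" by (simp add: U'B)
qed

lemma W_other:
  assumes i: "i \<in> {1..n}" "i \<noteq> p" "i \<noteq> q"
  shows "W (Z i h) = adj (hardy J E) (mult_op J E (inner_pencil.symbol i (\<lambda>x. 0) (\<lambda>x. x))) (W h)"
  by (rule W_intertwines[OF inner_pencil_coordinate[OF J(1) _ hilbert_E]]) (use i in \<open>auto simp: Zpq_def J_def\<close>)

end

section \<open>The symbols, their products and the resulting tuple\<close>

lemma inner_pencil_symbol_coordinate: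
  fixes E :: "'e::complex_hilbert set"
  assumes "finite J" "i \<in> J" "hilbert_subspace E"
  shows "inner_pencil.symbol i (\<lambda>x :: 'e. 0) (\<lambda>x. x) = (\<lambda>z x. z i *\<^sub>C x)"
  by (simp add: fun_eq_iff inner_pencil.symbol_def[OF inner_pencil_coordinate[OF assms]])

context szego_pair_unitary
begin

definition \<Phi>p :: "(nat \<Rightarrow> complex) \<Rightarrow> (nat, 'h) ell2 \<Rightarrow> (nat, 'h) ell2"
  where "\<Phi>p z x = P' (U x) + z p *\<^sub>C P (U x)"

definition \<Phi>q :: "(nat \<Rightarrow> complex) \<Rightarrow> (nat, 'h) ell2 \<Rightarrow> (nat, 'h) ell2"
  where "\<Phi>q z x = U' (P x) + z p *\<^sub>C U' (P' x)"

lemma symbol_p: "inner_pencil.symbol p (\<lambda>x. P' (U x)) (\<lambda>x. P (U x)) = \<Phi>p"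
  by (simp add: fun_eq_iff \<Phi>p_def inner_pencil.symbol_def[OF pencil_p])

lemma symbol_q: "inner_pencil.symbol p (\<lambda>x. U' (P x)) (\<lambda>x. U' (P' x)) = \<Phi>q"
  by (simp add: fun_eq_iff \<Phi>q_def inner_pencil.symbol_def[OF pencil_q])

lemma \<Phi>_scaleC: "\<Phi>p z (c *\<^sub>C x) = c *\<^sub>C \<Phi>p z x" "\<Phi>q z (c *\<^sub>C x) = c *\<^sub>C \<Phi>q z x"
  by (simp_all add: \<Phi>p_def \<Phi>q_def bounded_op_scaleC[OF bounded_P] bounded_op_scaleC[OF bounded_P']
      bounded_op_scaleC[OF bounded_U(1)] bounded_op_scaleC[OF bounded_U(2)] scaleC_add_right
      scaleC_scaleC mult.commute)

lemma \<Phi>p_\<Phi>q: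
  assumes x: "x \<in> E"
  shows "\<Phi>p z (\<Phi>q z x) = z p *\<^sub>C x"
proof -
  have "\<Phi>q z x = U' (P x + z p *\<^sub>C P' x)"
    by (simp add: \<Phi>q_def bounded_op_add[OF bounded_U(2)] bounded_op_scaleC[OF bounded_U(2)])
  moreover have "P x + z p *\<^sub>C P' x \<in> E"
    by (intro complex_vector.subspace_add[OF subspace_E] complex_vector.subspace_scale[OF subspace_E]
      E_invariant x)
  ultimately have U: "U (\<Phi>q z x) = P x + z p *\<^sub>C P' x" by (simp add: U_U')
  have "\<Phi>p z (\<Phi>q z x) = z p *\<^sub>C P' x + z p *\<^sub>C P x"
    unfolding \<Phi>p_def U
    by (simp add: bounded_op_add[OF bounded_P] bounded_op_add[OF bounded_P'] P_P
        bounded_op_scaleC[OF bounded_P] bounded_op_scaleC[OF bounded_P'])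
  also have "\<dots> = z p *\<^sub>C (P x + P' x)" by (simp add: scaleC_add_right add.commute)
  finally show ?thesis by (simp only: P_plus_P')
qed

lemma \<Phi>q_\<Phi>p:
  assumes x: "x \<in> E"
  shows "\<Phi>q z (\<Phi>p z x) = z p *\<^sub>C x"
proof -
  have "P (\<Phi>p z x) = z p *\<^sub>C P (U x)" "P' (\<Phi>p z x) = P' (U x)"
    unfolding \<Phi>p_def
    by (simp_all add: bounded_op_add[OF bounded_P] bounded_op_add[OF bounded_P'] P_P
        bounded_op_scaleC[OF bounded_P] bounded_op_scaleC[OF bounded_P'])
  then have "\<Phi>q z (\<Phi>p z x) = z p *\<^sub>C U' (P (U x) + P' (U x))"
    by (simp add: \<Phi>q_def bounded_op_scaleC[OF bounded_U(2)] bounded_op_add[OF bounded_U(2)]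
        scaleC_add_right)
  then show ?thesis by (simp only: P_plus_P' U_U' x)
qed

text \<open>One family for all entries of the tuple: purity and the dilation property then follow
  uniformly from the pencil locale, and commutativity from pointwise commutation of the
  symbols.\<close>

definition \<Psi> :: "nat \<Rightarrow> (nat \<Rightarrow> complex) \<Rightarrow> (nat, 'h) ell2 \<Rightarrow> (nat, 'h) ell2"
  where "\<Psi> i = (if i = p then \<Phi>p else if i = q then \<Phi>q else (\<lambda>z x. z i *\<^sub>C x))"

lemma pencil_\<Psi>:
  assumes i: "i \<in> {1..n}"
  obtains j C D C' D' where "inner_pencil J j E C D C' D'" "inner_pencil.symbol j C D = \<Psi> i"
    "\<And>h. W (Z i h) = adj (hardy J E) (mult_op J E (\<Psi> i)) (W h)"
proof -
  consider "i = p" | "i = q" | "i \<noteq> p" "i \<noteq> q" by blast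
  then show thesis
  proof cases
    case 1
    then have \<Psi>: "\<Psi> i = \<Phi>p" by (simp add: \<Psi>_def)
    show thesis
      using W_p by (intro that[OF pencil_p]) (simp_all only: \<Psi> symbol_p, simp_all only: 1)
  next
    case 2
    then have \<Psi>: "\<Psi> i = \<Phi>q" using pq(3) by (simp add: \<Psi>_def)
    show thesis
      using W_q by (intro that[OF pencil_q]) (simp_all only: \<Psi> symbol_q, simp_all only: 2)
  next
    case 3
    then have \<Psi>: "\<Psi> i = (\<lambda>z x. z i *\<^sub>C x)" by (simp add: \<Psi>_def)
    have iJ: "i \<in> J" using i 3 by (simp add: J_def)
    note symbol = inner_pencil_symbol_coordinate[OF J(1) iJ hilbert_E]
    show thesis
      using W_other[OF i 3]
      by (intro that[OF inner_pencil_coordinate[OF J(1) iJ hilbert_E]]) (simp_all only: \<Psi> symbol)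
  qed
qed

lemma pure_isometry_\<Psi>:
  assumes "i \<in> {1..n}"
  shows "pure_isometry (hardy J E) (mult_op J E (\<Psi> i))"
proof -
  obtain j C D C' D' where pencil: "inner_pencil J j E C D C' D'" "inner_pencil.symbol j C D = \<Psi> i"
    by (rule pencil_\<Psi>[OF assms])
  then show ?thesis using inner_pencil.pure_isometry_mult_op by force
qed

lemma mult_op_\<Psi>:
  assumes "i \<in> {1..n}" "f \<in> hardy J E"
  shows "mult_op J E (\<Psi> i) f \<in> hardy J E"
    and "z \<in> polydisc J \<Longrightarrow> hardy_eval J (mult_op J E (\<Psi> i) f) z = \<Psi> i z (hardy_eval J f z)"
proof -
  obtain j C D C' D' where pencil: "inner_pencil J j E C D C' D'" "inner_pencil.symbol j C D = \<Psi> i"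
    by (rule pencil_\<Psi>[OF assms(1)])
  then interpret inner_pencil J j E C D C' D' by simp
  show "mult_op J E (\<Psi> i) f \<in> hardy J E"
    using mult_in[OF assms(2)] mult_op_symbol[OF assms(2)] pencil(2) by simp
  show "hardy_eval J (mult_op J E (\<Psi> i) f) z = \<Psi> i z (hardy_eval J f z)" if "z \<in> polydisc J"
    using hardy_eval_mult_op[OF assms(2) that] pencil(2) by simp
qed

lemma \<Psi>_commute:
  assumes "x \<in> E"
  shows "\<Psi> i z (\<Psi> j z x) = \<Psi> j z (\<Psi> i z x)"
  using assms by (simp add: \<Psi>_def \<Phi>p_\<Phi>q \<Phi>q_\<Phi>p \<Phi>_scaleC scaleC_scaleC mult.commute)

lemma commuting_\<Psi>: "commuting_on (hardy J E) {1..n} (\<lambda>i. mult_op J E (\<Psi> i))"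
  unfolding commuting_on_def
proof (intro ballI)
  fix i j f assume i: "i \<in> {1..n}" and j: "j \<in> {1..n}" and f: "f \<in> hardy J E"
  show "mult_op J E (\<Psi> i) (mult_op J E (\<Psi> j) f) = mult_op J E (\<Psi> j) (mult_op J E (\<Psi> i) f)"
  proof (rule hardy_eval_inject[OF J(1) hilbert_E])
    fix z assume z: "z \<in> polydisc J"
    show "hardy_eval J (mult_op J E (\<Psi> i) (mult_op J E (\<Psi> j) f)) z
        = hardy_eval J (mult_op J E (\<Psi> j) (mult_op J E (\<Psi> i) f)) z"
      using \<Psi>_commute[OF hardy_eval_in[OF hilbert_E f]]
      by (simp only: mult_op_\<Psi>[OF i] mult_op_\<Psi>[OF j] f z)
  qed (intro mult_op_\<Psi> i j f)+
qed

lemma dilates_\<Psi>: "dilates_to n UNIV X (hardy J E) (\<lambda>i. mult_op J E (\<Psi> i))"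
  unfolding dilates_to_def
proof (intro exI[of _ W] conjI ballI isometry_W)
  fix i h assume "i \<in> {1..n}"
  then show "W (Z i h) = adj (hardy J E) (mult_op J E (\<Psi> i)) (W h)" by (rule pencil_\<Psi>) blast
qed

lemma inner_\<Phi>:
  "inner_function J E \<Phi>p" "op_polynomial J E 1 \<Phi>p" "inner_function J E \<Phi>q" "op_polynomial J E 1 \<Phi>q"
  using inner_pencil.inner_function_symbol[OF pencil_p] inner_pencil.op_polynomial_symbol[OF pencil_p]
    inner_pencil.inner_function_symbol[OF pencil_q] inner_pencil.op_polynomial_symbol[OF pencil_q]
  unfolding symbol_p symbol_q by blast+

end

theorem theorem5p4:
  fixes X :: "nat \<Rightarrow> 'h::complex_hilbert \<Rightarrow> 'h" and n p q :: nat
  assumes "p \<in> {1..n}" and "q \<in> {1..n}" and "p \<noteq> q"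
    and "X_class n p q X"
    and "pure_tuple {1..n} X"
    and "finite_rank n p q X"
  shows "let J = {1..n} - {q} in \<exists>(E :: (nat, 'h) ell2 set) \<Phi>\<^sub>p \<Phi>\<^sub>q.
    hilbert_subspace E
    \<and> inner_function J E \<Phi>\<^sub>p \<and> op_polynomial J E 1 \<Phi>\<^sub>p
    \<and> inner_function J E \<Phi>\<^sub>q \<and> op_polynomial J E 1 \<Phi>\<^sub>q
    \<and> (\<forall>z\<in>polydisc J. \<forall>x\<in>E.
        \<Phi>\<^sub>p z (\<Phi>\<^sub>q z x) = z p *\<^sub>C x \<and> \<Phi>\<^sub>q z (\<Phi>\<^sub>p z x) = z p *\<^sub>C x)
    \<and> (let K = hardy J E;
            V = (\<lambda>i. if i = p then mult_op J E \<Phi>\<^sub>p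
                     else if i = q then mult_op J E \<Phi>\<^sub>q
                     else mult_op J E (\<lambda>z x. z i *\<^sub>C x))
        in (\<forall>i\<in>{1..n}. pure_isometry K (V i)) \<and> commuting_on K {1..n} V
          \<and> dilates_to n UNIV X K V)"
proof -
  interpret szego_pair X n p q by unfold_locales (use assms in auto)
  obtain E0 :: "(nat, 'h) ell2 set" where E0: "fin_dim E0" "\<And>h. A h \<in> E0" "\<And>h. B h \<in> E0"
    "\<And>f. f \<in> E0 \<Longrightarrow> P f \<in> E0"
    by (rule fin_dim_range) blast
  obtain U U' where U: "unitary_pair E0 U U'" "\<And>h. U (A h) = B h"
    by (rule isometry_extension[OF E0(1) bounded_A E0(2) bounded_B E0(3) norm_A_B]) blast
  interpret szego_pair_unitary X n p q E0 U U'
    by unfold_locales (use E0 U in auto)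
  have V: "(if i = p then mult_op J E \<Phi>p else if i = q then mult_op J E \<Phi>q
      else mult_op J E (\<lambda>z x. z i *\<^sub>C x)) = mult_op J E (\<Psi> i)" for i
    by (simp add: \<Psi>_def)
  show ?thesis
    unfolding Let_def J_def[symmetric]
    by (rule exI[of _ E], rule exI[of _ \<Phi>p], rule exI[of _ \<Phi>q], unfold V)
      (intro conjI ballI hilbert_E inner_\<Phi> \<Phi>p_\<Phi>q \<Phi>q_\<Phi>p pure_isometry_\<Psi> commuting_\<Psi> dilates_\<Psi>)
qed

end
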